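(* Let $K \subset \mathbb{C}$ be a compact set with connected complement, let $C \in \mathbb{C}$, and let $g:(0,\infty)\to\mathbb{C}$ be a measurable function with $|x g(x)| \leq 1$ for all $x>0$, such that $x \mapsto g(x)e^{-sx}$ is integrable on $(0,\infty)$ for every $s \in K$. Let $f:K\to\mathbb{C}$ be given by $$f(s)=C+\int_0^\infty g(x) e^{-sx}\,dx \qquad (s \in K).$$ Then for any $\varepsilon>0$ there exists some $\delta_0>0$ such that for every $0<\delta\leq \delta_0$ $$\liminf_{T \to \infty} \frac{1}{T} \operatorname{meas} \left\{t \in [0,T] : \max_{s \in K} \left|\log \zeta(1+it+\delta s)-f(s)\right|<\varepsilon \right\}>0.$$
   Context: $\zeta$ denotes the Riemann zeta-function (meromorphically continued to $\mathbb{C}$), and $\operatorname{meas}$ denotes Lebesgue measure on $\mathbb{R}$. "Connected complement" means that $\mathbb{C}\setminus K$ is connected. The function $\log\zeta$ is the usual branch: for $\operatorname{Re}(z)>1$ it is $\log\zeta(z)=-\sum_p \log(1-p^{-z})$ (sum over primes, principal logarithms), and for other $z$ it is obtained by analytic continuation along the horizontal ray $\{z+u: u\ge 0\}$ from the right, whenever that ray contains no zero or pole of $\zeta$. Values of $t$ for which $\log\zeta(1+it+\delta s)$ is undefined for some $s\in K$ are not counted in the set. *)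

theory Defs
  imports
    "HOL-Complex_Analysis.Complex_Analysis"
    "HOL-Computational_Algebra.Primes"
begin

text \<open>
  The Riemann zeta-function is the meromorphic function on the whole plane that agrees with
  its Dirichlet series for \<open>Re s > 1\<close>.  The library predicate \<open>nicely_meromorphic_on\<close> asks for a
  meromorphic function without removable singularities that takes the value 0 at its poles;
  so the description below determines the value at every point, including the junk value
  at the pole 1.
\<close>

definition zeta :: "complex \<Rightarrow> complex" where
  "zeta = (THE f. f nicely_meromorphic_on UNIV \<and>
             (\<forall>s. Re s > 1 \<longrightarrow> f s = (\<Sum>n. of_nat (Suc n) powr (- s))))"

definition log_zeta_euler :: "complex \<Rightarrow> complex" where
  "log_zeta_euler z = - (\<Sum>\<^sub>\<infinity>p\<in>{p::nat. prime p}. Ln (1 - of_nat p powr (- z)))"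

definition right_ray :: "complex \<Rightarrow> complex set" where
  "right_ray z = {z + of_real u |u. u \<ge> 0}"

definition log_zeta_defined :: "complex \<Rightarrow> bool" where
  "log_zeta_defined z \<longleftrightarrow> (\<forall>w\<in>right_ray z. zeta w \<noteq> 0 \<and> \<not> is_pole zeta w)"

text \<open>
  Analytic continuation along the ray: \<open>w\<close> is the value at \<open>z\<close> of a holomorphic function on a
  domain containing the ray that extends the Euler product logarithm.  By the identity theorem,
  followed along the ray from the right, this value does not depend on the choice of the domain.
  For \<open>Re z > 1\<close> the ray never meets a zero or a pole, so \<open>log_zeta_defined z\<close> holds there.
  The value of \<open>log_zeta\<close> is meaningful only where \<open>log_zeta_defined\<close> holds.
\<close>

definition log_zeta :: "complex \<Rightarrow> complex" where
  "log_zeta z =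
     (if Re z > 1 then log_zeta_euler z
      else (THE w. \<exists>U F. open U \<and> connected U \<and> right_ray z \<subseteq> U \<and> F holomorphic_on U \<and>
                         (\<forall>s\<in>U. Re s > 1 \<longrightarrow> F s = log_zeta_euler s) \<and> F z = w))"

end

theory Submission
  imports Defs "HOL-Real_Asymp.Real_Asymp"
begin

text \<open>
  Put \<open>x = \<delta> ln p\<close>.  By Mertens' theorem the measure that gives the prime \<open>p\<close> the weight \<open>1/p\<close> at
  the point \<open>x\<close> tends to \<open>dx/x\<close> as \<open>\<delta> \<rightarrow> 0\<close>, and \<open>p powr (-1 - \<delta>s) = exp (-sx) / p\<close>.  Since \<open>|x g x| \<le> 1\<close>,
  unimodular phases \<open>\<omega> p\<close> can be chosen so that the sum of \<open>\<omega> p * p powr (-1 - \<delta>s)\<close> over the primes with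
  \<open>x\<close> in a short window approximates the integral of \<open>g x * exp (-sx)\<close> over this window; the primes
  with tiny \<open>x\<close> have unbounded total weight and produce the constant \<open>C\<close>.  Hence \<open>f\<close> is close to
  the logarithm of a finite Euler product, twisted by \<open>\<omega>\<close>, over the primes up to some \<open>M\<close>.

  It remains to find many \<open>t\<close> for which \<open>p powr (-it)\<close> is close to \<open>\<omega> p\<close> for all \<open>p \<le> M\<close> while the
  zeta-function without its Euler factors up to \<open>M\<close> is close to 1.  Multiply the latter minus 1 by
  a Dirichlet polynomial over \<open>M\<close>-smooth numbers whose absolute value peaks at the prescribed phases.
  Unique factorization makes the mean square of the product equal to the product of the two mean
  squares, up to a small error, and the second one is a tail of a convergent series.
\<close>

section \<open>Primes in logarithmic windows\<close>

text \<open>The abscissa 7/8 is a compromise: any number above 1/2 makes the mean square over rough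
  numbers small, and 7/8 keeps a crude off-diagonal estimate, of order \<open>T powr (1/2)\<close>
  up to logarithms for sums of length about \<open>T^2\<close>, negligible against T. Moreover log
  zeta is defined through a whole horizontal ray, so closeness to 1 is needed on a half strip: a
  disc covers the part near the line, absolute convergence the rest. The choices are made in the
  order \<delta>, then M (about \<open>exp (b / \<delta>)\<close>) with the phases \<omega>, then
  the tolerance for the phases, then the exponent k of the weight, then T. This is consistent
  because the mean square of the sieved function is measured relative to the mean of the weight: its
  size \<open>M powr (-3/4)\<close> does not depend on k, and k only has to make the weight away
  from the prescribed phases negligible against its mean.\<close>

abbreviation primes_le :: "nat \<Rightarrow> nat set" where
  "primes_le n \<equiv> {p. prime p \<and> p \<le> n}"

lemma finite_primes_le [simp, intro]: "finite (primes_le n)"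
  by simp

section \<open>Chebyshev's bound for the sum of ln p\<close>

lemma prod_primes_dvd:
  fixes m :: nat
  assumes "finite A" "\<And>p. p \<in> A \<Longrightarrow> prime p" "\<And>p. p \<in> A \<Longrightarrow> p dvd m"
  shows "\<Prod>A dvd m"
  using assms
proof (induction A rule: finite_induct)
  case (insert p A)
  have "coprime p (\<Prod>A)"
    using insert by (intro prod_coprime_right) (auto intro: primes_coprime)
  with insert show ?case by (simp add: divides_mult)
qed auto

lemma prime_dvd_central_binomial:
  fixes p n :: nat
  assumes "prime p" "n < p" "p \<le> 2 * n"
  shows "p dvd (2 * n choose n)"
proof -
  have "p dvd fact (2 * n)"
    using assms by (simp add: prime_dvd_fact_iff)
  also have "fact (2 * n) = fact n * fact n * (2 * n choose n)"
    using binomial_fact_lemma[of n "2 * n"] by simp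
  finally show ?thesis
    using assms by (simp add: prime_dvd_mult_iff prime_dvd_fact_iff)
qed

text \<open>Chebyshev's argument: the primes in (n, 2n] all divide the central binomial coefficient,
  which is at most \<open>4 ^ n\<close>.\<close>

lemma theta_double:
  "(\<Sum>p\<in>primes_le (2 * n). ln (real p)) \<le> (\<Sum>p\<in>primes_le n. ln (real p)) + 2 * real n"
proof -
  define A where "A = {p. prime p \<and> n < p \<and> p \<le> 2 * n}"
  have A: "finite A" "\<And>p. p \<in> A \<Longrightarrow> prime p" by (auto simp: A_def)
  have "\<Prod>A dvd (2 * n choose n)"
    by (rule prod_primes_dvd[OF A]) (auto simp: A_def intro!: prime_dvd_central_binomial)
  then have "\<Prod>A \<le> (2 * n choose n)"
    by (rule dvd_imp_le) simp
  also have "\<dots> \<le> 2 ^ (2 * n)" by (rule binomial_le_pow2)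
  finally have le: "real (\<Prod>A) \<le> 2 ^ (2 * n)"
    by (metis of_nat_le_iff of_nat_numeral of_nat_power)
  have "(\<Sum>p\<in>A. ln (real p)) = ln (real (\<Prod>A))"
    using A by (simp add: ln_prod prime_gt_0_nat)
  also have "\<dots> \<le> ln (2 ^ (2 * n))"
    using A le by (subst ln_le_cancel_iff) (auto intro!: prod_pos simp: prime_gt_0_nat)
  also have "\<dots> = 2 * real n * ln 2"
    by (simp add: ln_realpow)
  also have "\<dots> \<le> 2 * real n"
    using ln_2_less_1 by (simp add: mult_left_le)
  finally have "(\<Sum>p\<in>A. ln (real p)) \<le> 2 * real n" .
  moreover have "(\<Sum>p\<in>primes_le (2 * n). ln (real p)) =
      (\<Sum>p\<in>primes_le n. ln (real p)) + (\<Sum>p\<in>A. ln (real p))"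
    by (subst sum.union_disjoint[symmetric]) (auto simp: A_def intro: sum.cong)
  ultimately show ?thesis by simp
qed

lemma theta_le: "(\<Sum>p\<in>primes_le n. ln (real p)) \<le> 7 * real n"
proof (induction n rule: less_induct)
  case (less n)
  show ?case
  proof (cases "n \<le> 1")
    case True
    then have "primes_le n = {}" by (auto dest: prime_gt_1_nat)
    then show ?thesis by (simp only: sum.empty)
  next
    case False
    define m where "m = (n + 1) div 2"
    have m: "m < n" "n \<le> 2 * m" "2 * m \<le> n + 1" using False by (auto simp: m_def)
    have "(\<Sum>p\<in>primes_le n. ln (real p)) \<le> (\<Sum>p\<in>primes_le (2 * m). ln (real p))"
      using m by (intro sum_mono2) (auto simp: Suc_leI prime_gt_0_nat)
    also have "\<dots> \<le> 7 * real m + 2 * real m"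
      using theta_double[of m] less.IH[OF m(1)] by linarith
    \<comment> \<open>The constant 7 absorbs the rounding of the half: 9 m \<le> 9 (n + 1) / 2 \<le>
      7 n as soon as n \<ge> 2.\<close>
    also have "\<dots> \<le> 7 * real n" using m False by simp
    finally show ?thesis .
  qed
qed

section \<open>Mertens' first theorem from the prime factorization of n!\<close>

lemma ln_fact_eq_sum:
  "ln (fact n) = (\<Sum>p\<in>primes_le n. real (multiplicity p (fact n :: nat)) * ln (real p))"
proof -
  have *: "(fact n :: nat) = (\<Prod>p\<in>prime_factors (fact n). p ^ multiplicity p (fact n :: nat))"
    using prime_factorization_nat[of "fact n"] by simp
  have **: "prime_factors (fact n :: nat) = primes_le n"
    by (auto simp: prime_factors_dvd prime_dvd_fact_iff)
  have "ln (fact n :: real) = ln (real (fact n))" by simp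
  also have "\<dots> = ln (\<Prod>p\<in>primes_le n. real p ^ multiplicity p (fact n :: nat))"
    by (subst *, subst **) simp
  also have "\<dots> = (\<Sum>p\<in>primes_le n. real (multiplicity p (fact n :: nat)) * ln (real p))"
    by (subst ln_prod) (auto simp: prime_gt_0_nat ln_realpow)
  finally show ?thesis .
qed

lemma multiplicity_fact_Suc:
  assumes "prime (p::nat)"
  shows "multiplicity p (fact (Suc n) :: nat) = multiplicity p (Suc n) + multiplicity p (fact n :: nat)"
  using assms by (simp del: of_nat_Suc mult_Suc add: prime_elem_multiplicity_mult_distrib)

lemma multiplicity_fact_ge:
  assumes "prime (p::nat)"
  shows "n div p \<le> multiplicity p (fact n :: nat)"
proof (induction n)
  case (Suc n)
  have "Suc n div p \<le> n div p + (if p dvd Suc n then 1 else 0)"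
    by (simp add: div_Suc dvd_eq_mod_eq_0)
  moreover have "(if p dvd Suc n then 1 else 0) \<le> multiplicity p (Suc n)"
    using assms by (simp add: Suc_le_eq prime_multiplicity_gt_zero_iff)
  ultimately show ?case
    using Suc assms by (simp only: multiplicity_fact_Suc)
qed auto

text \<open>Legendre's formula as a recursion: the multiples of p up to n, divided by p, run through
  1, ..., n div p.\<close>

lemma multiplicity_fact_rec:
  assumes "prime (p::nat)"
  shows "multiplicity p (fact n :: nat) = n div p + multiplicity p (fact (n div p) :: nat)"
proof (induction n)
  case (Suc n)
  have p: "p > 0" "\<not> is_unit p" using assms by (auto simp: prime_gt_0_nat)
  show ?case
  proof (cases "p dvd Suc n")
    case True
    then obtain k where k: "Suc n = p * k" by auto
    then have "k > 0" by (metis Zero_not_Suc mult_0_right neq0_conv)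
    have "Suc n div p = Suc (n div p)"
      using True by (simp add: div_Suc dvd_eq_mod_eq_0)
    moreover have "Suc n div p = k" using k p by simp
    moreover have "multiplicity p (Suc n) = Suc (multiplicity p k)"
      unfolding k using \<open>k > 0\<close> p by (intro multiplicity_times_same) auto
    ultimately show ?thesis
      using Suc assms multiplicity_fact_Suc[of p n] multiplicity_fact_Suc[of p "n div p"] by simp
  next
    case False
    then have "Suc n div p = n div p" "multiplicity p (Suc n) = 0"
      by (auto simp: div_Suc dvd_eq_mod_eq_0 not_dvd_imp_multiplicity_0)
    then show ?thesis using Suc assms multiplicity_fact_Suc[of p n] by simp
  qed
qed auto

text \<open>The recursion is dominated by a geometric series; the induction closes because (1 + 1/(p
  - 1)) / p = 1/(p - 1).\<close>

lemma multiplicity_fact_le: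
  assumes "prime (p::nat)"
  shows "real (multiplicity p (fact n :: nat)) \<le> real n / (real p - 1)"
proof (induction n rule: less_induct)
  case (less n)
  have p: "real p > 1" using assms prime_gt_1_nat by simp
  show ?case
  proof (cases "n = 0")
    case False
    then have "n div p < n" using assms prime_gt_1_nat by simp
    from less.IH[OF this] have "real (multiplicity p (fact n :: nat)) \<le> real (n div p) + real (n div p) / (real p - 1)"
      by (subst multiplicity_fact_rec[OF assms]) simp
    also have "\<dots> = real (n div p) * (real p / (real p - 1))"
      using p by (simp add: field_simps)
    also have "\<dots> \<le> real n / real p * (real p / (real p - 1))"
      using p by (intro mult_right_mono of_nat_div_le_of_nat) auto
    also have "\<dots> = real n / (real p - 1)" using p by simp
    finally show ?thesis .
  qed auto
qed

lemma ln_fact_ge: "real n * ln (real n) - real n \<le> ln (fact n)"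
proof (cases "n = 0")
  case False
  \<comment> \<open>The left-hand side is a single term of the exponential series at n.\<close>
  have "real n ^ n / fact n \<le> exp (real n)"
  proof -
    have "(\<Sum>i\<in>{n}. real n ^ i /\<^sub>R fact i) \<le> (\<Sum>i. real n ^ i /\<^sub>R fact i)"
      by (intro sum_le_suminf) (use Transcendental.exp_converges[where x = "real n"] in \<open>auto simp: sums_iff\<close>)
    then show ?thesis by (simp add: exp_def field_simps)
  qed
  then have "ln (real n ^ n / fact n) \<le> ln (exp (real n))"
    using False by (subst ln_le_cancel_iff) auto
  then show ?thesis using False by (simp add: ln_div ln_realpow)
qed auto

lemma ln_fact_le: "ln (fact n) \<le> real n * ln (real n)"
proof (cases "n = 0")
  case False
  have "(fact n :: real) \<le> real n ^ n"
    using fact_le_power[of n, where 'a = real] by simp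
  then have "ln (fact n :: real) \<le> ln (real n ^ n)"
    using False by (subst ln_le_cancel_iff) auto
  then show ?thesis using False by (simp add: ln_realpow)
qed auto

text \<open>The summand is ln n times the excess of 1/(n - 1) over 1/n, the price of bounding
  multiplicities in n! by n/(p - 1).\<close>

lemma summable_prime_correction: "summable (\<lambda>n. ln (real n) / (real n * (real n - 1)))"
proof (rule summable_comparison_test_bigo)
  show "summable (\<lambda>n. norm (real n powr (-3/2)))"
    by (simp add: summable_real_powr_iff)
  show "(\<lambda>n. ln (real n) / (real n * (real n - 1))) \<in> O(\<lambda>n. real n powr (-3/2))"
    by real_asymp
qed

text \<open>Compare n times the sum with ln n!, which is n ln n up to O(n). Bounding the
  multiplicities below by n div p loses at most the sum of ln p, hence 7 n; bounding them above by
  n/(p - 1) adds at most n B with the convergent sum B.\<close>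

lemma mertens_bounds:
  obtains C where "C > 0"
    "\<And>n. n > 0 \<Longrightarrow> \<bar>(\<Sum>p\<in>primes_le n. ln (real p) / real p) - ln (real n)\<bar> \<le> C"
proof -
  define S where "S = (\<lambda>n. \<Sum>p\<in>primes_le n. ln (real p) / real p)"
  define B where "B = (\<Sum>n. ln (real n) / (real n * (real n - 1)))"
  have upper: "S n \<le> ln (real n) + 7" if n: "n > 0" for n
  proof -
    have "real n * S n - 7 * real n \<le> (\<Sum>p\<in>primes_le n. (real n / real p - 1) * ln (real p))"
      using theta_le[of n] by (simp add: S_def algebra_simps sum_subtractf sum_distrib_left)
    also have "\<dots> \<le> ln (fact n)"
      unfolding ln_fact_eq_sum
    proof (intro sum_mono mult_right_mono)
      fix p assume p: "p \<in> primes_le n"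
      have "real n / real p - 1 \<le> real (n div p)"
        using real_of_int_div3[of "int n" "int p"] by (simp flip: zdiv_int)
      also have "\<dots> \<le> real (multiplicity p (fact n :: nat))"
        using p multiplicity_fact_ge by simp
      finally show "real n / real p - 1 \<le> real (multiplicity p (fact n :: nat))" .
      show "ln (real p) \<ge> 0" using p by (auto simp: Suc_leI prime_gt_0_nat)
    qed
    also have "\<dots> \<le> real n * ln (real n)" by (rule ln_fact_le)
    finally have "real n * S n \<le> real n * (ln (real n) + 7)" by (simp add: algebra_simps)
    then show ?thesis using n by simp
  qed
  have lower: "S n \<ge> ln (real n) - 1 - B" if n: "n > 0" for n
  proof -
    have "real n * ln (real n) - real n \<le> ln (fact n)" by (rule ln_fact_ge)
    also have "\<dots> \<le> (\<Sum>p\<in>primes_le n. real n / (real p - 1) * ln (real p))"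
      unfolding ln_fact_eq_sum
      by (intro sum_mono mult_right_mono multiplicity_fact_le) (auto simp: Suc_leI prime_gt_0_nat)
    also have "\<dots> = real n * (\<Sum>p\<in>primes_le n. ln (real p) / real p + ln (real p) / (real p * (real p - 1)))"
      unfolding sum_distrib_left
      by (intro sum.cong) (auto simp: divide_simps algebra_simps dest: prime_gt_1_nat)
    also have "\<dots> = real n * (S n + (\<Sum>p\<in>primes_le n. ln (real p) / (real p * (real p - 1))))"
      by (simp add: S_def sum.distrib)
    finally have le: "real n * ln (real n) - real n \<le> real n * (S n + (\<Sum>p\<in>primes_le n. ln (real p) / (real p * (real p - 1))))" .
    have "(\<Sum>p\<in>primes_le n. ln (real p) / (real p * (real p - 1))) \<le> B"
      unfolding B_def
    proof (intro sum_le_suminf summable_prime_correction ballI)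
      fix m assume "m \<in> - primes_le n"
      show "0 \<le> ln (real m) / (real m * (real m - 1))"
        \<comment> \<open>For m = 0 and m = 1 the denominator is 0, so the quotient is 0 by
          convention.\<close>
        by (cases "m \<le> 1") (auto simp: le_Suc_eq)
    qed auto
    then have "real n * (S n + (\<Sum>p\<in>primes_le n. ln (real p) / (real p * (real p - 1)))) \<le> real n * (S n + B)"
      by (intro mult_left_mono) auto
    with le have "real n * (ln (real n) - 1 - B) \<le> real n * S n" by (simp add: algebra_simps)
    then show ?thesis using n by simp
  qed
  show ?thesis
  proof (rule that[of "\<bar>B\<bar> + 7"])
    fix n :: nat assume "n > 0"
    then show "\<bar>(\<Sum>p\<in>primes_le n. ln (real p) / real p) - ln (real n)\<bar> \<le> \<bar>B\<bar> + 7"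
      using upper[of n] lower[of n] unfolding S_def abs_le_iff by linarith
  qed auto
qed

section \<open>Mertens' theorem in windows of ln p\<close>

definition primes_window :: "real \<Rightarrow> real \<Rightarrow> nat set" where
  "primes_window x y = {p. prime p \<and> x < ln (real p) \<and> ln (real p) \<le> y}"

lemma ln_le_iff_le_exp: "prime (p::nat) \<Longrightarrow> ln (real p) \<le> y \<longleftrightarrow> p \<le> nat \<lfloor>exp y\<rfloor>"
proof -
  assume "prime p"
  then have "p > 0" by (rule prime_gt_0_nat)
  then have "ln (real p) \<le> y \<longleftrightarrow> real p \<le> exp y"
    by (metis exp_ge_zero exp_le_cancel_iff exp_ln of_nat_0_less_iff)
  also have "\<dots> \<longleftrightarrow> p \<le> nat \<lfloor>exp y\<rfloor>"
    using exp_gt_zero[of y] by linarith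
  finally show ?thesis .
qed

lemma primes_ln_le_eq: "{p. prime p \<and> ln (real p) \<le> y} = primes_le (nat \<lfloor>exp y\<rfloor>)"
  using ln_le_iff_le_exp by blast

lemma finite_primes_window [simp, intro]: "finite (primes_window x y)"
  by (rule finite_subset[of _ "primes_le (nat \<lfloor>exp y\<rfloor>)"])
     (auto simp: primes_window_def ln_le_iff_le_exp)

lemma primes_window_disjoint: "y \<le> x' \<Longrightarrow> primes_window x y \<inter> primes_window x' y' = {}"
  by (auto simp: primes_window_def)

lemma primes_window_Un: "x \<le> y \<Longrightarrow> y \<le> z \<Longrightarrow> primes_window x y \<union> primes_window y z = primes_window x z"
  by (auto simp: primes_window_def)

lemma mertens_window:
  obtains C where "C > 0"
    "\<And>x y. 0 \<le> x \<Longrightarrow> x \<le> y \<Longrightarrow> \<bar>(\<Sum>p\<in>primes_window x y. ln (real p) / real p) - (y - x)\<bar> \<le> C"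
proof -
  obtain C where C: "C > 0"
    "\<And>n. n > 0 \<Longrightarrow> \<bar>(\<Sum>p\<in>primes_le n. ln (real p) / real p) - ln (real n)\<bar> \<le> C"
    using mertens_bounds by blast
  define S where "S = (\<lambda>y::real. \<Sum>p\<in>primes_le (nat \<lfloor>exp y\<rfloor>). ln (real p) / real p)"
  have S: "\<bar>S y - y\<bar> \<le> C + 1" if "y \<ge> 0" for y :: real
  proof -
    define n where "n = nat \<lfloor>exp y\<rfloor>"
    have "1 \<le> exp y" using that by simp
    then have n: "n > 0" "real n \<le> exp y" "exp y \<le> real n + 1"
      unfolding n_def by (auto simp: le_nat_iff)
    have "ln (real n) \<le> y"
      using n by (metis ln_exp ln_le_cancel_iff exp_gt_zero of_nat_0_less_iff)
    \<comment> \<open>Rounding \<open>exp y\<close> down to n at most halves it, which costs ln 2 <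
      1: the extra 1 in the error.\<close>
    moreover have "y \<le> ln (2 * real n)"
    proof -
      have "exp y \<le> 2 * real n" using n by linarith
      then show ?thesis using n by (simp add: ln_ge_iff)
    qed
    then have "y \<le> ln (real n) + 1"
      using n ln_2_less_1 by (simp add: ln_mult)
    ultimately show ?thesis
      using C(2)[OF n(1)] unfolding S_def n_def[symmetric] abs_le_iff by linarith
  qed
  show ?thesis
  proof (rule that[of "2 * (C + 1)"])
    fix x y :: real assume xy: "0 \<le> x" "x \<le> y"
    have "S y = S x + (\<Sum>p\<in>primes_window x y. ln (real p) / real p)"
    proof -
      have eq: "primes_le (nat \<lfloor>exp y\<rfloor>) = primes_le (nat \<lfloor>exp x\<rfloor>) \<union> primes_window x y"
        unfolding primes_ln_le_eq[symmetric] primes_window_def using xy by auto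
      show ?thesis unfolding S_def eq
        by (rule sum.union_disjoint[OF finite_primes_le finite_primes_window])
           (auto simp: primes_ln_le_eq[symmetric] primes_window_def)
    qed
    then have "(\<Sum>p\<in>primes_window x y. ln (real p) / real p) - (y - x) = (S y - y) - (S x - x)"
      by simp
    then show "\<bar>(\<Sum>p\<in>primes_window x y. ln (real p) / real p) - (y - x)\<bar> \<le> 2 * (C + 1)"
      using S[OF xy(1)] S[OF order_trans[OF xy]] abs_triangle_ineq4[of "S y - y" "S x - x"] by simp
  qed (use C in auto)
qed

text \<open>The error terms of the approximation are reduced to sums of ln p / p, which need an
  upper bound; the supply of weight 1/p only needs a lower bound, which follows from ln p \<le> y in
  the window.\<close>

lemma sum_inverse_primes_window:
  obtains C where "C > 0"
    "\<And>x y. 0 \<le> x \<Longrightarrow> x \<le> y \<Longrightarrow> (\<Sum>p\<in>primes_window x y. ln (real p) / real p) \<le> y - x + C"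
    "\<And>x y. 0 \<le> x \<Longrightarrow> x \<le> y \<Longrightarrow> 0 < y \<Longrightarrow> (y - x - C) / y \<le> (\<Sum>p\<in>primes_window x y. 1 / real p)"
proof -
  obtain C where C: "C > 0"
    "\<And>x y. 0 \<le> x \<Longrightarrow> x \<le> y \<Longrightarrow> \<bar>(\<Sum>p\<in>primes_window x y. ln (real p) / real p) - (y - x)\<bar> \<le> C"
    using mertens_window by blast
  show ?thesis
  proof (rule that[of C])
    fix x y :: real assume xy: "0 \<le> x" "x \<le> y"
    show "(\<Sum>p\<in>primes_window x y. ln (real p) / real p) \<le> y - x + C"
      using C(2)[OF xy] by linarith
  next
    fix x y :: real assume xy: "0 \<le> x" "x \<le> y" "0 < y"
    have "(\<Sum>p\<in>primes_window x y. ln (real p) / real p) \<le> (\<Sum>p\<in>primes_window x y. y * (1 / real p))"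
      by (intro sum_mono) (auto simp: primes_window_def divide_simps dest: prime_gt_0_nat)
    also have "\<dots> = y * (\<Sum>p\<in>primes_window x y. 1 / real p)"
      by (rule sum_distrib_left[symmetric])
    finally show "(y - x - C) / y \<le> (\<Sum>p\<in>primes_window x y. 1 / real p)"
      using C(2)[OF xy(1,2)] xy unfolding abs_le_iff by (simp add: pos_divide_le_eq mult.commute)
  qed (use C in auto)
qed

lemma sum_inverse_primes_unbounded:
  assumes "x \<ge> 0"
  shows "\<exists>Y\<ge>x. \<forall>y\<ge>Y. B \<le> (\<Sum>p\<in>primes_window x y. 1 / real p)"
proof -
  obtain C where C: "C > 0"
    "\<And>x y. 0 \<le> x \<Longrightarrow> x \<le> y \<Longrightarrow> 0 < y \<Longrightarrow> (y - x - C) / y \<le> (\<Sum>p\<in>primes_window x y. 1 / real p)"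
    using sum_inverse_primes_window by metis
  have "\<exists>Y\<ge>x. real n / 2 \<le> (\<Sum>p\<in>primes_window x Y. 1 / real p)" for n
  proof (induction n)
    case (Suc n)
    then obtain Y where Y: "Y \<ge> x" "real n / 2 \<le> (\<Sum>p\<in>primes_window x Y. 1 / real p)" by blast
    \<comment> \<open>This makes the lower bound (Z - Y - C) / Z equal to 1/2, so every further
      window adds at least 1/2.\<close>
    define Z where "Z = 2 * (Y + C)"
    have Z: "Z \<ge> Y" "Z > 0" "Z - Y - C = Z / 2" using assms Y C by (auto simp: Z_def)
    have "1 / 2 \<le> (\<Sum>p\<in>primes_window Y Z. 1 / real p)"
      using C(2)[of Y Z] Z assms Y by simp
    moreover have "(\<Sum>p\<in>primes_window x Z. 1 / real p) =
        (\<Sum>p\<in>primes_window x Y. 1 / real p) + (\<Sum>p\<in>primes_window Y Z. 1 / real p)"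
      unfolding primes_window_Un[OF Y(1) Z(1), symmetric]
      by (rule sum.union_disjoint) (simp_all add: primes_window_disjoint)
    ultimately show ?case using Y Z by (intro exI[of _ Z]) (simp add: field_simps)
  qed (auto intro!: exI[of _ x] sum_nonneg)
  then obtain Y where Y: "Y \<ge> x" "real (nat \<lceil>2 * B\<rceil>) / 2 \<le> (\<Sum>p\<in>primes_window x Y. 1 / real p)"
    by blast
  have "B \<le> (\<Sum>p\<in>primes_window x Y. 1 / real p)" using Y(2) by linarith
  also have "\<dots> \<le> (\<Sum>p\<in>primes_window x y. 1 / real p)" if "y \<ge> Y" for y
    by (intro sum_mono2 finite_primes_window) (use that in \<open>auto simp: primes_window_def\<close>)
  finally show ?thesis using Y(1) by blast
qed

section \<open>Continuation of the zeta-function\<close>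

lemma holomorphic_suminf:
  fixes f :: "nat \<Rightarrow> complex \<Rightarrow> complex"
  assumes "open S" and hol: "\<And>n. f n holomorphic_on S"
    and bound: "\<And>z. z \<in> S \<Longrightarrow> \<exists>d>0. \<exists>M. cball z d \<subseteq> S \<and> summable M \<and>
                  (\<forall>n. \<forall>w\<in>cball z d. norm (f n w) \<le> M n)"
  shows "(\<lambda>z. \<Sum>n. f n z) holomorphic_on S"
proof (rule holomorphic_uniform_sequence[OF \<open>open S\<close>])
  show "(\<lambda>z. \<Sum>n<N. f n z) holomorphic_on S" for N
    by (intro holomorphic_intros hol)
  show "\<exists>d>0. cball z d \<subseteq> S \<and>
          uniform_limit (cball z d) (\<lambda>N z. \<Sum>n<N. f n z) (\<lambda>z. \<Sum>n. f n z) sequentially"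
    if z: "z \<in> S" for z
  proof -
    obtain d M where "d > 0" "cball z d \<subseteq> S" "summable M" "\<forall>n. \<forall>w\<in>cball z d. norm (f n w) \<le> M n"
      using bound[OF z] by blast
    then show ?thesis
      by (intro exI[of _ d] conjI Weierstrass_m_test) auto
  qed
qed

abbreviation zeta_series :: "complex \<Rightarrow> complex" where
  "zeta_series s \<equiv> (\<Sum>n. of_nat (Suc n) powr (- s))"

lemma norm_of_nat_powr: "n > 0 \<Longrightarrow> norm (of_nat n powr s :: complex) = real n powr Re s"
  by (simp add: norm_powr_real_powr)

lemma summable_real_powr_Suc: "a < -1 \<Longrightarrow> summable (\<lambda>n. real (Suc n) powr a)"
  using summable_Suc_iff[of "\<lambda>n. real n powr a"] summable_real_powr_iff[of a] by simp

lemma summable_zeta_series: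
  assumes "Re s > 1"
  shows "summable (\<lambda>n. of_nat (Suc n) powr (- s))"
  by (rule summable_norm_cancel)
     (use assms summable_real_powr_Suc[of "- Re s"] in \<open>simp add: norm_of_nat_powr del: of_nat_Suc\<close>)

text \<open>The falling factorial of 1 - s, that is, the constant factor of the j-th derivative of
  \<open>z powr (1 - s)\<close>.\<close>

definition falling :: "nat \<Rightarrow> complex \<Rightarrow> complex" where
  "falling j s = (\<Prod>i<j. (1 - s - of_nat i))"

text \<open>The remainder of the Taylor polynomial of degree k of \<open>z powr (1 - s)\<close> at
  the integer \<open>Suc m\<close>, for an increment of 1.\<close>

definition zeta_rem :: "nat \<Rightarrow> nat \<Rightarrow> complex \<Rightarrow> complex" where
  "zeta_rem k m s = of_nat (Suc (Suc m)) powr (1 - s) -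
     (\<Sum>j\<le>k. falling j s * of_nat (Suc m) powr (1 - s - of_nat j) / fact j)"

lemma falling_0 [simp]: "falling 0 s = 1"
  and falling_Suc: "falling (Suc j) s = falling j s * (1 - s - of_nat j)"
  by (simp_all add: falling_def)

text \<open>The hypothesis makes the real exponent in the derivative of order k + 1 nonpositive, so
  this derivative is largest at the left end of the unit segment.\<close>

lemma norm_zeta_rem_le:
  assumes "Re s \<ge> - real k"
  shows "norm (zeta_rem k m s) \<le> norm (falling (Suc k) s) * real (Suc m) powr (- Re s - real k)"
proof -
  define S :: "complex set" where "S = closed_segment (of_nat (Suc m)) (of_nat (Suc (Suc m)))"
  define f where "f = (\<lambda>i z. falling i s * z powr (1 - s - of_nat i))"
  have S: "\<exists>x. z = of_real x \<and> x \<ge> real (Suc m)" if "z \<in> S" for z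
  proof -
    have "\<exists>u\<ge>0. u \<le> 1 \<and> z = (1 - u) *\<^sub>R of_nat (Suc m) + u *\<^sub>R of_nat (Suc (Suc m))"
      using that unfolding S_def closed_segment_def by blast
    then obtain u where u: "0 \<le> u" "u \<le> 1"
      "z = (1 - u) *\<^sub>R of_nat (Suc m) + u *\<^sub>R of_nat (Suc (Suc m))"
      by (elim exE conjE)
    then have "z = of_real (real (Suc m) + u)"
      by (simp add: scaleR_conv_of_real algebra_simps)
    with u(1) show ?thesis by (intro exI[of _ "real (Suc m) + u"]) simp
  qed
  have der: "(f i has_field_derivative f (Suc i) z) (at z within S)" if "z \<in> S" for i z
  proof -
    obtain x where x: "z = of_real x" "x \<ge> real (Suc m)" using S[OF \<open>z \<in> S\<close>] by blast
    then have "z \<notin> \<real>\<^sub>\<le>\<^sub>0" by (auto simp: complex_nonpos_Reals_iff)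
    then have "((\<lambda>z. z powr (1 - s - of_nat i)) has_field_derivative
        (1 - s - of_nat i) * z powr (1 - s - of_nat i - 1)) (at z)"
      by (rule has_field_derivative_powr)
    then have "(f i has_field_derivative falling i s * ((1 - s - of_nat i) * z powr (1 - s - of_nat i - 1))) (at z)"
      unfolding f_def by (rule DERIV_cmult)
    then show ?thesis
      unfolding f_def falling_Suc by (rule has_field_derivative_at_within[THEN DERIV_cong]) (simp add: algebra_simps)
  qed
  have bd: "norm (f (Suc k) z) \<le> norm (falling (Suc k) s) * real (Suc m) powr (- Re s - real k)"
    if "z \<in> S" for z
  proof -
    obtain x where x: "z = of_real x" "x \<ge> real (Suc m)" using S[OF \<open>z \<in> S\<close>] by blast
    then have "norm (z powr (1 - s - of_nat (Suc k))) = x powr (- Re s - real k)"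
      using norm_powr_real_powr[of z] by simp
    also have "\<dots> \<le> real (Suc m) powr (- Re s - real k)"
      using x assms by (intro powr_mono2') auto
    finally show ?thesis
      unfolding f_def norm_mult by (intro mult_left_mono) auto
  qed
  have "norm (f 0 (of_nat (Suc (Suc m))) - (\<Sum>i\<le>k. f i (of_nat (Suc m)) *
          (of_nat (Suc (Suc m)) - of_nat (Suc m)) ^ i / fact i))
        \<le> norm (falling (Suc k) s) * real (Suc m) powr (- Re s - real k) *
           norm (of_nat (Suc (Suc m)) - of_nat (Suc m) :: complex) ^ Suc k / fact k"
    by (rule complex_Taylor[where S = S]) (use der bd in \<open>auto simp: S_def\<close>)
  also have "\<dots> = norm (falling (Suc k) s) * real (Suc m) powr (- Re s - real k) / fact k"
    by simp
  also have "\<dots> \<le> norm (falling (Suc k) s) * real (Suc m) powr (- Re s - real k)"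
    using mult_left_mono[OF fact_ge_1[of k, where 'a = real], of "norm (falling (Suc k) s) * real (Suc m) powr (- Re s - real k)"]
    by (simp add: divide_le_eq del: of_nat_Suc)
  finally show ?thesis
    by (simp add: zeta_rem_def f_def)
qed

text \<open>The two powers with exponent 1 - s telescope to -1; the terms with j \<ge> 1 form
  convergent Dirichlet series at s + j - 1.\<close>

lemma zeta_rem_sums:
  assumes "Re s > 1"
  shows "(\<lambda>m. zeta_rem k m s) sums
           (- 1 - (\<Sum>j\<in>{1..k}. falling j s / fact j * zeta_series (s + of_nat j - 1)))"
proof -
  have lim: "(\<lambda>m. of_nat (Suc m) powr (1 - s) :: complex) \<longlonglongrightarrow> 0"
  proof (rule tendsto_norm_zero_cancel)
    have "(\<lambda>m. real (Suc m) powr (1 - Re s)) \<longlonglongrightarrow> 0"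
      using assms by real_asymp
    then show "(\<lambda>m. norm (of_nat (Suc m) powr (1 - s) :: complex)) \<longlonglongrightarrow> 0"
      by (simp add: norm_of_nat_powr del: of_nat_Suc)
  qed
  have 1: "(\<lambda>m. of_nat (Suc (Suc m)) powr (1 - s) - of_nat (Suc m) powr (1 - s) :: complex) sums (0 - 1)"
    using telescope_sums[OF lim] by simp
  have 2: "(\<lambda>m. \<Sum>j\<in>{1..k}. falling j s / fact j * of_nat (Suc m) powr (- (s + of_nat j - 1))) sums
     (\<Sum>j\<in>{1..k}. falling j s / fact j * zeta_series (s + of_nat j - 1))"
    using assms by (intro sums_sum sums_mult summable_sums summable_zeta_series) auto
  have "zeta_rem k m s = (of_nat (Suc (Suc m)) powr (1 - s) - of_nat (Suc m) powr (1 - s))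
     - (\<Sum>j\<in>{1..k}. falling j s / fact j * of_nat (Suc m) powr (- (s + of_nat j - 1)))" for m
  proof -
    have "{..k} = insert 0 {1..k}" by auto
    then show ?thesis
      unfolding zeta_rem_def by (simp add: algebra_simps)
  qed
  with sums_diff[OF 1 2] show ?thesis by simp
qed

text \<open>
  Summing the Taylor expansion of \<open>(n + 1) powr (1 - s)\<close> at \<open>n\<close> over all \<open>n\<close> expresses the value at \<open>s\<close>
  by the values at \<open>s + 1, \<dots>, s + k\<close>, so that each step continues the function by one unit to the left.
\<close>

lemma zeta_series_recursion:
  assumes "Re s > 1"
  shows "(s - 1) * zeta_series s = 1 + (\<Sum>m. zeta_rem (Suc k) m s)
     - (\<Sum>j\<in>{1..k}. falling j s / fact (Suc j) * ((s + of_nat j - 1) * zeta_series (s + of_nat j)))"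
proof -
  have "(\<Sum>m. zeta_rem (Suc k) m s) = - 1 - (\<Sum>j\<in>{1..Suc k}. falling j s / fact j * zeta_series (s + of_nat j - 1))"
    using zeta_rem_sums[OF assms] by (rule sums_unique[symmetric])
  also have "(\<Sum>j\<in>{1..Suc k}. falling j s / fact j * zeta_series (s + of_nat j - 1)) =
     (\<Sum>j\<in>{0..k}. falling (Suc j) s / fact (Suc j) * zeta_series (s + of_nat (Suc j) - 1))"
    unfolding One_nat_def sum.shift_bounds_cl_Suc_ivl ..
  also have "\<dots> = falling 1 s * zeta_series s +
      (\<Sum>j\<in>{1..k}. falling (Suc j) s / fact (Suc j) * zeta_series (s + of_nat (Suc j) - 1))"
    by (simp add: sum.atLeast_Suc_atMost del: of_nat_Suc fact_Suc) simp
  \<comment> \<open>The last factor of \<open>falling (Suc j) s\<close> is -(s + j - 1), which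
    cancels the pole of the zeta value at s + j.\<close>
  also have "(\<Sum>j\<in>{1..k}. falling (Suc j) s / fact (Suc j) * zeta_series (s + of_nat (Suc j) - 1)) =
      - (\<Sum>j\<in>{1..k}. falling j s / fact (Suc j) * ((s + of_nat j - 1) * zeta_series (s + of_nat j)))"
    unfolding sum_negf[symmetric]
  proof (rule sum.cong[OF refl])
    fix j
    have "s + of_nat (Suc j) - 1 = s + of_nat j" by simp
    then show "falling (Suc j) s / fact (Suc j) * zeta_series (s + of_nat (Suc j) - 1) =
      - (falling j s / fact (Suc j) * ((s + of_nat j - 1) * zeta_series (s + of_nat j)))"
      unfolding falling_Suc by (simp only:) (simp add: divide_simps, simp add: algebra_simps)
  qed
  finally show ?thesis
    by (simp add: falling_def algebra_simps)
qed

lemma suminf_zeta_rem_holomorphic: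
  "(\<lambda>s. \<Sum>m. zeta_rem k m s) holomorphic_on {s. Re s > 1 - real k}"
proof (rule holomorphic_suminf)
  show "open {s. Re s > 1 - real k}" by (rule open_halfspace_Re_gt)
  show "zeta_rem k m holomorphic_on {s. Re s > 1 - real k}" for m
    unfolding zeta_rem_def [abs_def] falling_def by (intro holomorphic_intros) auto
next
  fix z assume z: "z \<in> {s. Re s > 1 - real k}"
  define d where "d = (Re z - (1 - real k)) / 2"
  have "d > 0" using z by (simp add: d_def)
  have Re: "Re w \<ge> 1 - real k + d" if "w \<in> cball z d" for w
  proof -
    have "\<bar>Re z - Re w\<bar> \<le> d"
      using that abs_Re_le_cmod[of "z - w"] by (simp add: dist_norm)
    then show ?thesis using abs_ge_self[of "Re z - Re w"] unfolding d_def by argo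
  qed
  have "compact (falling (Suc k) ` cball z d)"
    unfolding falling_def by (intro compact_continuous_image continuous_intros) auto
  then obtain B where B: "\<And>w. w \<in> cball z d \<Longrightarrow> norm (falling (Suc k) w) \<le> B"
    by (meson bounded_iff compact_imp_bounded image_eqI)
  show "\<exists>d>0. \<exists>M. cball z d \<subseteq> {s. Re s > 1 - real k} \<and> summable M \<and>
          (\<forall>n. \<forall>w\<in>cball z d. norm (zeta_rem k n w) \<le> M n)"
  proof (intro exI conjI allI ballI)
    show "d > 0" by fact
    show "cball z d \<subseteq> {s. Re s > 1 - real k}" using Re \<open>d > 0\<close> by force
    show "summable (\<lambda>n. B * real (Suc n) powr (- 1 - d))"
      using \<open>d > 0\<close> by (intro summable_mult summable_real_powr_Suc) auto
    fix n w assume w: "w \<in> cball z d"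
    have "norm (zeta_rem k n w) \<le> norm (falling (Suc k) w) * real (Suc n) powr (- Re w - real k)"
      using Re[OF w] \<open>d > 0\<close> by (intro norm_zeta_rem_le) simp
    also have "\<dots> \<le> B * real (Suc n) powr (- 1 - d)"
      using Re[OF w] B[OF w] order_trans[OF norm_ge_zero B[OF w]] by (intro mult_mono powr_mono) auto
    finally show "norm (zeta_rem k n w) \<le> B * real (Suc n) powr (- 1 - d)" .
  qed
qed

text \<open>Continuing (s - 1) zeta(s) instead of zeta(s) avoids the pole, so the shifted values in
  the recursion are holomorphic on the whole new half-plane.\<close>

lemma zeta_continuation_halfplane:
  "\<exists>E. E holomorphic_on {s. Re s > - real k} \<and> (\<forall>s. Re s > 1 \<longrightarrow> E s = (s - 1) * zeta_series s)"
proof (induction k)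
  case 0
  show ?case
    using suminf_zeta_rem_holomorphic[of 1] zeta_series_recursion[of _ 0]
    by (intro exI[of _ "\<lambda>s. 1 + (\<Sum>m. zeta_rem (Suc 0) m s)"]) (auto intro!: holomorphic_intros)
next
  case (Suc k)
  then obtain E where E: "E holomorphic_on {s. Re s > - real k}"
    "\<And>s. Re s > 1 \<Longrightarrow> E s = (s - 1) * zeta_series s" by blast
  define E' where "E' = (\<lambda>s. 1 + (\<Sum>m. zeta_rem (Suc (Suc k)) m s)
     - (\<Sum>j\<in>{1..Suc k}. falling j s / fact (Suc j) * E (s + of_nat j)))"
  have shift: "(\<lambda>s. E (s + of_nat j)) holomorphic_on {s. Re s > - real (Suc k)}" if "j \<in> {1..Suc k}" for j
    by (rule holomorphic_on_compose_gen[OF _ E(1), unfolded o_def])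
       (use that in \<open>auto intro!: holomorphic_intros\<close>)
  have "(\<lambda>s. \<Sum>m. zeta_rem (Suc (Suc k)) m s) holomorphic_on {s. Re s > - real (Suc k)}"
    using suminf_zeta_rem_holomorphic[of "Suc (Suc k)"] by simp
  then have "E' holomorphic_on {s. Re s > - real (Suc k)}"
    unfolding E'_def falling_def using shift by (intro holomorphic_intros) auto
  moreover have "E' s = (s - 1) * zeta_series s" if "Re s > 1" for s
  proof -
    have "E (s + of_nat j) = (s + of_nat j - 1) * zeta_series (s + of_nat j)" for j
      using that by (intro E(2)) auto
    then show ?thesis
      unfolding E'_def zeta_series_recursion[OF that, of "Suc k"] by simp
  qed
  ultimately show ?case by blast
qed

lemma zeta_continuation_entire:
  obtains E where "E holomorphic_on UNIV" "\<And>s. Re s > 1 \<Longrightarrow> E s = (s - 1) * zeta_series s"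
proof -
  obtain F where hol: "\<And>k. F k holomorphic_on {s. Re s > - real k}"
    and eq: "\<And>k s. Re s > 1 \<Longrightarrow> F k s = (s - 1) * zeta_series s"
    using zeta_continuation_halfplane by metis
  have agree: "F j s = F k s" if jk: "j \<le> k" and s: "Re s > - real j" for j k s
  proof (rule analytic_continuation_open[of "{s. Re s > 1}" "{s. Re s > - real j}" "F j" "F k"])
    show "{s. Re s > 1} \<noteq> {}" by (auto intro: exI[of _ 2])
    show "connected {s. Re s > - real j}"
      by (intro convex_connected convex_halfspace_Re_gt)
    show "F k holomorphic_on {s. Re s > - real j}"
      by (rule holomorphic_on_subset[OF hol[of k]]) (use jk in auto)
  qed (use s hol eq in \<open>auto intro: open_halfspace_Re_gt\<close>)
  define n where "n = (\<lambda>s. nat \<lceil>1 - Re s\<rceil>)"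
  have n: "Re s > - real (n s)" for s
    unfolding n_def by linarith
  have E: "F (n s) s = F k s" if "Re s > - real k" for s k
  proof (cases "n s \<le> k")
    case True
    then show ?thesis using agree n by blast
  next
    case False
    then have "k \<le> n s" by simp
    then show ?thesis using agree that by metis
  qed
  have "(\<lambda>s. F (n s) s) holomorphic_on {s. Re s > - real k}" for k
    using hol[of k] by (rule holomorphic_transform) (use E in auto)
  then have "(\<lambda>s. F (n s) s) holomorphic_on (\<Union>k. {s. Re s > - real k})"
    by (intro holomorphic_on_UN_open open_halfspace_Re_gt)
  also have "(\<Union>k. {s. Re s > - real k}) = UNIV" using n by auto
  finally show ?thesis using eq that by blast
qed

text \<open>After removal of its singularities the difference vanishes identically, so f and g agree
  on a punctured neighbourhood of every point. There a nicely meromorphic function has no freedom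
  left: its value is the limit, or 0 at a pole.\<close>

lemma nicely_meromorphic_eqI:
  assumes f: "f nicely_meromorphic_on UNIV" and g: "g nicely_meromorphic_on UNIV"
    and "open S" "S \<noteq> {}" and eq: "\<And>z. z \<in> S \<Longrightarrow> f z = g z"
  shows "f = g"
proof
  fix z
  obtain z0 where "z0 \<in> S" using \<open>S \<noteq> {}\<close> by blast
  have "eventually (\<lambda>w. w \<in> S) (at z0)"
    using \<open>open S\<close> \<open>z0 \<in> S\<close> by (rule eventually_at_in_open')
  then have "eventually (\<lambda>w. f w - g w = 0) (at z0)"
    by eventually_elim (simp add: eq)
  define h where "h = remove_sings (\<lambda>w. f w - g w)"
  have mero: "(\<lambda>w. f w - g w) meromorphic_on UNIV"
    using f g unfolding nicely_meromorphic_on_def by (intro meromorphic_intros) auto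
  have h: "eventually (\<lambda>w. h w = f w - g w) (at w)" for w
    unfolding h_def using mero
    by (intro eventually_remove_sings_eq_at meromorphic_on_isolated_singularity)
       (auto elim: meromorphic_on_subset)
  have "eventually (\<lambda>w. h w = 0) (at z0)"
    using \<open>eventually (\<lambda>w. f w - g w = 0) (at z0)\<close> h[of z0] by eventually_elim simp
  then have "frequently (\<lambda>w. h w = 0) (at z0)"
    by (rule eventually_frequently[OF at_neq_bot])
  moreover have "h nicely_meromorphic_on UNIV"
    unfolding h_def using mero by (rule remove_sings_nicely_meromorphic)
  ultimately have h0: "h w = 0" for w
    by (rule frequently_eq_meromorphic_imp_constant) auto
  have ev: "eventually (\<lambda>w. f w = g w) (at z)"
    using h[of z] by eventually_elim (simp add: h0)
  have cong: "is_pole f z \<longleftrightarrow> is_pole g z" "(f \<midarrow>z\<rightarrow> c) \<longleftrightarrow> (g \<midarrow>z\<rightarrow> c)" for c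
    using ev by (intro is_pole_cong filterlim_cong refl; simp)+
  have fz: "(is_pole f z \<and> f z = 0) \<or> f \<midarrow>z\<rightarrow> f z" and gz: "(is_pole g z \<and> g z = 0) \<or> g \<midarrow>z\<rightarrow> g z"
    using f g by (auto simp: nicely_meromorphic_on_def)
  have no_both: "\<not> (is_pole g z \<and> g \<midarrow>z\<rightarrow> c)" for c
    unfolding is_pole_def by (meson at_neq_bot not_tendsto_and_filterlim_at_infinity)
  show "f z = g z"
    using fz gz no_both LIM_unique unfolding cong by metis
qed

text \<open>The division by zero at 1 produces exactly the value required at the pole.\<close>

lemma zeta_eq_entire_quotient:
  obtains E where "E holomorphic_on UNIV" "\<And>s. zeta s = E s / (s - 1)"
    "\<And>s. Re s > 1 \<Longrightarrow> E s = (s - 1) * zeta_series s"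
    "\<And>s. Re s > 0 \<Longrightarrow> E s = 1 + (\<Sum>m. zeta_rem 1 m s)"
proof -
  obtain E where E: "E holomorphic_on UNIV" "\<And>s. Re s > 1 \<Longrightarrow> E s = (s - 1) * zeta_series s"
    using zeta_continuation_entire by blast
  have E1: "E s = 1 + (\<Sum>m. zeta_rem 1 m s)" if s: "Re s > 0" for s
  proof (rule analytic_continuation_open[of "{s. Re s > 1}" "{s. Re s > 0}" E "\<lambda>s. 1 + (\<Sum>m. zeta_rem 1 m s)"])
    show "{s. Re s > 1} \<noteq> {}" by (auto intro: exI[of _ 2])
    show "connected {s. Re s > 0}" by (intro convex_connected convex_halfspace_Re_gt)
    show "E holomorphic_on {s. Re s > 0}" using E(1) by (rule holomorphic_on_subset) auto
    show "(\<lambda>s. 1 + (\<Sum>m. zeta_rem 1 m s)) holomorphic_on {s. Re s > 0}"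
      using suminf_zeta_rem_holomorphic[of 1] by (intro holomorphic_intros) simp
    show "E s = 1 + (\<Sum>m. zeta_rem 1 m s)" if "s \<in> {s. Re s > 1}" for s
      using zeta_series_recursion[of s 0] E(2)[of s] that by simp
  qed (use s in \<open>auto intro: open_halfspace_Re_gt\<close>)
  \<comment> \<open>At s = 1 the power \<open>z powr (1 - s)\<close> is constant and has no Taylor
    remainder. Hence E 1 = 1, and the quotient really has a pole at 1.\<close>
  have "zeta_rem 1 m 1 = 0" for m
    by (simp add: zeta_rem_def falling_def del: of_nat_Suc)
  then have "E 1 = 1" using E1[of 1] by simp
  define Z where "Z = (\<lambda>s. E s / (s - 1))"
  have hol: "Z holomorphic_on - {1}"
    unfolding Z_def by (intro holomorphic_intros holomorphic_on_subset[OF E(1)]) auto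
  then have analytic: "Z analytic_on - {1}"
    by (subst analytic_on_open) auto
  have nice: "Z nicely_meromorphic_on UNIV"
  proof (rule nicely_meromorphic_onI_open[where pts = "{1}"])
    show "Z analytic_on UNIV - {1}" using analytic by (simp add: Compl_eq_Diff_UNIV)
    have "is_pole Z 1"
      unfolding Z_def
    proof (rule is_pole_divide)
      show "isCont E 1"
        using holomorphic_on_imp_continuous_on[OF E(1)] by (simp add: continuous_on_eq_continuous_at)
      show "filterlim (\<lambda>s::complex. s - 1) (at 0) (at 1)"
        by (rule filterlim_atI) (auto intro!: tendsto_eq_intros simp: eventually_at_filter)
    qed (simp add: \<open>E 1 = 1\<close>)
    then show "is_pole Z x \<and> Z x = 0" if "x \<in> {1}" for x
      using that by (simp add: Z_def)
    show "isolated_singularity_at Z x" for x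
    proof (cases "x = 1")
      case False
      then show ?thesis
        using analytic by (intro isolated_singularity_at_analytic) (auto elim: analytic_on_subset)
    next
      case True
      then show ?thesis
        unfolding isolated_singularity_at_def
        by (intro exI[of _ 1]) (auto intro: analytic_on_subset[OF analytic])
    qed
  qed auto
  have series: "Z s = zeta_series s" if "Re s > 1" for s
    using E(2)[OF that] that by (auto simp: Z_def)
  have "zeta = Z"
    unfolding zeta_def
  proof (rule the_equality)
    show "Z nicely_meromorphic_on UNIV \<and> (\<forall>s. Re s > 1 \<longrightarrow> Z s = zeta_series s)"
      using nice series by blast
    fix f assume "f nicely_meromorphic_on UNIV \<and> (\<forall>s. Re s > 1 \<longrightarrow> f s = zeta_series s)"
    then show "f = Z"
      using nice series
      by (intro nicely_meromorphic_eqI[where S = "{s. Re s > 1}"])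
         (auto intro: open_halfspace_Re_gt exI[of _ 2])
  qed
  then have "zeta s = E s / (s - 1)" for s unfolding Z_def by (rule fun_cong)
  with E E1 show ?thesis using that by blast
qed

text \<open>The default value at the pole is exploited below: wherever zeta is known to be nonzero,
  the point 1 is excluded as well.\<close>

lemma zeta_1: "zeta 1 = 0"
proof -
  obtain E where "\<And>s. zeta s = E s / (s - 1)"
    using zeta_eq_entire_quotient by metis
  then show ?thesis by simp
qed

lemma holomorphic_zeta: "zeta holomorphic_on - {1}"
proof -
  obtain E where "E holomorphic_on UNIV" "\<And>s. zeta s = E s / (s - 1)"
    using zeta_eq_entire_quotient by metis
  then show ?thesis
    using holomorphic_on_subset[of E UNIV "- {1}"]
    by (subst holomorphic_cong[OF refl, of _ _ "\<lambda>s. E s / (s - 1)"]) (auto intro!: holomorphic_intros)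
qed

lemma zeta_eq_series: "Re s > 1 \<Longrightarrow> zeta s = zeta_series s"
proof -
  assume s: "Re s > 1"
  obtain E where "\<And>s. zeta s = E s / (s - 1)" "\<And>s. Re s > 1 \<Longrightarrow> E s = (s - 1) * zeta_series s"
    using zeta_eq_entire_quotient by metis
  then show "zeta s = zeta_series s" using s by fastforce
qed

section \<open>Approximation of zeta by partial sums for real part at least 7/8\<close>

lemma powr_tail_step:
  fixes x a :: real
  assumes "x > 0" "a > 0"
  shows "(x + 1) powr (- a - 1) \<le> (x powr (- a) - (x + 1) powr (- a)) / a"
proof -
  have "\<exists>z>x. z < x + 1 \<and> - ((x + 1) powr (- a)) / a - (- (x powr (- a)) / a) = (x + 1 - x) * z powr (- a - 1)"
  proof (rule MVT2)
    fix z assume "x \<le> z" "z \<le> x + 1"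
    then show "((\<lambda>z. - (z powr (- a)) / a) has_real_derivative z powr (- a - 1)) (at z)"
      using assms by (auto intro!: derivative_eq_intros)
  qed auto
  then obtain z where z: "x < z" "z < x + 1" "(x powr (- a) - (x + 1) powr (- a)) / a = z powr (- a - 1)"
    by (auto simp: diff_divide_distrib)
  show ?thesis
    unfolding z(3) using z assms by (intro powr_mono2') auto
qed

lemma powr_tail:
  assumes "N > 0" "a > 0"
  shows "summable (\<lambda>m. real (N + Suc m) powr (- a - 1))"
    and "(\<Sum>m. real (N + Suc m) powr (- a - 1)) \<le> real N powr (- a) / a"
proof -
  have bound: "(\<Sum>m<k. real (N + Suc m) powr (- a - 1)) \<le> (real N powr (- a) - real (N + k) powr (- a)) / a" for k
  proof (induction k)
    case (Suc k)
    then show ?case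
      using powr_tail_step[of "real (N + k)" a] assms by (simp add: diff_divide_distrib add_ac)
  qed simp
  then have bound': "(\<Sum>m<k. real (N + Suc m) powr (- a - 1)) \<le> real N powr (- a) / a" for k
    using assms by (intro order_trans[OF bound]) (simp add: divide_right_mono)
  show "summable (\<lambda>m. real (N + Suc m) powr (- a - 1))"
    using bound'[of "Suc _"] by (intro bounded_imp_summable[where B = "real N powr (- a) / a"]) (auto simp: lessThan_Suc_atMost)
  then show "(\<Sum>m. real (N + Suc m) powr (- a - 1)) \<le> real N powr (- a) / a"
    by (rule suminf_le_const) (rule bound')
qed

text \<open>Since \<open>falling 1 s\<close> is 1 - s, each remainder of order 1 is a telescoping
  difference plus (s - 1) times one term of the Dirichlet series.\<close>

lemma zeta_partial_sum_eq:
  assumes "Re s > 0" "s \<noteq> 1" and summable: "summable (\<lambda>m. zeta_rem 1 m s)"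
  shows "(s - 1) * (zeta s - (\<Sum>m<N. of_nat (Suc m) powr (- s))) =
           of_nat (Suc N) powr (1 - s) + (\<Sum>m. zeta_rem 1 (m + N) s)"
proof -
  obtain E where E: "\<And>s. zeta s = E s / (s - 1)" "\<And>s. Re s > 0 \<Longrightarrow> E s = 1 + (\<Sum>m. zeta_rem 1 m s)"
    using zeta_eq_entire_quotient by metis
  have "(\<Sum>m<N. zeta_rem 1 m s) = of_nat (Suc N) powr (1 - s) - 1 + (s - 1) * (\<Sum>m<N. of_nat (Suc m) powr (- s))"
    by (induction N) (simp_all add: zeta_rem_def falling_def algebra_simps)
  moreover have "(s - 1) * zeta s = 1 + (\<Sum>m. zeta_rem 1 m s)"
    using E assms by simp
  moreover have "(\<Sum>m. zeta_rem 1 m s) = (\<Sum>m. zeta_rem 1 (m + N) s) + (\<Sum>m<N. zeta_rem 1 m s)"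
    by (rule suminf_split_initial_segment[OF summable])
  ultimately show ?thesis by (simp add: algebra_simps)
qed

text \<open>The first term comes from the boundary term \<open>x powr (1 - s) / (s - 1)\<close>, the
  second from the tail of the Taylor remainders, both estimated at real part 7/8.\<close>

definition zeta_err :: "complex \<Rightarrow> real \<Rightarrow> real" where
  "zeta_err s x = x powr (1/8) / norm (s - 1) + norm s * x powr (-7/8)"

lemma zeta_approx_nat:
  assumes s: "Re s \<ge> 7/8" "s \<noteq> 1" and N: "N > 0"
  shows "norm (zeta s - (\<Sum>m<N. of_nat (Suc m) powr (- s))) \<le> 2 * zeta_err s (real N)"
proof -
  have le: "norm (zeta_rem 1 m s) \<le> norm (s - 1) * norm s * real (Suc m) powr (- (7/8) - 1)" for m
  proof -
    have "norm (zeta_rem 1 m s) \<le> norm (falling (Suc 1) s) * real (Suc m) powr (- Re s - real 1)"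
      using s by (intro norm_zeta_rem_le) simp
    also have "norm (falling (Suc 1) s) = norm (s - 1) * norm s"
      by (simp add: falling_Suc norm_mult norm_minus_commute)
    also have "norm (s - 1) * norm s * real (Suc m) powr (- Re s - real 1)
        \<le> norm (s - 1) * norm s * real (Suc m) powr (- (7/8) - 1)"
      using s by (intro mult_left_mono powr_mono) auto
    finally show ?thesis .
  qed
  have summable: "summable (\<lambda>m. zeta_rem 1 m s)"
    by (rule summable_comparison_test'[of "\<lambda>m. norm (s - 1) * norm s * real (Suc m) powr (- (7/8) - 1)" 0])
       (use le in \<open>auto intro!: summable_mult summable_real_powr_Suc simp del: of_nat_Suc\<close>)
  have tail: "norm (\<Sum>m. zeta_rem 1 (m + N) s) \<le> norm (s - 1) * norm s * (real N powr (-(7/8)) / (7/8))"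
  proof -
    note pt = powr_tail[OF N, of "7/8", simplified]
    have le': "norm (zeta_rem 1 (m + N) s) \<le> norm (s - 1) * norm s * real (N + Suc m) powr (- (7/8) - 1)" for m
      using le[of "m + N"] by (simp add: add_ac)
    have "summable (\<lambda>m. norm (s - 1) * norm s * real (N + Suc m) powr (- (7/8) - 1))"
      using powr_tail(1)[OF N, of "7/8"] by (intro summable_mult) simp
    from norm_suminf_le[OF le' this]
    have "norm (\<Sum>m. zeta_rem 1 (m + N) s) \<le> (\<Sum>m. norm (s - 1) * norm s * real (N + Suc m) powr (- (7/8) - 1))" .
    also have "\<dots> = norm (s - 1) * norm s * (\<Sum>m. real (N + Suc m) powr (- (7/8) - 1))"
      using powr_tail(1)[OF N, of "7/8"] by (intro suminf_mult) simp
    also have "\<dots> \<le> norm (s - 1) * norm s * (real N powr (-(7/8)) / (7/8))"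
      using powr_tail(2)[OF N, of "7/8"] by (intro mult_left_mono) auto
    finally show ?thesis .
  qed
  have main: "norm (of_nat (Suc N) powr (1 - s)) \<le> 2 * real N powr (1/8)"
  proof -
    have "norm (of_nat (Suc N) powr (1 - s)) = real (Suc N) powr (1 - Re s)"
      by (simp add: norm_of_nat_powr del: of_nat_Suc)
    also have "\<dots> \<le> real (Suc N) powr (1/8)"
      using s by (intro powr_mono) auto
    also have "\<dots> \<le> (2 * real N) powr (1/8)"
      using N by (intro powr_mono2) auto
    also have "\<dots> = 2 powr (1/8) * real N powr (1/8)"
      by (simp add: powr_mult)
    also have "\<dots> \<le> 2 powr 1 * real N powr (1/8)"
      by (intro mult_right_mono powr_mono) auto
    finally show ?thesis by simp
  qed
  have "norm (s - 1) * norm (zeta s - (\<Sum>m<N. of_nat (Suc m) powr (- s))) =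
      norm (of_nat (Suc N) powr (1 - s) + (\<Sum>m. zeta_rem 1 (m + N) s))"
    using zeta_partial_sum_eq[OF _ s(2) summable, of N] s by (simp add: norm_mult[symmetric] del: of_nat_Suc)
  also have "\<dots> \<le> 2 * real N powr (1/8) + norm (s - 1) * norm s * (real N powr (-(7/8)) / (7/8))"
    using main tail by (intro norm_triangle_mono)
  also have "\<dots> \<le> 2 * real N powr (1/8) + norm (s - 1) * norm s * (2 * real N powr (-(7/8)))"
    by (intro add_left_mono mult_left_mono) auto
  also have "\<dots> = norm (s - 1) * (2 * zeta_err s (real N))"
    using s by (simp add: zeta_err_def field_simps)
  finally show ?thesis using s by simp
qed

text \<open>Real cutoffs are wanted because the sieve replaces x by x / p. Passing to the floor
  costs another factor 2, since x is at most twice its floor.\<close>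

lemma zeta_approx:
  assumes s: "Re s \<ge> 7/8" "s \<noteq> 1" and x: "x \<ge> 1"
  shows "norm (zeta s - (\<Sum>n | n > 0 \<and> real n \<le> x. of_nat n powr (- s))) \<le> 4 * zeta_err s x"
proof -
  define N where "N = nat \<lfloor>x\<rfloor>"
  have N: "N > 0" "real N \<le> x" "x < real N + 1" using x unfolding N_def by linarith+
  then have N': "x \<le> 2 * real N" by linarith
  have set: "{n. n > 0 \<and> real n \<le> x} = Suc ` {..<N}"
  proof (intro set_eqI iffI)
    fix n assume "n \<in> {n. n > 0 \<and> real n \<le> x}"
    then have "n > 0" "n \<le> N" using N by auto
    then show "n \<in> Suc ` {..<N}" by (auto simp: image_iff Suc_le_eq intro!: bexI[of _ "n - 1"])
  qed (use N in auto)
  have "norm (zeta s - (\<Sum>n | n > 0 \<and> real n \<le> x. of_nat n powr (- s))) \<le> 2 * zeta_err s (real N)"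
    unfolding set using zeta_approx_nat[OF s N(1)] by (simp add: sum.reindex)
  also have "zeta_err s (real N) \<le> 2 * zeta_err s x"
  proof -
    have "real N powr (1/8) / norm (s - 1) \<le> x powr (1/8) / norm (s - 1)"
      using N by (intro divide_right_mono powr_mono2) auto
    also have "\<dots> \<le> 2 * (x powr (1/8) / norm (s - 1))"
      using divide_nonneg_nonneg[OF powr_ge_zero[of x "1/8"] norm_ge_zero[of "s - 1"]] by linarith
    finally have "real N powr (1/8) / norm (s - 1) \<le> 2 * (x powr (1/8) / norm (s - 1))" .
    moreover have "real N powr (-7/8) \<le> 2 * x powr (-7/8)"
    proof -
      have "real N powr (-7/8) \<le> (x / 2) powr (-7/8)"
        using N N' x by (intro powr_mono2') auto
      also have "\<dots> = 2 powr (7/8) * x powr (-7/8)"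
        using x by (simp add: powr_divide powr_minus field_simps)
      also have "\<dots> \<le> 2 powr 1 * x powr (-7/8)"
        by (intro mult_right_mono powr_mono) auto
      finally show ?thesis by simp
    qed
    then have "norm s * real N powr (-7/8) \<le> norm s * (2 * x powr (-7/8))"
      by (rule mult_left_mono) simp
    ultimately show ?thesis unfolding zeta_err_def by (simp add: algebra_simps)
  qed
  finally show ?thesis by simp
qed

section \<open>Sieving out the small primes\<close>

definition rough :: "nat \<Rightarrow> nat set" where
  "rough M = {n. n > 0 \<and> (\<forall>p. prime p \<and> p \<le> M \<longrightarrow> \<not> p dvd n)}"

definition sieved_zeta :: "nat \<Rightarrow> complex \<Rightarrow> complex" where
  "sieved_zeta M s = zeta s * (\<Prod>p\<in>primes_le M. 1 - of_nat p powr (- s))"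

lemma rough_0: "rough 0 = {0<..}"
  by (auto simp: rough_def)

lemma one_in_rough: "1 \<in> rough M"
  by (auto simp: rough_def)

lemma rough_gt:
  assumes "n \<in> rough M" "n \<noteq> 1"
  shows "n > M"
proof (rule ccontr)
  assume "\<not> n > M"
  obtain p where "prime p" "p dvd n" using assms(2) prime_factor_nat by blast
  moreover from this have "p \<le> n" using assms by (intro dvd_imp_le) (auto simp: rough_def)
  ultimately show False using assms \<open>\<not> n > M\<close> by (auto simp: rough_def)
qed

lemma primes_le_Suc:
  "primes_le (Suc M) = (if prime (Suc M) then insert (Suc M) (primes_le M) else primes_le M)"
  by (auto simp: le_Suc_eq)

lemma rough_Suc_not_prime: "\<not> prime (Suc M) \<Longrightarrow> rough (Suc M) = rough M"
  by (auto simp: rough_def le_Suc_eq)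

text \<open>The sieve of Eratosthenes: a rough number divisible by the new prime has a rough
  cofactor, and multiplication by a prime beyond M keeps a number rough.\<close>

lemma rough_Suc_prime:
  assumes "prime (Suc M)"
  shows "rough M = rough (Suc M) \<union> (*) (Suc M) ` rough M"
    and "rough (Suc M) \<inter> (*) (Suc M) ` rough M = {}"
proof -
  have mult: "Suc M * n \<in> rough M" if "n \<in> rough M" for n
  proof -
    have "\<not> p dvd Suc M * n" if "prime p" "p \<le> M" for p
    proof
      assume "p dvd Suc M * n"
      then have "p dvd Suc M \<or> p dvd n" using \<open>prime p\<close> by (simp only: prime_dvd_mult_iff)
      moreover have "\<not> p dvd Suc M"
        using primes_dvd_imp_eq[of p "Suc M"] assms that by auto
      ultimately show False using \<open>n \<in> rough M\<close> that by (auto simp: rough_def)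
    qed
    then show ?thesis using that by (auto simp: rough_def)
  qed
  have div: "n \<in> rough (Suc M) \<or> n \<in> (*) (Suc M) ` rough M" if "n \<in> rough M" for n
  proof (cases "Suc M dvd n")
    case True
    then obtain m where m: "n = Suc M * m" by blast
    have "\<not> p dvd m" if "prime p" "p \<le> M" for p
      using \<open>n \<in> rough M\<close> that dvd_mult[of p m "Suc M"] unfolding rough_def m by blast
    then have "m \<in> rough M" using \<open>n \<in> rough M\<close> m by (auto simp: rough_def)
    then show ?thesis using m by blast
  next
    case False
    then show ?thesis using that by (auto simp: rough_def le_Suc_eq)
  qed
  have "rough (Suc M) \<subseteq> rough M" by (auto simp: rough_def)
  then show "rough M = rough (Suc M) \<union> (*) (Suc M) ` rough M"
    using mult div by blast
  show "rough (Suc M) \<inter> (*) (Suc M) ` rough M = {}"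
    using assms by (auto simp: rough_def simp del: mult_Suc)
qed

lemma sieved_zeta_0: "sieved_zeta 0 s = zeta s"
proof -
  have "primes_le 0 = {}" by auto
  then show ?thesis unfolding sieved_zeta_def by (simp only: prod.empty mult_1_right)
qed

lemma sieved_zeta_Suc:
  "sieved_zeta (Suc M) s =
     (if prime (Suc M) then sieved_zeta M s * (1 - of_nat (Suc M) powr (- s)) else sieved_zeta M s)"
  unfolding sieved_zeta_def primes_le_Suc by (simp del: of_nat_Suc)

lemma powr_of_nat_mult:
  fixes s :: complex
  shows "(of_nat m * of_nat n) powr s = of_nat m powr s * of_nat n powr s"
  using powr_times_real_left[of "of_nat m" "of_nat n" s] by simp

text \<open>Each step of the sieve subtracts the multiples of the new prime p, which contribute
  \<open>p powr (-s)\<close> times the previous sum.\<close>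

lemma has_sum_rough:
  assumes "Re s > 1"
  shows "((\<lambda>n. of_nat n powr (- s)) has_sum sieved_zeta M s) (rough M)"
proof (induction M)
  case 0
  have "summable (\<lambda>n. norm (of_nat (Suc n) powr (- s) :: complex))"
    using assms summable_real_powr_Suc[of "- Re s"] by (simp add: norm_of_nat_powr del: of_nat_Suc)
  then have "((\<lambda>n. of_nat (Suc n) powr (- s)) has_sum zeta s) UNIV"
    using summable_sums[OF summable_zeta_series[OF assms]] zeta_eq_series[OF assms]
    by (intro norm_summable_imp_has_sum) auto
  then have "((\<lambda>n. of_nat n powr (- s)) has_sum zeta s) (range Suc)"
    by (subst has_sum_reindex) (auto simp: o_def)
  moreover have "range Suc = rough 0"
    by (auto simp: rough_0 image_iff Suc_le_eq gr0_conv_Suc)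
  ultimately show ?case by (simp add: sieved_zeta_0)
next
  case (Suc M)
  show ?case
  proof (cases "prime (Suc M)")
    case False
    then show ?thesis using Suc by (simp add: rough_Suc_not_prime sieved_zeta_Suc)
  next
    case True
    have "((\<lambda>n. of_nat (Suc M) powr (- s) * of_nat n powr (- s)) has_sum
        of_nat (Suc M) powr (- s) * sieved_zeta M s) (rough M)"
      by (intro has_sum_cmult_right Suc)
    then have "((\<lambda>n. of_nat n powr (- s)) has_sum of_nat (Suc M) powr (- s) * sieved_zeta M s)
        ((*) (Suc M) ` rough M)"
      by (subst has_sum_reindex) (auto simp: o_def powr_of_nat_mult inj_on_def simp del: of_nat_Suc mult_Suc)
    from has_sum_Diff[OF Suc this] have "((\<lambda>n. of_nat n powr (- s)) has_sum
        sieved_zeta M s - of_nat (Suc M) powr (- s) * sieved_zeta M s) (rough M - (*) (Suc M) ` rough M)"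
      using rough_Suc_prime(1)[OF True] by blast
    moreover have "rough M - (*) (Suc M) ` rough M = rough (Suc M)"
      using rough_Suc_prime[OF True] by blast
    ultimately show ?thesis
      using True by (simp add: sieved_zeta_Suc algebra_simps)
  qed
qed

lemma zeta_err_divide_le:
  assumes "x > 0" "c \<ge> 1"
  shows "zeta_err s (x / c) \<le> c * zeta_err s x"
proof -
  have "(x / c) powr (1/8) \<le> x powr (1/8)"
    using assms by (intro powr_mono2) (auto simp: field_simps)
  also have "\<dots> \<le> c * x powr (1/8)"
    using mult_right_mono[OF assms(2) powr_ge_zero[of x "1/8"]] by simp
  finally have 1: "(x / c) powr (1/8) / norm (s - 1) \<le> c * (x powr (1/8) / norm (s - 1))"
    using divide_right_mono[OF _ norm_ge_zero] by fastforce
  have "(x / c) powr (-7/8) = c powr (7/8) * x powr (-7/8)"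
    using assms by (simp add: powr_divide powr_minus field_simps)
  also have "\<dots> \<le> c powr 1 * x powr (-7/8)"
    using assms by (intro mult_right_mono powr_mono) auto
  finally have "norm s * (x / c) powr (-7/8) \<le> norm s * (c * x powr (-7/8))"
    using assms by (intro mult_left_mono) auto
  with 1 show ?thesis by (simp add: zeta_err_def algebra_simps)
qed

lemma finite_nat_le_real [simp]: "finite {n::nat. P n \<and> real n \<le> x}"
  by (rule finite_subset[of _ "{..nat \<lceil>x\<rceil>}"]) (auto, linarith)

text \<open>
  Removing the prime \<open>p\<close> from the sum up to \<open>x\<close> involves the sum up to \<open>x / p\<close>; the lower bound
  \<open>fact M\<close> for \<open>x\<close> keeps all these lengths at least 1.
\<close>

lemma sieved_zeta_approx:
  "\<exists>C>0. \<forall>s x. Re s \<ge> 7/8 \<longrightarrow> s \<noteq> 1 \<longrightarrow> x \<ge> fact M \<longrightarrow>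
     norm (sieved_zeta M s - (\<Sum>n | n \<in> rough M \<and> real n \<le> x. of_nat n powr (- s))) \<le> C * zeta_err s x"
proof (induction M)
  case 0
  show ?case
    using zeta_approx by (intro exI[of _ 4]) (auto simp: rough_0 sieved_zeta_0)
next
  case (Suc M)
  then obtain C where C: "C > 0" "\<And>s x. Re s \<ge> 7/8 \<Longrightarrow> s \<noteq> 1 \<Longrightarrow> x \<ge> fact M \<Longrightarrow>
     norm (sieved_zeta M s - (\<Sum>n | n \<in> rough M \<and> real n \<le> x. of_nat n powr (- s))) \<le> C * zeta_err s x"
    by blast
  show ?case
  proof (cases "prime (Suc M)")
    case False
    have "(fact M :: real) \<le> fact (Suc M)" by (rule fact_mono) simp
    then show ?thesis
      using C False
      by (intro exI[of _ C]) (force simp: rough_Suc_not_prime sieved_zeta_Suc simp del: fact_Suc)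
  next
    case True
    define p where "p = Suc M"
    have p: "prime p" "real p \<ge> 1" "p > 0" using True by (auto simp: p_def)
    show ?thesis
    proof (intro exI[of _ "C * (1 + real p)"] conjI allI impI)
      show "C * (1 + real p) > 0" using C p by simp
      fix s :: complex and x :: real
      assume s: "Re s \<ge> 7/8" "s \<noteq> 1" and x: "x \<ge> fact (Suc M)"
      define A where "A = (\<lambda>M x. \<Sum>n | n \<in> rough M \<and> real n \<le> x. of_nat n powr (- s))"
      have x': "x \<ge> fact M" "x / real p \<ge> fact M" "x > 0"
      proof -
        have "(fact M :: real) \<le> fact (Suc M)" by (rule fact_mono) simp
        then show "x \<ge> fact M" using x by linarith
        show "x / real p \<ge> fact M"
          using x p by (simp add: p_def pos_le_divide_eq mult.commute)
        show "x > 0" using \<open>x \<ge> fact M\<close> fact_gt_zero[of M, where 'a = real] by linarith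
      qed
      have set: "{n. n \<in> rough M \<and> real n \<le> x} =
          {n. n \<in> rough p \<and> real n \<le> x} \<union> (*) p ` {n. n \<in> rough M \<and> real n \<le> x / real p}"
        using rough_Suc_prime(1)[OF True] p
        by (auto simp: p_def[symmetric] field_simps image_iff simp flip: of_nat_mult)
      have "A M x = A p x + (\<Sum>n\<in>(*) p ` {n. n \<in> rough M \<and> real n \<le> x / real p}. of_nat n powr (- s))"
        unfolding A_def set
        by (rule sum.union_disjoint) (use rough_Suc_prime(2)[OF True] in \<open>auto simp: p_def[symmetric]\<close>)
      also have "(\<Sum>n\<in>(*) p ` {n. n \<in> rough M \<and> real n \<le> x / real p}. of_nat n powr (- s)) =
          of_nat p powr (- s) * A M (x / real p)"
        using p by (subst sum.reindex) (auto simp: A_def inj_on_def powr_of_nat_mult sum_distrib_left)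
      finally have A: "A p x = A M x - of_nat p powr (- s) * A M (x / real p)" by simp
      have "sieved_zeta p s = sieved_zeta M s * (1 - of_nat p powr (- s))"
        using True by (simp add: sieved_zeta_Suc p_def del: of_nat_Suc)
      then have "sieved_zeta p s - A p x =
          (sieved_zeta M s - A M x) - of_nat p powr (- s) * (sieved_zeta M s - A M (x / real p))"
        unfolding A by (simp add: algebra_simps)
      also have "norm \<dots> \<le> norm (sieved_zeta M s - A M x) +
          norm (of_nat p powr (- s) :: complex) * norm (sieved_zeta M s - A M (x / real p))"
        by (metis norm_triangle_ineq4 norm_mult)
      also have "\<dots> \<le> C * zeta_err s x + 1 * (C * zeta_err s (x / real p))"
      proof (intro add_mono mult_mono)
        show "norm (sieved_zeta M s - A M x) \<le> C * zeta_err s x"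
          "norm (sieved_zeta M s - A M (x / real p)) \<le> C * zeta_err s (x / real p)"
          unfolding A_def using C(2)[OF s] x' by auto
        show "norm (of_nat p powr (- s) :: complex) \<le> 1"
          using p s powr_mono[of "- Re s" 0 "real p"] by (simp add: norm_of_nat_powr)
      qed auto
      also have "\<dots> \<le> C * zeta_err s x + 1 * (C * (real p * zeta_err s x))"
        using C p x' by (intro add_left_mono mult_left_mono zeta_err_divide_le) auto
      also have "\<dots> = C * (1 + real p) * zeta_err s x" by (simp add: algebra_simps)
      finally show "norm (sieved_zeta (Suc M) s - (\<Sum>n | n \<in> rough (Suc M) \<and> real n \<le> x. of_nat n powr (- s)))
          \<le> C * (1 + real p) * zeta_err s x"
        by (simp add: A_def p_def)
    qed
  qed
qed

text \<open>Stated for sums over an arbitrary set of integers beyond M, so that it serves rough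
  numbers, primes and finite sets alike.\<close>

lemma norm_tail_sum_le:
  fixes f :: "nat \<Rightarrow> complex"
  assumes f: "(f has_sum S) A" and A: "\<And>n. n \<in> A \<Longrightarrow> M < n" and "M > 0" "a > 0"
    and le: "\<And>n. n \<in> A \<Longrightarrow> norm (f n) \<le> c * real n powr (- a - 1)" and "c \<ge> 0"
  shows "norm S \<le> c * real M powr (- a) / a"
proof -
  let ?g = "\<lambda>n. c * real n powr (- a - 1)"
  note pt = powr_tail[OF \<open>M > 0\<close> \<open>a > 0\<close>]
  have "(\<lambda>m. ?g (M + Suc m)) sums (c * (\<Sum>m. real (M + Suc m) powr (- a - 1)))"
    using pt by (intro sums_mult summable_sums)
  then have "((\<lambda>m. ?g (M + Suc m)) has_sum (c * (\<Sum>m. real (M + Suc m) powr (- a - 1)))) UNIV"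
    using \<open>c \<ge> 0\<close> by (intro sums_nonneg_imp_has_sum) auto
  then have g: "(?g has_sum (c * (\<Sum>m. real (M + Suc m) powr (- a - 1)))) ((\<lambda>m. M + Suc m) ` UNIV)"
    by (subst has_sum_reindex) (auto simp: o_def inj_on_def)
  have sub: "A \<subseteq> (\<lambda>m. M + Suc m) ` UNIV"
    using A by (fastforce simp: image_iff less_iff_Suc_add)
  have g': "?g summable_on A"
    using g sub by (meson has_sum_imp_summable summable_on_subset_banach)
  have "norm S \<le> infsum ?g A"
    using f has_sum_infsum[OF g'] le by (rule norm_infsum_le)
  also have "\<dots> \<le> c * (\<Sum>m. real (M + Suc m) powr (- a - 1))"
    by (rule has_sum_mono2[OF has_sum_infsum[OF g'] g sub]) (use \<open>c \<ge> 0\<close> in auto)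
  also have "\<dots> \<le> c * (real M powr (- a) / a)"
    using pt \<open>c \<ge> 0\<close> by (intro mult_left_mono)
  finally show ?thesis by simp
qed

text \<open>Apart from 1, all rough numbers exceed M, which leaves the tail of a convergent
  series.\<close>

lemma norm_sieved_zeta_minus_1_le:
  assumes s: "Re s \<ge> 1 + a" "a > 0" and M: "M > 0"
  shows "norm (sieved_zeta M s - 1) \<le> real M powr (- a) / a"
proof -
  let ?f = "\<lambda>n. of_nat n powr (- s) :: complex"
  have "(?f has_sum sieved_zeta M s - ?f 1) (rough M - {1})"
    by (intro has_sum_Diff has_sum_rough) (use s one_in_rough in \<open>auto simp: has_sum_finite_iff\<close>)
  then have f: "(?f has_sum sieved_zeta M s - 1) (rough M - {1})" by simp
  have "norm (?f n) \<le> 1 * real n powr (- a - 1)" if "n \<in> rough M - {1}" for n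
    using s that by (auto simp: norm_of_nat_powr rough_def intro!: powr_mono)
  from norm_tail_sum_le[OF f _ M s(2) this] show ?thesis
    using rough_gt by auto
qed

section \<open>The logarithm of the zeta-function\<close>

lemma norm_of_nat_powr_le_half:
  assumes "p \<ge> 2" "Re z > 1"
  shows "norm (of_nat p powr (- z) :: complex) < 1/2"
proof -
  have "norm (of_nat p powr (- z) :: complex) = real p powr (- Re z)"
    using assms by (simp add: norm_of_nat_powr)
  also have "\<dots> < real p powr (- 1)"
    using assms by (intro powr_less_mono) auto
  also have "\<dots> \<le> 1/2" using assms by (simp add: powr_minus_divide field_simps)
  finally show ?thesis .
qed

lemma norm_Ln_one_minus_le: "norm w < 1/2 \<Longrightarrow> norm (Ln (1 - w)) \<le> 2 * norm w"
  using norm_Ln_le[of "- w"] by simp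

lemma norm_euler_term_le:
  assumes "Re z > 1" "prime p"
  shows "norm (Ln (1 - of_nat p powr (- z))) \<le> 2 * real p powr (- Re z)"
  using norm_Ln_one_minus_le[OF norm_of_nat_powr_le_half] prime_ge_2_nat assms
  by (metis norm_of_nat_powr prime_gt_0_nat uminus_complex.simps(1))

lemma log_zeta_euler_has_sum:
  assumes "Re z > 1"
  shows "((\<lambda>p. - Ln (1 - of_nat p powr (- z))) has_sum log_zeta_euler z) {p. prime p}"
proof -
  have "summable (\<lambda>n. 2 * real (Suc n) powr (- Re z))"
    using assms by (intro summable_mult summable_real_powr_Suc) auto
  then have "(\<lambda>n. 2 * real (Suc n) powr (- Re z)) summable_on UNIV"
    by (subst summable_on_UNIV_nonneg_real_iff) auto
  then have "(\<lambda>n. 2 * real n powr (- Re z)) summable_on (range Suc)"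
    by (subst summable_on_reindex) (auto simp: o_def)
  then have "(\<lambda>n. 2 * real n powr (- Re z)) summable_on {p. prime p}"
    by (rule summable_on_subset_banach)
       (auto simp: image_iff gr0_conv_Suc dest!: prime_gt_0_nat)
  then have "(\<lambda>p. norm (Ln (1 - of_nat p powr (- z)))) summable_on {p. prime p}"
    by (rule summable_on_comparison_test) (use assms norm_euler_term_le in auto)
  then have "(\<lambda>p. Ln (1 - of_nat p powr (- z))) summable_on {p. prime p}"
    by (rule abs_summable_summable)
  then show ?thesis
    unfolding log_zeta_euler_def by (subst has_sum_uminus) simp
qed

lemma log_zeta_euler_sums:
  assumes "Re z > 1"
  shows "(\<lambda>n. if prime n then - Ln (1 - of_nat n powr (- z)) else 0) sums log_zeta_euler z"
  by (rule has_sum_imp_sums)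
     (use log_zeta_euler_has_sum[OF assms] in \<open>subst has_sum_cong_neutral[where T = "{p. prime p}"], auto\<close>)

lemma one_minus_powr_nonzero:
  assumes "prime p" "Re z > 0"
  shows "norm (of_nat p powr (- z) :: complex) < 1" "1 - of_nat p powr (- z) \<noteq> (0 :: complex)"
    "1 - of_nat p powr (- z) \<notin> (\<real>\<^sub>\<le>\<^sub>0 :: complex set)"
proof -
  have "norm (of_nat p powr (- z) :: complex) = real p powr (- Re z)"
    using prime_gt_0_nat[OF assms(1)] by (simp add: norm_of_nat_powr)
  also have "\<dots> < real p powr 0"
    using prime_gt_1_nat[OF assms(1)] assms(2) by (intro powr_less_mono) auto
  finally show less: "norm (of_nat p powr (- z) :: complex) < 1"
    using prime_gt_0_nat[OF assms(1)] by simp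
  have "Re (of_nat p powr (- z)) < 1"
    using complex_Re_le_cmod less by (rule order.strict_trans1)
  then show "1 - of_nat p powr (- z) \<notin> (\<real>\<^sub>\<le>\<^sub>0 :: complex set)"
    by (auto simp: complex_nonpos_Reals_iff)
  then show "1 - of_nat p powr (- z) \<noteq> (0 :: complex)" by auto
qed

text \<open>For every M the exponential of the partial sum over p \<le> M, multiplied by
  \<open>sieved_zeta M z\<close>, is exactly zeta z, and the second factor tends to 1.\<close>

lemma exp_log_zeta_euler:
  assumes z: "Re z > 1"
  shows "exp (log_zeta_euler z) = zeta z"
proof -
  define P where "P = (\<lambda>M. \<Prod>p\<in>primes_le M. 1 - of_nat p powr (- z))"
  have exp_sum: "exp (\<Sum>n<Suc M. if prime n then - Ln (1 - of_nat n powr (- z)) else 0) * P M = 1" for M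
  proof -
    have "(\<Sum>n<Suc M. if prime n then - Ln (1 - of_nat n powr (- z)) else 0) =
        (\<Sum>p\<in>primes_le M. - Ln (1 - of_nat p powr (- z)))"
      by (intro sum.mono_neutral_cong_right) auto
    moreover have "exp (\<Sum>p\<in>primes_le M. - Ln (1 - of_nat p powr (- z))) = (\<Prod>p\<in>primes_le M. inverse (1 - of_nat p powr (- z)))"
      using z one_minus_powr_nonzero by (subst exp_sum) (auto simp: exp_minus intro!: prod.cong)
    ultimately have "exp (\<Sum>n<Suc M. if prime n then - Ln (1 - of_nat n powr (- z)) else 0) * P M =
        (\<Prod>p\<in>primes_le M. inverse (1 - of_nat p powr (- z)) * (1 - of_nat p powr (- z)))"
      unfolding P_def by (simp only: prod.distrib)
    also have "\<dots> = 1"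
      by (rule prod.neutral) (use z one_minus_powr_nonzero(2) in auto)
    finally show ?thesis .
  qed
  have "(\<lambda>M. \<Sum>n<Suc M. if prime n then - Ln (1 - of_nat n powr (- z)) else 0) \<longlonglongrightarrow> log_zeta_euler z"
    using log_zeta_euler_sums[OF z] unfolding sums_def by (rule LIMSEQ_Suc)
  then have 1: "(\<lambda>M. exp (\<Sum>n<Suc M. if prime n then - Ln (1 - of_nat n powr (- z)) else 0)) \<longlonglongrightarrow> exp (log_zeta_euler z)"
    by (rule tendsto_exp)
  have "(\<lambda>M. sieved_zeta M z - 1) \<longlonglongrightarrow> 0"
  proof (rule Lim_null_comparison)
    show "eventually (\<lambda>M. norm (sieved_zeta M z - 1) \<le> real M powr (- (Re z - 1)) / (Re z - 1)) sequentially"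
      using eventually_gt_at_top[of 0] 
    proof eventually_elim
      case (elim M)
      show ?case
        by (rule norm_sieved_zeta_minus_1_le[of "Re z - 1" z M]) (use z elim in linarith)+
    qed
    show "(\<lambda>M. real M powr (- (Re z - 1)) / (Re z - 1)) \<longlonglongrightarrow> 0"
      using z by real_asymp
  qed
  then have "(\<lambda>M. sieved_zeta M z) \<longlonglongrightarrow> 1"
    by (simp add: LIM_zero_iff)
  from tendsto_mult[OF 1 this]
  have "(\<lambda>M. exp (\<Sum>n<Suc M. if prime n then - Ln (1 - of_nat n powr (- z)) else 0) * sieved_zeta M z)
      \<longlonglongrightarrow> exp (log_zeta_euler z)" by simp
  moreover have "exp (\<Sum>n<Suc M. if prime n then - Ln (1 - of_nat n powr (- z)) else 0) * sieved_zeta M z = zeta z" for M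
  proof -
    have "sieved_zeta M z = zeta z * P M" by (simp add: sieved_zeta_def P_def)
    then show ?thesis by (simp only: mult.left_commute[of _ "zeta z"] exp_sum mult_1_right)
  qed
  ultimately show ?thesis by (simp only: LIMSEQ_const_iff)
qed

lemma zeta_nonzero: "Re z > 1 \<Longrightarrow> zeta z \<noteq> 0"
  using exp_log_zeta_euler[of z] by auto

lemma holomorphic_log_zeta_euler: "log_zeta_euler holomorphic_on {z. Re z > 1}"
proof -
  let ?f = "\<lambda>n z. if prime n then - Ln (1 - of_nat n powr (- z)) else 0"
  have "(\<lambda>z. \<Sum>n. ?f n z) holomorphic_on {z. Re z > 1}"
  proof (rule holomorphic_suminf)
    show "open {z. Re z > 1}" by (rule open_halfspace_Re_gt)
    show "?f n holomorphic_on {z. Re z > 1}" for n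
      using one_minus_powr_nonzero(3)[of n]
      by (cases "prime n") (auto intro!: holomorphic_intros dest: prime_gt_0_nat)
    fix z assume z: "z \<in> {z. Re z > 1}"
    define d where "d = (Re z - 1) / 2"
    have "d > 0" using z by (simp add: d_def)
    have Re: "Re w \<ge> 1 + d" if "w \<in> cball z d" for w
    proof -
      have "\<bar>Re z - Re w\<bar> \<le> d"
        using that abs_Re_le_cmod[of "z - w"] by (simp add: dist_norm)
      then show ?thesis using abs_ge_self[of "Re z - Re w"] unfolding d_def by argo
    qed
    show "\<exists>d>0. \<exists>M. cball z d \<subseteq> {z. Re z > 1} \<and> summable M \<and>
          (\<forall>n. \<forall>w\<in>cball z d. norm (?f n w) \<le> M n)"
    proof (intro exI conjI allI ballI)
      show "d > 0" by fact
      show "cball z d \<subseteq> {z. Re z > 1}" using Re \<open>d > 0\<close> by force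
      show "summable (\<lambda>n. 2 * real n powr (- 1 - d))"
        using \<open>d > 0\<close> by (intro summable_mult) (simp add: summable_real_powr_iff)
      fix n w assume w: "w \<in> cball z d"
      show "norm (?f n w) \<le> 2 * real n powr (- 1 - d)"
      proof (cases "prime n")
        case True
        have "norm (?f n w) \<le> 2 * real n powr (- Re w)"
          using norm_euler_term_le[of w n] True Re[OF w] \<open>d > 0\<close> by simp
        also have "\<dots> \<le> 2 * real n powr (- 1 - d)"
          using Re[OF w] prime_gt_0_nat[OF True] by (intro mult_left_mono powr_mono) auto
        finally show ?thesis .
      qed auto
    qed
  qed
  then show ?thesis
    by (rule holomorphic_transform) (use log_zeta_euler_sums sums_unique in fastforce)
qed

section \<open>Continuation of the logarithm along horizontal rays\<close>

lemma right_ray_connected: "connected (right_ray z)"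
proof -
  have "right_ray z = (\<lambda>u. z + of_real u) ` {0..}" by (auto simp: right_ray_def)
  then show ?thesis by (auto intro!: connected_continuous_image continuous_intros)
qed

lemma right_ray_far: "z + of_real (2 + \<bar>Re z\<bar>) \<in> right_ray z"
  unfolding right_ray_def by (intro CollectI exI[of _ "2 + \<bar>Re z\<bar>"]) auto

text \<open>
  The branch of the logarithm does not depend on the domain of the continuation: two continuations
  agree on the component of the intersection of their domains that contains the ray.
\<close>

lemma log_zeta_eqI:
  assumes V: "open V" "connected V" and ray: "right_ray z \<subseteq> V"
    and F: "F holomorphic_on V" "\<And>s. s \<in> V \<Longrightarrow> Re s > 1 \<Longrightarrow> F s = log_zeta_euler s"
  shows "log_zeta z = F z"
proof (cases "Re z > 1")
  case True
  have "z \<in> right_ray z" by (auto simp: right_ray_def intro: exI[of _ 0])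
  then show ?thesis using True ray F(2) by (auto simp: log_zeta_def)
next
  case False
  define P where "P = (\<lambda>w. \<exists>U F. open U \<and> connected U \<and> right_ray z \<subseteq> U \<and> F holomorphic_on U \<and>
                         (\<forall>s\<in>U. Re s > 1 \<longrightarrow> F s = log_zeta_euler s) \<and> F z = w)"
  have z: "z \<in> right_ray z" by (auto simp: right_ray_def intro: exI[of _ 0])
  have "(THE w. P w) = F z"
  proof (rule the_equality)
    show "P (F z)" unfolding P_def using V ray F by blast
    fix w assume "P w"
    then obtain U G where U: "open U" "right_ray z \<subseteq> U" "G holomorphic_on U"
      "\<And>s. s \<in> U \<Longrightarrow> Re s > 1 \<Longrightarrow> G s = log_zeta_euler s" "G z = w"
      unfolding P_def by blast
    define W where "W = connected_component_set (U \<inter> V) z"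
    have W: "open W" "connected W" "W \<subseteq> U \<inter> V"
      unfolding W_def using U(1) V connected_component_subset[of "U \<inter> V" z]
      by (auto intro: open_connected_component)
    have rayW: "right_ray z \<subseteq> W"
      unfolding W_def using z ray U(2) by (intro connected_component_maximal right_ray_connected) auto
    have "G z = F z"
    proof (rule analytic_continuation_open[of "W \<inter> {s. Re s > 1}" W G F])
      show "open (W \<inter> {s. Re s > 1})" using W by (intro open_Int open_halfspace_Re_gt)
      show "W \<inter> {s. Re s > 1} \<noteq> {}"
        using right_ray_far[of z] rayW by (auto intro!: exI[of _ "z + of_real (2 + \<bar>Re z\<bar>)"])
      show "G holomorphic_on W" "F holomorphic_on W"
        using U(3) F(1) W(3) by (auto elim: holomorphic_on_subset)
      show "G s = F s" if "s \<in> W \<inter> {s. Re s > 1}" for s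
      proof -
        have "s \<in> U" "s \<in> V" "Re s > 1" using that W(3) by auto
        then show ?thesis using U(4) F(2) by simp
      qed
    qed (use W z rayW in auto)
    then show "w = F z" using U(5) by simp
  qed
  then show ?thesis using False by (simp add: log_zeta_def P_def)
qed

text \<open>A convex open set that contains the right ray of each of its points, hence one domain of
  continuation for all of them at once.\<close>

definition half_strip :: "real \<Rightarrow> real \<Rightarrow> real \<Rightarrow> complex set" where
  "half_strip a t r = {z. Re z > a \<and> Im z > t - r \<and> Im z < t + r}"

lemma half_strip:
  "open (half_strip a t r)" "convex (half_strip a t r)"
  "z \<in> half_strip a t r \<Longrightarrow> right_ray z \<subseteq> half_strip a t r"
proof -
  have eq: "half_strip a t r = {z. Re z > a} \<inter> {z. Im z > t - r} \<inter> {z. Im z < t + r}"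
    by (auto simp: half_strip_def)
  show "open (half_strip a t r)"
    unfolding eq by (intro open_Int open_halfspace_Re_gt open_halfspace_Im_gt open_halfspace_Im_lt)
  show "convex (half_strip a t r)"
    unfolding eq by (intro convex_Int convex_halfspace_Re_gt convex_halfspace_Im_gt convex_halfspace_Im_lt)
  show "z \<in> half_strip a t r \<Longrightarrow> right_ray z \<subseteq> half_strip a t r"
    by (auto simp: half_strip_def right_ray_def)
qed

lemma log_zeta_definedI:
  assumes "\<And>w. w \<in> right_ray z \<Longrightarrow> zeta w \<noteq> 0"
  shows "log_zeta_defined z"
  unfolding log_zeta_defined_def
proof (intro ballI conjI)
  fix w assume "w \<in> right_ray z"
  then show "zeta w \<noteq> 0" by (rule assms)
  then have "w \<noteq> 1" using zeta_1 by auto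
  then show "\<not> is_pole zeta w"
    by (intro not_is_pole_holomorphic[OF _ _ holomorphic_zeta]) auto
qed

text \<open>This provides the continuity behind the measurability of the set in the theorem. The
  part of the ray up to real part 2 is compact, hence at positive distance from the closed zero set,
  which contains 1; further right there are no zeros. So a thin half strip is free of zeros and
  carries a holomorphic logarithm, which differs from the Euler branch by a constant.\<close>

lemma log_zeta_local_branch:
  assumes "log_zeta_defined z"
  obtains V F where "open V" "z \<in> V" "F holomorphic_on V"
    "\<And>w. w \<in> V \<Longrightarrow> log_zeta_defined w" "\<And>w. w \<in> V \<Longrightarrow> log_zeta w = F w"
proof -
  obtain E where E: "E holomorphic_on UNIV" "\<And>s. zeta s = E s / (s - 1)"
    using zeta_eq_entire_quotient by metis
  define Z where "Z = {w. zeta w = 0}"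
  have "Z = E -` {0} \<union> {1}" using E(2) by (auto simp: Z_def)
  moreover have "closed (E -` {0})"
    by (intro continuous_closed_vimage) 
       (use holomorphic_on_imp_continuous_on[OF E(1)] in \<open>auto simp: continuous_on_eq_continuous_at\<close>)
  ultimately have "closed Z" by simp
  define U where "U = max 0 (2 - Re z)"
  define S where "S = (\<lambda>u. z + of_real u) ` {0..U}"
  have "compact S" unfolding S_def by (intro compact_continuous_image continuous_intros) auto
  have "S \<subseteq> right_ray z" by (auto simp: S_def right_ray_def)
  then have "S \<inter> Z = {}" using assms by (auto simp: log_zeta_defined_def Z_def)
  then obtain d where d: "d > 0" "\<And>x y. x \<in> S \<Longrightarrow> y \<in> Z \<Longrightarrow> d \<le> dist x y"
    using separate_compact_closed[OF \<open>compact S\<close> \<open>closed Z\<close>] by blast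
  define r where "r = d / 2"
  define V where "V = half_strip (Re z - r) (Im z) r"
  have "z \<in> V" using d by (auto simp: V_def half_strip_def r_def)
  have nz: "zeta w \<noteq> 0" if "w \<in> V" for w
  proof (cases "Re w > 1")
    case False
    \<comment> \<open>The point of the ray with the same real part as w, or z itself if w lies
      further left.\<close>
    define u where "u = max 0 (Re w - Re z)"
    have u: "z + of_real u \<in> S"
      unfolding S_def u_def using False by (intro imageI) (auto simp: U_def)
    have "dist (z + of_real u) w \<le> \<bar>Re (z + of_real u - w)\<bar> + \<bar>Im (z + of_real u - w)\<bar>"
      unfolding dist_norm by (rule cmod_le)
    also have "\<dots> < r + r"
      using that by (intro add_le_less_mono) (auto simp: V_def half_strip_def u_def)
    finally have "dist (z + of_real u) w < d" by (simp add: r_def)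
    then show ?thesis using d(2)[OF u, of w] by (auto simp: Z_def)
  qed (rule zeta_nonzero)
  have V: "open V" "convex V" unfolding V_def by (rule half_strip)+
  have ray: "right_ray w \<subseteq> V" if "w \<in> V" for w using that half_strip(3) unfolding V_def by blast
  have "1 \<notin> V" using nz zeta_1 by auto
  then have holV: "zeta holomorphic_on V" by (intro holomorphic_on_subset[OF holomorphic_zeta]) auto
  obtain g where g: "g holomorphic_on V" "\<And>x. x \<in> V \<Longrightarrow> exp (g x) = zeta x"
    using holomorphic_logarithm_exists[OF V(2,1) holV nz \<open>z \<in> V\<close>] by blast
  define V1 where "V1 = V \<inter> {s. Re s > 1}"
  have V1: "open V1" "convex V1" unfolding V1_def
    using V by (auto intro!: convex_Int open_Int open_halfspace_Re_gt convex_halfspace_Re_gt)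
  define h where "h = (\<lambda>s. g s - log_zeta_euler s)"
  have h: "h holomorphic_on V1"
    unfolding h_def V1_def using g(1) holomorphic_log_zeta_euler
    by (auto intro!: holomorphic_intros elim: holomorphic_on_subset)
  have exp_h: "exp (h s) = 1" if "s \<in> V1" for s
    using that g(2)[of s] exp_log_zeta_euler[of s] zeta_nonzero[of s]
    by (simp add: h_def exp_diff V1_def)
  \<comment> \<open>Differentiating \<open>exp (h s) = 1\<close> gives h' = 0, and \<open>V1\<close>
    is convex.\<close>
  have "\<exists>c. \<forall>s\<in>V1. h s = c"
  proof (rule has_field_derivative_zero_constant[OF V1(2)])
    fix s assume s: "s \<in> V1"
    have d1: "(h has_field_derivative deriv h s) (at s)"
      using h V1(1) s by (rule holomorphic_derivI)
    then have "((\<lambda>s. exp (h s)) has_field_derivative exp (h s) * deriv h s) (at s)"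
      by (rule DERIV_fun_exp)
    moreover have "((\<lambda>s. exp (h s)) has_field_derivative 0) (at s)"
      by (rule has_field_derivative_transform_within_open[OF DERIV_const V1(1) s]) (simp add: exp_h)
    ultimately have "exp (h s) * deriv h s = 0" by (rule DERIV_unique)
    then show "(h has_field_derivative 0) (at s within V1)"
      using d1 by (simp add: has_field_derivative_at_within)
  qed
  then obtain c where c: "\<And>s. s \<in> V1 \<Longrightarrow> h s = c" by blast
  show ?thesis
  proof (rule that[of V "\<lambda>s. g s - c"])
    show "log_zeta_defined w" if "w \<in> V" for w
      using ray[OF that] nz by (intro log_zeta_definedI) blast
    show "log_zeta w = g w - c" if "w \<in> V" for w
    proof (rule log_zeta_eqI[OF V(1) convex_connected[OF V(2)] ray[OF that]])
      show "g s - c = log_zeta_euler s" if "s \<in> V" "Re s > 1" for s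
        using c[of s] that by (auto simp: V1_def h_def)
    qed (intro holomorphic_intros g)
  qed (use V \<open>z \<in> V\<close> g in \<open>auto intro!: holomorphic_intros\<close>)
qed

lemma open_log_zeta_defined: "open {z. log_zeta_defined z}"
  by (subst open_subopen) (metis (mono_tags, lifting) log_zeta_local_branch mem_Collect_eq subsetI)

lemma continuous_log_zeta: "continuous_on {z. log_zeta_defined z} log_zeta"
proof (rule continuous_at_imp_continuous_on, intro ballI)
  fix z assume "z \<in> {z. log_zeta_defined z}"
  then obtain V F where V: "open V" "z \<in> V" "F holomorphic_on V" "\<And>w. w \<in> V \<Longrightarrow> log_zeta w = F w"
    using log_zeta_local_branch by (metis mem_Collect_eq)
  have "continuous_on V log_zeta"
    using holomorphic_on_imp_continuous_on[OF V(3)] by (rule continuous_on_eq) (simp add: V(4))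
  then show "isCont log_zeta z" using continuous_on_eq_continuous_at[OF V(1)] V(2) by blast
qed

text \<open>Within distance 1/2 of 1 the principal logarithm is holomorphic, so the right-hand side
  is a holomorphic function on the half strip. For real part above 3/2 it equals the Euler branch,
  because the primes beyond M contribute too little to leave the principal strip; the identity
  theorem carries the equality over to real part above 1.\<close>

lemma log_zeta_eq_sieved:
  assumes a: "a > 0" and M: "M > 2"
    and near: "\<And>w. w \<in> half_strip a t r \<Longrightarrow> norm (sieved_zeta M w - 1) < 1/2"
    and z: "z \<in> half_strip a t r"
  shows "log_zeta_defined z"
    "log_zeta z = Ln (sieved_zeta M z) - (\<Sum>p\<in>primes_le M. Ln (1 - of_nat p powr (- z)))"
proof -
  define V where "V = half_strip a t r"
  have V: "open V" "convex V" "z \<in> V" "\<And>w. w \<in> V \<Longrightarrow> right_ray w \<subseteq> V"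
    unfolding V_def by (auto intro: half_strip z dest: half_strip(3))
  have ReV: "Re w > 0" if "w \<in> V" for w using that a by (auto simp: V_def half_strip_def)
  have nz: "zeta w \<noteq> 0" if "w \<in> V" for w
    using near[of w] that by (auto simp: V_def sieved_zeta_def)
  show "log_zeta_defined z" using nz V by (intro log_zeta_definedI) blast
  have "1 \<notin> V" using nz zeta_1 by auto
  then have holV: "zeta holomorphic_on V" by (intro holomorphic_on_subset[OF holomorphic_zeta]) auto
  define F where "F = (\<lambda>z. Ln (sieved_zeta M z) - (\<Sum>p\<in>primes_le M. Ln (1 - of_nat p powr (- z))))"
  have slit: "sieved_zeta M w \<notin> \<real>\<^sub>\<le>\<^sub>0" if "w \<in> V" for w
  proof -
    have "\<bar>Re (sieved_zeta M w - 1)\<bar> < 1/2"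
      using near[of w] that abs_Re_le_cmod[of "sieved_zeta M w - 1"] by (simp add: V_def)
    then have "Re (sieved_zeta M w) > 0" unfolding abs_less_iff by simp
    then show ?thesis by (auto simp: complex_nonpos_Reals_iff)
  qed
  have F: "F holomorphic_on V"
  proof -
    have "sieved_zeta M holomorphic_on V"
      unfolding sieved_zeta_def [abs_def] by (intro holomorphic_intros holV) (auto dest: prime_gt_0_nat)
    then have L: "(\<lambda>z. Ln (sieved_zeta M z)) holomorphic_on V"
      by (intro holomorphic_on_compose_gen[OF _ holomorphic_on_Ln[of "- \<real>\<^sub>\<le>\<^sub>0"], unfolded o_def])
         (use slit in auto)
    have "(\<lambda>z. \<Sum>p\<in>primes_le M. Ln (1 - of_nat p powr (- z))) holomorphic_on V"
      using ReV one_minus_powr_nonzero(3) by (intro holomorphic_intros) (auto dest: prime_gt_0_nat)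
    with L show ?thesis unfolding F_def by (rule holomorphic_on_diff)
  qed
  have far: "F w = log_zeta_euler w" if w: "w \<in> V" "Re w > 3/2" for w
  proof -
    let ?f = "\<lambda>p. - Ln (1 - of_nat p powr (- w))"
    define L where "L = log_zeta_euler w - (\<Sum>p\<in>primes_le M. ?f p)"
    have L: "(?f has_sum L) ({p. prime p} - primes_le M)"
      unfolding L_def
      by (intro has_sum_Diff log_zeta_euler_has_sum) (use w in \<open>auto simp: has_sum_finite_iff\<close>)
    have "norm L \<le> 2 * real M powr (- (1/2)) / (1/2)"
    proof (rule norm_tail_sum_le[OF L])
      fix p assume p: "p \<in> {p. prime p} - primes_le M"
      then show "M < p" by auto
      have "norm (?f p) \<le> 2 * real p powr (- Re w)"
        using norm_euler_term_le[of w p] p w by simp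
      also have "\<dots> \<le> 2 * real p powr (- (1/2) - 1)"
        using w p by (intro mult_left_mono powr_mono) (auto dest: prime_gt_0_nat)
      finally show "norm (?f p) \<le> 2 * real p powr (- (1/2) - 1)" .
    qed (use M in auto)
    \<comment> \<open>As M \<ge> 3, the bound 4 / sqrt M is below 3 < pi, so \<open>Ln\<close>
      inverts \<open>exp\<close> at L.\<close>
    also have "\<dots> < 2 * 3 / 2"
    proof -
      have "real M powr (- (1/2)) \<le> 3 powr (- (1/2))"
        using M by (intro powr_mono2') auto
      also have "\<dots> < 3 / 4"
      proof -
        have "4 / 3 < sqrt (3::real)" by (rule real_less_rsqrt) (simp add: power2_eq_square)
        then show ?thesis by (simp add: powr_minus powr_half_sqrt field_simps)
      qed
      finally show ?thesis by simp
    qed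
    finally have "\<bar>Im L\<bar> < pi"
      using abs_Im_le_cmod[of L] pi_gt3 by linarith
    then have "Ln (exp L) = L" by (intro Ln_exp) (auto simp: abs_less_iff)
    moreover have "exp L = sieved_zeta M w"
    proof -
      have "exp L = zeta w * exp (\<Sum>p\<in>primes_le M. Ln (1 - of_nat p powr (- w)))"
        using exp_log_zeta_euler[of w] w by (simp add: L_def sum_negf exp_add[symmetric] exp_add)
      also have "exp (\<Sum>p\<in>primes_le M. Ln (1 - of_nat p powr (- w))) = (\<Prod>p\<in>primes_le M. 1 - of_nat p powr (- w))"
        using ReV[OF w(1)] one_minus_powr_nonzero(2) by (subst exp_sum) (auto intro!: prod.cong)
      finally show ?thesis by (simp add: sieved_zeta_def)
    qed
    ultimately show ?thesis by (simp add: F_def L_def sum_negf)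
  qed
  have eq: "F w = log_zeta_euler w" if w: "w \<in> V" "Re w > 1" for w
  proof (rule analytic_continuation_open[of "V \<inter> {s. Re s > 3/2}" "V \<inter> {s. Re s > 1}" F log_zeta_euler])
    show "open (V \<inter> {s. Re s > 3/2})" "open (V \<inter> {s. Re s > 1})"
      using V by (intro open_Int open_halfspace_Re_gt; simp)+
    have "z + of_real (2 + \<bar>Re z\<bar>) \<in> V \<inter> {s. Re s > 3/2}"
      using V(4)[OF V(3)] right_ray_far[of z] by auto
    then show "V \<inter> {s. Re s > 3/2} \<noteq> {}" by blast
    show "connected (V \<inter> {s. Re s > 1})"
      using V by (intro convex_connected convex_Int convex_halfspace_Re_gt)
    show "F holomorphic_on V \<inter> {s. Re s > 1}" "log_zeta_euler holomorphic_on V \<inter> {s. Re s > 1}"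
      using F holomorphic_log_zeta_euler by (auto elim: holomorphic_on_subset)
  qed (use w far in auto)
  show "log_zeta z = Ln (sieved_zeta M z) - (\<Sum>p\<in>primes_le M. Ln (1 - of_nat p powr (- z)))"
    using log_zeta_eqI[OF V(1) convex_connected[OF V(2)] V(4)[OF V(3)] F eq] by (simp add: F_def)
qed

section \<open>Mean values of Dirichlet polynomials\<close>

lemma cis_integral:
  assumes "a \<le> b"
  obtains J where "((\<lambda>t. cis (\<mu> * t)) has_integral J) {a..b}"
    "\<mu> = 0 \<Longrightarrow> J = of_real (b - a)" "\<mu> \<noteq> 0 \<Longrightarrow> norm J \<le> 2 / \<bar>\<mu>\<bar>"
proof (cases "\<mu> = 0")
  case True
  have "((\<lambda>t. 1 :: complex) has_integral of_real (b - a)) {a..b}"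
    using has_integral_const_real[of "1::complex" a b] assms by (simp add: scaleR_conv_of_real)
  with True show ?thesis by (intro that[of "of_real (b - a)"]) auto
next
  case False
  define F where "F = (\<lambda>t. cis (\<mu> * t) / (\<i> * of_real \<mu>))"
  have "((\<lambda>t. cis (\<mu> * t)) has_integral (F b - F a)) {a..b}"
  proof (rule fundamental_theorem_of_calculus[OF assms])
    fix t assume "t \<in> {a..b}"
    have "((\<lambda>x. exp (\<i> * of_real \<mu> * of_real x) / (\<i> * of_real \<mu>)) has_vector_derivative exp (\<i> * of_real \<mu> * of_real t)) (at t within {a..b})"
      using False
      by (auto intro!: derivative_eq_intros has_vector_derivative_real_field)
    then show "(F has_vector_derivative cis (\<mu> * t)) (at t within {a..b})"
      by (simp add: F_def cis_conv_exp mult.assoc)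
  qed
  moreover have "norm (F b - F a) \<le> 2 / \<bar>\<mu>\<bar>"
  proof -
    have "norm (F b - F a) \<le> norm (F b) + norm (F a)" by (rule norm_triangle_ineq4)
    then show ?thesis by (simp add: F_def norm_divide norm_mult)
  qed
  ultimately show ?thesis using False by (intro that[of "F b - F a"]) auto
qed

lemma integral_norm_square_trig_sum:
  fixes c :: "'i \<Rightarrow> complex" and freq :: "'i \<Rightarrow> real"
  assumes I: "finite I" and inj: "inj_on freq I" and ab: "a \<le> b"
  defines "D \<equiv> \<lambda>t. \<Sum>i\<in>I. c i * cis (- (freq i * t))"
  shows "\<bar>integral {a..b} (\<lambda>t. (norm (D t))\<^sup>2) - (b - a) * (\<Sum>i\<in>I. (norm (c i))\<^sup>2)\<bar>
           \<le> (\<Sum>i\<in>I. \<Sum>j\<in>I - {i}. norm (c i) * norm (c j) * (2 / \<bar>freq i - freq j\<bar>))"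
proof -
  define J where "J = (\<lambda>i j. integral {a..b} (\<lambda>t. cis ((freq j - freq i) * t)))"
  have J: "((\<lambda>t. cis ((freq j - freq i) * t)) has_integral J i j) {a..b}"
    "freq i = freq j \<Longrightarrow> J i j = of_real (b - a)"
    "freq i \<noteq> freq j \<Longrightarrow> norm (J i j) \<le> 2 / \<bar>freq i - freq j\<bar>" for i j
  proof -
    obtain J' where J': "((\<lambda>t. cis ((freq j - freq i) * t)) has_integral J') {a..b}"
      "freq j - freq i = 0 \<Longrightarrow> J' = of_real (b - a)" "freq j - freq i \<noteq> 0 \<Longrightarrow> norm J' \<le> 2 / \<bar>freq j - freq i\<bar>"
      using cis_integral[OF ab, of "freq j - freq i"] by blast
    have "J' = J i j" unfolding J_def using J'(1) by (rule integral_unique[symmetric])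
    with J' show "((\<lambda>t. cis ((freq j - freq i) * t)) has_integral J i j) {a..b}"
      "freq i = freq j \<Longrightarrow> J i j = of_real (b - a)"
      "freq i \<noteq> freq j \<Longrightarrow> norm (J i j) \<le> 2 / \<bar>freq i - freq j\<bar>"
      by (simp_all add: abs_minus_commute)
  qed
  have "((\<lambda>t. \<Sum>i\<in>I. \<Sum>j\<in>I. (c i * cnj (c j)) * cis ((freq j - freq i) * t)) has_integral
      (\<Sum>i\<in>I. \<Sum>j\<in>I. (c i * cnj (c j)) * J i j)) {a..b}"
    by (intro has_integral_sum I has_integral_mult_right J)
  moreover have "(\<Sum>i\<in>I. \<Sum>j\<in>I. (c i * cnj (c j)) * cis ((freq j - freq i) * t)) = of_real ((norm (D t))\<^sup>2)" for t
  proof -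
    have "of_real ((norm (D t))\<^sup>2) = D t * cnj (D t)" by (rule complex_norm_square)
    also have "\<dots> = (\<Sum>i\<in>I. \<Sum>j\<in>I. c i * cis (- (freq i * t)) * (cnj (c j) * cis (freq j * t)))"
      unfolding D_def cnj_sum sum_product by (simp add: cis_cnj)
    also have "\<dots> = (\<Sum>i\<in>I. \<Sum>j\<in>I. (c i * cnj (c j)) * cis ((freq j - freq i) * t))"
    proof (intro sum.cong refl)
      fix i j
      have "cis ((freq j - freq i) * t) = cis (- (freq i * t)) * cis (freq j * t)"
        by (simp add: cis_mult algebra_simps)
      then show "c i * cis (- (freq i * t)) * (cnj (c j) * cis (freq j * t)) = (c i * cnj (c j)) * cis ((freq j - freq i) * t)"
        by simp
    qed
    finally show ?thesis by simp
  qed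
  ultimately have int1: "((\<lambda>t. complex_of_real ((norm (D t))\<^sup>2)) has_integral
      (\<Sum>i\<in>I. \<Sum>j\<in>I. (c i * cnj (c j)) * J i j)) {a..b}"
    by simp
  have "(\<lambda>t. (norm (D t))\<^sup>2) integrable_on {a..b}"
    unfolding D_def by (intro integrable_continuous_real continuous_intros)
  then have "((\<lambda>t. complex_of_real ((norm (D t))\<^sup>2)) has_integral
      of_real (integral {a..b} (\<lambda>t. (norm (D t))\<^sup>2))) {a..b}"
    by (intro has_integral_of_real integrable_integral)
  then have eq: "of_real (integral {a..b} (\<lambda>t. (norm (D t))\<^sup>2)) = (\<Sum>i\<in>I. \<Sum>j\<in>I. (c i * cnj (c j)) * J i j)"
    using int1 by (rule has_integral_unique)
  have "(\<Sum>j\<in>I. (c i * cnj (c j)) * J i j) = of_real ((b - a) * (norm (c i))\<^sup>2) +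
      (\<Sum>j\<in>I - {i}. (c i * cnj (c j)) * J i j)" if "i \<in> I" for i
    using that I by (subst sum.remove[of _ i]) (auto simp: J(2) complex_norm_square simp del: of_real_power)
  then have "of_real (integral {a..b} (\<lambda>t. (norm (D t))\<^sup>2)) =
      of_real ((b - a) * (\<Sum>i\<in>I. (norm (c i))\<^sup>2)) + (\<Sum>i\<in>I. \<Sum>j\<in>I - {i}. (c i * cnj (c j)) * J i j)"
    unfolding eq by (simp add: sum.distrib sum_distrib_left)
  then have "complex_of_real (integral {a..b} (\<lambda>t. (norm (D t))\<^sup>2) - (b - a) * (\<Sum>i\<in>I. (norm (c i))\<^sup>2)) =
      (\<Sum>i\<in>I. \<Sum>j\<in>I - {i}. (c i * cnj (c j)) * J i j)"
    by simp
  from arg_cong[where f = norm, OF this]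
  have "\<bar>integral {a..b} (\<lambda>t. (norm (D t))\<^sup>2) - (b - a) * (\<Sum>i\<in>I. (norm (c i))\<^sup>2)\<bar> =
      norm (\<Sum>i\<in>I. \<Sum>j\<in>I - {i}. (c i * cnj (c j)) * J i j)"
    by (simp only: norm_of_real)
  also have "\<dots> \<le> (\<Sum>i\<in>I. \<Sum>j\<in>I - {i}. norm (c i) * norm (c j) * (2 / \<bar>freq i - freq j\<bar>))"
  proof (intro order_trans[OF norm_sum] sum_mono)
    fix i j assume "i \<in> I" "j \<in> I - {i}"
    then have "freq i \<noteq> freq j" using inj by (auto simp: inj_on_def)
    then show "norm ((c i * cnj (c j)) * J i j) \<le> norm (c i) * norm (c j) * (2 / \<bar>freq i - freq j\<bar>)"
      unfolding norm_mult complex_mod_cnj by (intro mult_left_mono J) auto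
  qed
  finally show ?thesis .
qed

text \<open>Let x < y be the two numbers. Their logarithms differ by at least (y - x) / y, and -7/8
  = 1/8 - 1 turns the powers into \<open>(x * y) powr (1/8) / (x * y)\<close>. The splitting 1/(x (y
  - x)) = 1/(x y) + 1/(y (y - x)) leaves sums that are essentially harmonic for fixed n.\<close>

lemma inverse_ln_diff_le:
  assumes "0 < m" "0 < n" "m \<noteq> n" "m \<le> Y" "n \<le> Y"
  shows "(real m powr (-7/8) * real n powr (-7/8)) * (2 / \<bar>ln (real m) - ln (real n)\<bar>)
    \<le> 2 * real Y powr (1/4) * (1 / (real m * real n) + 1 / (real n * \<bar>real m - real n\<bar>))"
proof -
  define x y where "x = real (min m n)" and "y = real (max m n)"
  have xy: "0 < x" "x < y" "y \<le> real Y" and y: "y \<ge> real n" using assms by (auto simp: x_def y_def)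
  have sym: "(real m powr (-7/8) * real n powr (-7/8)) * (2 / \<bar>ln (real m) - ln (real n)\<bar>)
      = (x powr (-7/8) * y powr (-7/8)) * (2 / (ln y - ln x))"
    "real m * real n = x * y" "\<bar>real m - real n\<bar> = y - x"
    using assms by (auto simp: x_def y_def min_def max_def abs_if)
  have "ln (x / y) \<le> x / y - 1" using xy by (intro ln_le_minus_one) auto
  then have ln: "(y - x) / y \<le> ln y - ln x" using xy by (simp add: ln_div diff_divide_distrib)
  have pow: "x powr (-7/8) * y powr (-7/8) = (x powr (1/8) * y powr (1/8)) / (x * y)"
    using xy powr_diff[of x "1/8" 1] powr_diff[of y "1/8" 1] by simp
  have "x powr (1/8) * y powr (1/8) \<le> real Y powr (1/8) * real Y powr (1/8)"
    using xy by (intro mult_mono powr_mono2) auto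
  also have "\<dots> = real Y powr (1/4)" by (simp flip: powr_add)
  finally have Y: "x powr (1/8) * y powr (1/8) \<le> real Y powr (1/4)" .
  have "(x powr (-7/8) * y powr (-7/8)) * (2 / (ln y - ln x)) \<le> (real Y powr (1/4) / (x * y)) * (2 / ((y - x) / y))"
    unfolding pow using xy ln Y by (intro mult_mono divide_right_mono divide_left_mono) (auto intro!: mult_pos_pos)
  also have "\<dots> = 2 * real Y powr (1/4) * (1 / (x * y) + 1 / (y * (y - x)))"
    using xy by (simp add: divide_simps)
  also have "\<dots> \<le> 2 * real Y powr (1/4) * (1 / (x * y) + 1 / (real n * (y - x)))"
    using xy y assms by (intro mult_left_mono add_left_mono divide_left_mono mult_right_mono mult_pos_pos) auto
  finally show ?thesis unfolding sym .
qed

lemma sum_inverse_distance_le: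
  assumes "n \<le> Y"
  shows "(\<Sum>m\<in>{1..Y} - {n}. 1 / \<bar>real m - real n\<bar>) \<le> 2 * harm Y"
proof -
  have "(\<Sum>m\<in>{1..Y} - {n}. 1 / \<bar>real m - real n\<bar>) =
      (\<Sum>m\<in>{1..<n}. 1 / \<bar>real m - real n\<bar>) + (\<Sum>m\<in>{n<..Y} - {0}. 1 / \<bar>real m - real n\<bar>)"
    using assms by (subst sum.union_disjoint[symmetric]) (auto intro!: sum.cong)
  also have "(\<Sum>m\<in>{1..<n}. 1 / \<bar>real m - real n\<bar>) = (\<Sum>k\<in>{1..<n}. 1 / real k)"
    by (rule sum.reindex_bij_witness[of _ "\<lambda>k. n - k" "\<lambda>k. n - k"]) (auto simp: of_nat_diff)
  also have "\<dots> \<le> (\<Sum>k\<in>{1..Y}. 1 / real k)"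
    using assms by (intro sum_mono2) auto
  also have "(\<Sum>m\<in>{n<..Y} - {0}. 1 / \<bar>real m - real n\<bar>) = (\<Sum>k\<in>{1..Y - n}. 1 / real k)"
    by (rule sum.reindex_bij_witness[of _ "\<lambda>k. n + k" "\<lambda>k. k - n"]) (auto simp: of_nat_diff)
  also have "\<dots> \<le> (\<Sum>k\<in>{1..Y}. 1 / real k)"
    by (intro sum_mono2) auto
  finally show ?thesis by (simp add: harm_def inverse_eq_divide)
qed

lemma off_diagonal_le:
  assumes J: "J \<subseteq> {1..Y}" and b: "\<And>n. n \<in> J \<Longrightarrow> norm (b n :: complex) \<le> L * real n powr (-7/8)" and L: "L \<ge> 0"
  shows "(\<Sum>n\<in>J. \<Sum>m\<in>J - {n}. norm (b n) * norm (b m) * (2 / \<bar>ln (real n) - ln (real m)\<bar>))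
           \<le> 6 * L\<^sup>2 * real Y powr (1/4) * (harm Y)\<^sup>2"
proof -
  have fin: "finite J" using J finite_subset by blast
  let ?B = "\<lambda>m n. 2 * L\<^sup>2 * real Y powr (1/4) * (1 / (real m * real n) + 1 / (real n * \<bar>real m - real n\<bar>))"
  have "(\<Sum>n\<in>J. \<Sum>m\<in>J - {n}. norm (b n) * norm (b m) * (2 / \<bar>ln (real n) - ln (real m)\<bar>))
      \<le> (\<Sum>n\<in>J. \<Sum>m\<in>J - {n}. ?B m n)"
  proof (intro sum_mono)
    fix n m assume nm: "n \<in> J" "m \<in> J - {n}"
    then have pos: "0 < n" "0 < m" "m \<noteq> n" "m \<le> Y" "n \<le> Y" using J by auto
    have "norm (b n) * norm (b m) * (2 / \<bar>ln (real n) - ln (real m)\<bar>)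
        \<le> (L * real n powr (-7/8)) * (L * real m powr (-7/8)) * (2 / \<bar>ln (real n) - ln (real m)\<bar>)"
      using nm b L by (intro mult_mono) auto
    also have "\<dots> = L\<^sup>2 * ((real m powr (-7/8) * real n powr (-7/8)) * (2 / \<bar>ln (real m) - ln (real n)\<bar>))"
      by (simp add: power2_eq_square mult_ac abs_minus_commute)
    also have "\<dots> \<le> L\<^sup>2 * (2 * real Y powr (1/4) * (1 / (real m * real n) + 1 / (real n * \<bar>real m - real n\<bar>)))"
      using pos by (intro mult_left_mono inverse_ln_diff_le) auto
    finally show "norm (b n) * norm (b m) * (2 / \<bar>ln (real n) - ln (real m)\<bar>) \<le> ?B m n"
      by (simp add: mult_ac)
  qed
  also have "\<dots> \<le> (\<Sum>n\<in>{1..Y}. \<Sum>m\<in>{1..Y} - {n}. ?B m n)"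
  proof -
    have "(\<Sum>n\<in>J. \<Sum>m\<in>J - {n}. ?B m n) \<le> (\<Sum>n\<in>J. \<Sum>m\<in>{1..Y} - {n}. ?B m n)"
      using J by (intro sum_mono sum_mono2) auto
    also have "\<dots> \<le> (\<Sum>n\<in>{1..Y}. \<Sum>m\<in>{1..Y} - {n}. ?B m n)"
      using J by (intro sum_mono2 sum_nonneg) auto
    finally show ?thesis .
  qed
  \<comment> \<open>Of the three harmonic sums one comes from 1/m and two from 1/|m - n|, one for
    each side of n.\<close>
  also have "\<dots> \<le> (\<Sum>n\<in>{1..Y}. 2 * L\<^sup>2 * real Y powr (1/4) * (3 * harm Y / real n))"
  proof (intro sum_mono)
    fix n assume n: "n \<in> {1..Y}"
    have "(\<Sum>m\<in>{1..Y} - {n}. ?B m n) = 2 * L\<^sup>2 * real Y powr (1/4) *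
       (1 / real n * ((\<Sum>m\<in>{1..Y} - {n}. 1 / real m) + (\<Sum>m\<in>{1..Y} - {n}. 1 / \<bar>real m - real n\<bar>)))"
      by (simp add: sum_distrib_left sum.distrib distrib_left mult_ac)
    also have "\<dots> \<le> 2 * L\<^sup>2 * real Y powr (1/4) * (1 / real n * (harm Y + 2 * harm Y))"
    proof (intro mult_left_mono add_mono)
      show "(\<Sum>m\<in>{1..Y} - {n}. 1 / real m) \<le> harm Y"
        unfolding harm_def inverse_eq_divide by (intro sum_mono2) auto
      show "(\<Sum>m\<in>{1..Y} - {n}. 1 / \<bar>real m - real n\<bar>) \<le> 2 * harm Y"
        using n by (intro sum_inverse_distance_le) auto
    qed auto
    finally show "(\<Sum>m\<in>{1..Y} - {n}. ?B m n) \<le> 2 * L\<^sup>2 * real Y powr (1/4) * (3 * harm Y / real n)"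
      by simp
  qed
  also have "\<dots> = 6 * L\<^sup>2 * real Y powr (1/4) * (harm Y)\<^sup>2"
  proof -
    have "(\<Sum>n\<in>{1..Y}. K * (3 * harm Y / real n)) = K * (3 * harm Y * (\<Sum>n\<in>{1..Y}. inverse (real n)))" for K :: real
      by (simp add: sum_distrib_left divide_inverse)
    from this[of "2 * L\<^sup>2 * real Y powr (1/4)"] show ?thesis
      unfolding harm_def[symmetric] by (simp add: power2_eq_square)
  qed
  finally show ?thesis .
qed

text \<open>The index set is kept abstract, with an injection \<nu> into the integers, because it
  will consist of pairs (a, m) with \<nu> (a, m) = a m.\<close>

lemma integral_norm_square_dirichlet_le:
  fixes c :: "'i \<Rightarrow> complex" and \<nu> :: "'i \<Rightarrow> nat"
  assumes I: "finite I" and inj: "inj_on \<nu> I" and range: "\<And>i. i \<in> I \<Longrightarrow> \<nu> i \<in> {1..Y}"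
    and c: "\<And>i. i \<in> I \<Longrightarrow> norm (c i) \<le> L * real (\<nu> i) powr (-7/8)" and "L \<ge> 0" and ab: "a \<le> b"
  shows "integral {a..b} (\<lambda>t. (norm (\<Sum>i\<in>I. c i * cis (- (ln (real (\<nu> i)) * t))))\<^sup>2)
           \<le> (b - a) * (\<Sum>i\<in>I. (norm (c i))\<^sup>2) + 6 * L\<^sup>2 * real Y powr (1/4) * (harm Y)\<^sup>2"
proof -
  define b' where "b' = (\<lambda>n. c (the_inv_into I \<nu> n))"
  have b': "b' (\<nu> i) = c i" if "i \<in> I" for i
    using that by (simp add: b'_def the_inv_into_f_f[OF inj])
  have freq: "inj_on (\<lambda>i. ln (real (\<nu> i))) I"
  proof (rule inj_onI)
    fix i j assume ij: "i \<in> I" "j \<in> I" "ln (real (\<nu> i)) = ln (real (\<nu> j))"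
    then have "\<nu> i = \<nu> j" using range[of i] range[of j] by (simp add: Suc_le_eq)
    then show "i = j" using inj ij by (auto dest: inj_onD)
  qed
  have "(\<Sum>i\<in>I. \<Sum>j\<in>I - {i}. norm (c i) * norm (c j) * (2 / \<bar>ln (real (\<nu> i)) - ln (real (\<nu> j))\<bar>)) =
      (\<Sum>n\<in>\<nu> ` I. \<Sum>m\<in>\<nu> ` I - {n}. norm (b' n) * norm (b' m) * (2 / \<bar>ln (real n) - ln (real m)\<bar>))"
    unfolding sum.reindex[OF inj] o_def
  proof (rule sum.cong[OF refl])
    fix i assume i: "i \<in> I"
    have "\<nu> ` I - {\<nu> i} = \<nu> ` (I - {i})" using inj i by (auto simp: inj_on_def)
    then show "(\<Sum>j\<in>I - {i}. norm (c i) * norm (c j) * (2 / \<bar>ln (real (\<nu> i)) - ln (real (\<nu> j))\<bar>)) =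
       (\<Sum>m\<in>\<nu> ` I - {\<nu> i}. norm (b' (\<nu> i)) * norm (b' m) * (2 / \<bar>ln (real (\<nu> i)) - ln (real m)\<bar>))"
      using i b' by (simp add: sum.reindex[OF inj_on_subset[OF inj]])
  qed
  also have "\<dots> \<le> 6 * L\<^sup>2 * real Y powr (1/4) * (harm Y)\<^sup>2"
    using range c b' \<open>L \<ge> 0\<close> by (intro off_diagonal_le) auto
  finally show ?thesis
    using integral_norm_square_trig_sum[OF I freq ab, of c] by linarith
qed

lemma harm_le_ln:
  assumes "n > 0"
  shows "harm n \<le> ln (real n) + 1"
proof -
  obtain m where m: "n = Suc m" using assms gr0_conv_Suc by blast
  have "harm (Suc m) - ln (real (Suc m)) \<le> harm (Suc 0) - ln (real (Suc 0))"
    using decseq_harm_diff_ln by (rule decseqD) simp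
  then show ?thesis by (simp add: m harm_Suc harm_expand)
qed

text \<open>
  The square of the norm of this Dirichlet polynomial is a Fejer-like kernel which concentrates,
  for large \<open>k\<close>, on those \<open>t\<close> for which \<open>p powr (-it)\<close> is close to the prescribed phase for all
  primes \<open>p\<close> up to \<open>M\<close>.
\<close>

definition phase_weight :: "nat \<Rightarrow> nat \<Rightarrow> (nat \<Rightarrow> complex) \<Rightarrow> real \<Rightarrow> complex" where
  "phase_weight M k \<omega> t = (\<Prod>p\<in>primes_le M. ((1 + cnj (\<omega> p) * cis (- (ln (real p) * t))) / 2) ^ k)"

lemma norm_phase_factor_le:
  assumes "norm w = 1"
  shows "norm ((1 + cnj w * cis x) / 2) \<le> 1"
  using norm_triangle_ineq[of 1 "cnj w * cis x"] assms by (simp add: norm_mult norm_divide)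

lemma norm_phase_weight_le:
  assumes "\<And>p. norm (\<omega> p) = 1"
  shows "norm (phase_weight M k \<omega> t) \<le> 1"
  unfolding phase_weight_def prod_norm[symmetric]
  by (intro prod_le_1)
     (use assms norm_phase_factor_le in \<open>auto simp: norm_power simp del: norm_divide intro!: power_le_one\<close>)

text \<open>Unique factorization as used for a smooth factor a and a rough factor m: a divides a' m'
  and is coprime to m', so it divides a', and conversely.\<close>

lemma coprime_mult_eqD:
  fixes a m a' m' :: nat
  assumes "a * m = a' * m'" "coprime a m'" "coprime a' m" "a > 0"
  shows "a = a'" "m = m'"
proof -
  have "a dvd a' * m'" "a' dvd a * m" using assms(1) by (metis dvd_triv_left)+
  then have "a dvd a'" "a' dvd a"
    using assms(2,3) by (auto simp: coprime_dvd_mult_left_iff)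
  then show "a = a'" by (rule dvd_antisym)
  then show "m = m'" using assms by simp
qed

lemma prime_power_in_rough:
  assumes "prime (Suc M)"
  shows "Suc M ^ e \<in> rough M"
proof -
  have "\<not> p dvd Suc M ^ e" if "prime p" "p \<le> M" for p
  proof
    assume "p dvd Suc M ^ e"
    then have "p dvd Suc M" using that(1) by (rule prime_dvd_power[rotated])
    then show False using primes_dvd_imp_eq[OF that(1) assms] that(2) by auto
  qed
  then show ?thesis by (auto simp: rough_def simp del: power_Suc)
qed

lemma coprime_prime_rough:
  assumes "prime (Suc M)" "m \<in> rough (Suc M)"
  shows "coprime (Suc M ^ e) m"
  using assms by (intro coprime_power_left_iff[THEN iffD2] disjI1 prime_imp_coprime) (auto simp: rough_def)

text \<open>The binomial expansion of each factor has coefficients of total absolute mass 1 and k +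
  1 terms, which gives the bound on the number of frequencies. Smoothness of the frequencies is
  expressed as coprimality to all rough numbers. Mass and number of terms together bound the mean
  square from below.\<close>

lemma phase_weight_dirichlet:
  assumes \<omega>: "\<And>p. norm (\<omega> p) = 1"
  shows "\<exists>S c. finite S \<and> (\<forall>a\<in>S. a > 0 \<and> (\<forall>m\<in>rough M. coprime a m)) \<and>
           (\<Sum>a\<in>S. norm (c a)) = 1 \<and> card S \<le> (k + 1) ^ M \<and>
           (\<forall>t. phase_weight M k \<omega> t = (\<Sum>a\<in>S. c a * cis (- (ln (real a) * t))))"
proof (induction M)
  case 0
  have "primes_le 0 = {}" by auto
  then have "phase_weight 0 k \<omega> t = 1" for t unfolding phase_weight_def by (simp only: prod.empty)
  then show ?case
    by (intro exI[of _ "{1}"] exI[of _ "\<lambda>_. 1"]) auto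
next
  case (Suc M)
  then obtain S c where S: "finite S" "\<And>a m. a \<in> S \<Longrightarrow> a > 0" "\<And>a m. a \<in> S \<Longrightarrow> m \<in> rough M \<Longrightarrow> coprime a m"
    "(\<Sum>a\<in>S. norm (c a)) = 1" "card S \<le> (k + 1) ^ M"
    "\<And>t. phase_weight M k \<omega> t = (\<Sum>a\<in>S. c a * cis (- (ln (real a) * t)))" by blast
  show ?case
  proof (cases "prime (Suc M)")
    case False
    have "card S \<le> (k + 1) ^ Suc M" using S(5) by (rule order_trans) simp
    moreover have "phase_weight (Suc M) k \<omega> t = phase_weight M k \<omega> t" for t
      using False by (simp add: phase_weight_def primes_le_Suc)
    ultimately show ?thesis
      using S False by (intro exI[of _ S] exI[of _ c]) (auto simp: rough_Suc_not_prime)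
  next
    case True
    define p where "p = Suc M"
    have p: "prime p" "p > 0" using True by (auto simp: p_def)
    define \<nu> where "\<nu> = (\<lambda>(a, e). a * p ^ e)"
    define b where "b = (\<lambda>e. of_nat (k choose e) / 2 ^ k * cnj (\<omega> p) ^ e)"
    define I where "I = S \<times> {..k}"
    have inj: "inj_on \<nu> I"
    proof (rule inj_onI, clarsimp simp: \<nu>_def I_def)
      fix a e a' e' assume *: "a \<in> S" "a' \<in> S" "a * p ^ e = a' * p ^ e'"
      have rough: "p ^ n \<in> rough M" for n using prime_power_in_rough[OF True] by (simp add: p_def)
      have "a = a'" "p ^ e = p ^ e'"
        using coprime_mult_eqD[OF *(3) S(3)[OF *(1) rough] S(3)[OF *(2) rough] S(2)[OF *(1)]] by blast+
      then show "a = a' \<and> e = e'" using prime_gt_1_nat[OF p(1)] by simp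
    qed
    define c' where "c' = (\<lambda>n. (\<lambda>(a, e). c a * b e) (the_inv_into I \<nu> n))"
    have c': "c' (\<nu> i) = (\<lambda>(a, e). c a * b e) i" if "i \<in> I" for i
      using that by (simp add: c'_def the_inv_into_f_f[OF inj])
    have re: "(\<Sum>n\<in>\<nu> ` I. g (c' n) n) = (\<Sum>a\<in>S. \<Sum>e\<le>k. g (c a * b e) (a * p ^ e))" for g :: "complex \<Rightarrow> nat \<Rightarrow> 'z::comm_monoid_add"
      unfolding sum.reindex[OF inj] sum.cartesian_product I_def[symmetric]
    proof (rule sum.cong[OF refl])
      fix i assume "i \<in> I"
      then show "((\<lambda>n. g (c' n) n) \<circ> \<nu>) i = (case i of (a, e) \<Rightarrow> g (c a * b e) (a * p ^ e))"
        using c' by (simp add: \<nu>_def split_beta)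
    qed
    have bsum: "(\<Sum>e\<le>k. norm (b e)) = 1"
    proof -
      have "(\<Sum>e\<le>k. norm (b e)) = (\<Sum>e\<le>k. real (k choose e)) / 2 ^ k"
        using \<omega> by (simp add: b_def norm_mult norm_divide norm_power sum_divide_distrib)
      also have "(\<Sum>e\<le>k. real (k choose e)) = 2 ^ k"
        using choose_row_sum[of k] by (metis of_nat_numeral of_nat_power of_nat_sum)
      finally show ?thesis by simp
    qed
    show ?thesis
    proof (intro exI[of _ "\<nu> ` I"] exI[of _ c'] conjI ballI allI)
      show "finite (\<nu> ` I)" using S by (simp add: I_def)
      show "n > 0" if "n \<in> \<nu> ` I" for n using that S p by (auto simp: I_def \<nu>_def)
      show "coprime n m" if n: "n \<in> \<nu> ` I" and m: "m \<in> rough (Suc M)" for n m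
      proof -
        have "m \<in> rough M" using m by (auto simp: rough_def)
        then show ?thesis
          using n S(3) coprime_prime_rough[OF True m] by (auto simp: I_def \<nu>_def p_def)
      qed
      have "(\<Sum>n\<in>\<nu> ` I. norm (c' n)) = (\<Sum>a\<in>S. norm (c a) * (\<Sum>e\<le>k. norm (b e)))"
        using re[of "\<lambda>x n. norm x"] by (simp add: norm_mult sum_distrib_left)
      then show "(\<Sum>n\<in>\<nu> ` I. norm (c' n)) = 1" by (simp add: bsum S(4))
      have "card (\<nu> ` I) = card S * (k + 1)"
        unfolding card_image[OF inj] by (simp add: I_def card_cartesian_product)
      also have "\<dots> \<le> (k + 1) ^ M * (k + 1)" using S(5) by (rule mult_right_mono) simp
      finally show "card (\<nu> ` I) \<le> (k + 1) ^ Suc M" by (simp add: mult.commute)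
      fix t
      define u where "u = cnj (\<omega> p) * cis (- (ln (real p) * t))"
      have "((1 + u) / 2) ^ k = (u + 1) ^ k / 2 ^ k" by (simp add: power_divide add.commute)
      also have "\<dots> = (\<Sum>e\<le>k. of_nat (k choose e) / 2 ^ k * u ^ e)"
        by (simp add: binomial_ring sum_divide_distrib)
      also have "\<dots> = (\<Sum>e\<le>k. b e * cis (- (ln (real (p ^ e)) * t)))"
      proof (rule sum.cong[OF refl])
        fix e
        have "u ^ e = cnj (\<omega> p) ^ e * cis (- (ln (real (p ^ e)) * t))"
          using p by (simp add: u_def power_mult_distrib Complex.DeMoivre ln_realpow mult.assoc)
        then show "of_nat (k choose e) / 2 ^ k * u ^ e = b e * cis (- (ln (real (p ^ e)) * t))"
          by (simp add: b_def)
      qed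
      finally have factor: "((1 + u) / 2) ^ k = (\<Sum>e\<le>k. b e * cis (- (ln (real (p ^ e)) * t)))" .
      have "phase_weight (Suc M) k \<omega> t = phase_weight M k \<omega> t * ((1 + u) / 2) ^ k"
        using True by (simp add: phase_weight_def primes_le_Suc u_def p_def mult.commute del: of_nat_Suc)
      also have "\<dots> = (\<Sum>a\<in>S. \<Sum>e\<le>k. (c a * b e) * cis (- (ln (real (a * p ^ e)) * t)))"
        unfolding factor S(6) sum_product
      proof (intro sum.cong refl)
        fix a e assume "a \<in> S"
        then have "ln (real (a * p ^ e)) = ln (real a) + ln (real (p ^ e))"
          using S(2) p by (simp add: ln_mult)
        then show "c a * cis (- (ln (real a) * t)) * (b e * cis (- (ln (real (p ^ e)) * t))) =
            c a * b e * cis (- (ln (real (a * p ^ e)) * t))"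
          by (simp add: cis_mult algebra_simps)
      qed
      also have "\<dots> = (\<Sum>n\<in>\<nu> ` I. c' n * cis (- (ln (real n) * t)))"
        using re[of "\<lambda>x n. x * cis (- (ln (real n) * t))"] by simp
      finally show "phase_weight (Suc M) k \<omega> t = (\<Sum>n\<in>\<nu> ` I. c' n * cis (- (ln (real n) * t)))" .
    qed
  qed
qed

section \<open>Weighted mean square of the sieved zeta-function\<close>

lemma powr_vertical_shift:
  assumes "n > 0"
  shows "of_nat n powr (- (z + \<i> * of_real t)) = of_nat n powr (- z) * cis (- (ln (real n) * t))"
proof -
  have "of_nat n powr (- (z + \<i> * of_real t)) = of_nat n powr (- z) * of_nat n powr (- (\<i> * of_real t))"
    by (simp flip: powr_add)
  also have "of_nat n powr (- (\<i> * of_real t)) = cis (- (ln (real n) * t))"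
    using assms by (simp add: powr_def cis_conv_exp Ln_of_nat mult_ac)
  finally show ?thesis .
qed

text \<open>The cutoff has to lie well beyond T: with x = T the term
  \<open>norm s * x powr (-7/8)\<close> would grow like \<open>T powr (1/8)\<close>. With the square
  of T both error terms have order \<open>T powr (-3/4)\<close>.\<close>

lemma zeta_err_vertical_le:
  assumes z: "Re z \<ge> 7/8" "Re z \<le> 3" "\<bar>Im z\<bar> \<le> 1" and T: "T \<ge> 4" and t: "t \<in> {T..2 * T}"
  shows "zeta_err (z + \<i> * of_real t) (T\<^sup>2) \<le> 6 * T powr (-3/4)"
proof -
  define s where "s = z + \<i> * of_real t"
  have "norm s \<le> norm z + norm (\<i> * of_real t)" unfolding s_def by (rule norm_triangle_ineq)
  also have "norm z \<le> \<bar>Re z\<bar> + \<bar>Im z\<bar>" by (rule cmod_le)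
  also have "norm (\<i> * of_real t) = t" using t T by (simp add: norm_mult)
  finally have s: "norm s \<le> 4 * T" using z t T by simp
  have "T / 2 \<le> \<bar>Im (s - 1)\<bar>" using z t T by (simp add: s_def abs_le_iff)
  also have "\<dots> \<le> norm (s - 1)" by (rule abs_Im_le_cmod)
  finally have s1: "T / 2 \<le> norm (s - 1)" .
  have sq: "(T\<^sup>2) powr x = T powr (2 * x)" for x
    using T by (simp add: powr_powr flip: powr_numeral)
  have "zeta_err s (T\<^sup>2) = T powr (1/4) / norm (s - 1) + norm s * T powr (-7/4)"
    by (simp add: zeta_err_def sq)
  also have "\<dots> \<le> T powr (1/4) / (T / 2) + 4 * T * T powr (-7/4)"
    using s s1 T by (intro add_mono divide_left_mono mult_right_mono mult_pos_pos) auto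
  also have "\<dots> = 6 * T powr (-3/4)"
  proof -
    have "T powr (1/4) / T = T powr (-3/4)" "T * T powr (-7/4) = T powr (-3/4)"
      using T powr_diff[of T "1/4" 1] powr_add[of T 1 "-7/4"] by simp_all
    moreover have "T powr (1/4) / (T / 2) + 4 * T * T powr (-7/4) = 2 * (T powr (1/4) / T) + 4 * (T * T powr (-7/4))"
      by simp
    ultimately show ?thesis by (simp only:)
  qed
  finally show ?thesis by (simp add: s_def)
qed

lemma holomorphic_sieved_zeta: "sieved_zeta M holomorphic_on - {1}"
  unfolding sieved_zeta_def [abs_def]
  by (intro holomorphic_intros holomorphic_zeta) (auto dest: prime_gt_0_nat)

lemma continuous_phase_weight [continuous_intros]:
  "continuous_on A f \<Longrightarrow> continuous_on A (\<lambda>x. phase_weight M k \<omega> (f x))"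
  unfolding phase_weight_def by (intro continuous_intros) auto

lemma continuous_sieved_zeta [continuous_intros]:
  "continuous_on A f \<Longrightarrow> (\<And>x. x \<in> A \<Longrightarrow> f x \<noteq> 1) \<Longrightarrow> continuous_on A (\<lambda>x. sieved_zeta M (f x))"
  by (rule continuous_on_compose2[OF holomorphic_on_imp_continuous_on[OF holomorphic_sieved_zeta]]) auto

lemma norm_add_square_le:
  fixes x y :: complex
  shows "(norm (x + y))\<^sup>2 \<le> 2 * (norm x)\<^sup>2 + 2 * (norm y)\<^sup>2"
proof -
  have "(norm (x + y))\<^sup>2 \<le> (norm x + norm y)\<^sup>2"
    by (intro power_mono norm_triangle_ineq) auto
  also have "\<dots> \<le> 2 * (norm x)\<^sup>2 + 2 * (norm y)\<^sup>2"
    using sum_squares_bound[of "norm x" "norm y"] by (simp add: power2_sum)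
  finally show ?thesis .
qed

text \<open>Here \<open>cw\<close> is the diagonal sum of the weight. The frequencies a m of the
  weight times the rough sum are distinct, so the diagonal sum of this product is \<open>cw\<close>
  times the sum of m powr (-2 Re z) over the rough m > 1 in range, at most
  \<open>4/3 * M powr (-3/4)\<close>. It is essential for the later exchange of integrals that
  \<open>T0\<close> does not depend on z.\<close>

lemma phase_weight_mean_square:
  fixes M k :: nat
  assumes \<omega>: "\<And>p. norm (\<omega> p) = 1" and M: "M > 0"
  obtains cw T0 where "cw \<ge> 1 / (real k + 1) ^ M" "T0 \<ge> 4"
    "\<And>T. T \<ge> T0 \<Longrightarrow> 7 / 8 * T * cw \<le> integral {T..2*T} (\<lambda>t. (norm (phase_weight M k \<omega> t))\<^sup>2)"
    "\<And>T z. T \<ge> T0 \<Longrightarrow> 7/8 \<le> Re z \<Longrightarrow> Re z \<le> 3 \<Longrightarrow> \<bar>Im z\<bar> \<le> 1 \<Longrightarrow>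
       integral {T..2*T} (\<lambda>t. (norm (phase_weight M k \<omega> t))\<^sup>2 * (norm (sieved_zeta M (z + \<i> * of_real t) - 1))\<^sup>2)
         \<le> 4 * T * cw * real M powr (-3/4)"
proof -
  from phase_weight_dirichlet[of \<omega> M k, OF \<omega>] obtain S c where *: "finite S"
    "\<forall>a\<in>S. a > 0 \<and> (\<forall>m\<in>rough M. coprime a m)" "(\<Sum>a\<in>S. norm (c a)) = 1" "card S \<le> (k + 1) ^ M"
    "\<forall>t. phase_weight M k \<omega> t = (\<Sum>a\<in>S. c a * cis (- (ln (real a) * t)))"
    by (elim exE conjE)
  have S: "finite S" "\<And>a. a \<in> S \<Longrightarrow> a > 0" "\<And>a m. a \<in> S \<Longrightarrow> m \<in> rough M \<Longrightarrow> coprime a m"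
    "(\<Sum>a\<in>S. norm (c a)) = 1" "card S \<le> (k + 1) ^ M"
    "\<And>t. phase_weight M k \<omega> t = (\<Sum>a\<in>S. c a * cis (- (ln (real a) * t)))"
    using * by auto
  obtain C where C: "C > 0" "\<And>s x. Re s \<ge> 7/8 \<Longrightarrow> s \<noteq> 1 \<Longrightarrow> x \<ge> fact M \<Longrightarrow>
     norm (sieved_zeta M s - (\<Sum>n | n \<in> rough M \<and> real n \<le> x. of_nat n powr (- s))) \<le> C * zeta_err s x"
    using sieved_zeta_approx[of M] by blast
  define cw where "cw = (\<Sum>a\<in>S. (norm (c a))\<^sup>2)"
  \<comment> \<open>Cauchy-Schwarz: the absolute values sum to 1 and there are at most (k + 1) ^ M
    of them.\<close>
  have cw: "cw \<ge> 1 / (real k + 1) ^ M"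
  proof -
    have "1 \<le> cw * real (card S)"
      using sum_squared_le_sum_of_squares[of "\<lambda>a. norm (c a)" S] S(4) by (simp add: cw_def)
    also have "\<dots> \<le> cw * (real k + 1) ^ M"
    proof (rule mult_left_mono)
      show "real (card S) \<le> (real k + 1) ^ M"
        using S(5) by (metis Suc_eq_plus1 of_nat_Suc of_nat_le_iff of_nat_power add.commute)
    qed (simp add: cw_def sum_nonneg)
    finally show ?thesis by (simp add: divide_le_eq)
  qed
  have "cw > 0" by (rule less_le_trans[OF _ cw]) simp
  \<comment> \<open>A crude bound for all smooth frequencies. It bounds the length of the product
    and absorbs the factor \<open>a powr (7/8)\<close> that appears when decay in m is rewritten as
    decay in a m.\<close>
  define L where "L = (\<Sum>a\<in>S. a)"
  have aL: "a \<le> L" if "a \<in> S" for a unfolding L_def using S(1) that by (intro member_le_sum) auto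
  have "S \<noteq> {}" using S(4) by auto
  then have L: "L \<ge> 1" using S(2) aL by (metis Suc_leI One_nat_def ex_in_conv le_trans)
  have c1: "norm (c a) \<le> 1" if "a \<in> S" for a
    using S(1) S(4) that member_le_sum[of a S "\<lambda>a. norm (c a)"] by simp
  define B where "B = (\<Sum>i\<in>S. \<Sum>j\<in>S - {i}. norm (c i) * norm (c j) * (2 / \<bar>ln (real i) - ln (real j)\<bar>))"
  have mean: "T * cw - B \<le> integral {T..2*T} (\<lambda>t. (norm (phase_weight M k \<omega> t))\<^sup>2)" if "T \<ge> 0" for T
  proof -
    have inj: "inj_on (\<lambda>a. ln (real a)) S" using S(2) by (auto intro!: inj_onI)
    from integral_norm_square_trig_sum[OF S(1) inj, of T "2 * T" c] that
    show ?thesis unfolding S(6) B_def cw_def abs_le_iff by simp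
  qed
  define E where "E = (\<lambda>T::real. 6 * (real L)\<^sup>2 * (real L * T\<^sup>2) powr (1/4) * (ln (real L * T\<^sup>2) + 1)\<^sup>2)"
  have main: "integral {T..2*T} (\<lambda>t. (norm (phase_weight M k \<omega> t))\<^sup>2 * (norm (sieved_zeta M (z + \<i> * of_real t) - 1))\<^sup>2)
         \<le> 2 * (T * cw * (4/3 * real M powr (-3/4)) + E T) + 2 * T * (C * (6 * T powr (-3/4)))\<^sup>2"
    if T: "T \<ge> 4" "T\<^sup>2 \<ge> fact M" and z: "7/8 \<le> Re z" "Re z \<le> 3" "\<bar>Im z\<bar> \<le> 1" for T z
  proof -
    \<comment> \<open>The term m = 1 is left out, so the sum over R approximates the sieved function
      minus 1.\<close>
    define R where "R = {m \<in> rough M. real m \<le> T\<^sup>2} - {1}"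
    have "finite R" unfolding R_def by simp
    have R: "m > M" "m > 0" "m \<in> rough M" "real m \<le> T\<^sup>2" if "m \<in> R" for m
      using that rough_gt[of m M] by (auto simp: R_def rough_def)
    define A where "A = (\<lambda>t. \<Sum>m\<in>R. of_nat m powr (- z) * cis (- (ln (real m) * t)))"
    define I where "I = S \<times> R"
    define \<nu> where "\<nu> = (\<lambda>(a, m). a * m :: nat)"
    define d where "d = (\<lambda>(a, m). c a * of_nat m powr (- z))"
    define N where "N = nat \<lfloor>T\<^sup>2\<rfloor>"
    define Y where "Y = L * N"
    have "T * T \<ge> 4 * 4" using T by (intro mult_mono) auto
    then have N: "real N \<le> T\<^sup>2" "N \<ge> 1" unfolding N_def power2_eq_square by linarith+
    have Y: "Y > 0" "real Y \<le> real L * T\<^sup>2" using L N by (auto simp: Y_def intro!: mult_left_mono)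
    have prod: "phase_weight M k \<omega> t * A t = (\<Sum>i\<in>I. d i * cis (- (ln (real (\<nu> i)) * t)))" for t
      unfolding S(6) A_def sum_product I_def sum.cartesian_product
    proof (intro sum.cong refl, clarify)
      fix a m assume "a \<in> S" "m \<in> R"
      then have "ln (real (a * m)) = ln (real a) + ln (real m)" using S(2) R by (simp add: ln_mult)
      then show "c a * cis (- (ln (real a) * t)) * (of_nat m powr (- z) * cis (- (ln (real m) * t)))
          = d (a, m) * cis (- (ln (real (\<nu> (a, m))) * t))"
        by (simp add: d_def \<nu>_def cis_mult algebra_simps)
    qed
    have inj: "inj_on \<nu> I"
    proof (rule inj_onI, clarsimp simp: \<nu>_def I_def)
      fix a m a' m' assume *: "a \<in> S" "m \<in> R" "a' \<in> S" "m' \<in> R" "a * m = a' * m'"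
      show "a = a' \<and> m = m'"
        using coprime_mult_eqD[OF *(5) S(3)[OF *(1) R(3)[OF *(4)]] S(3)[OF *(3) R(3)[OF *(2)]] S(2)[OF *(1)]] by blast
    qed
    have range: "\<nu> i \<in> {1..Y}" if iI: "i \<in> I" for i
    proof -
      obtain a m where i: "i = (a, m)" "a \<in> S" "m \<in> R" using iI by (auto simp: I_def)
      have "m \<le> N" using R(4)[OF i(3)] unfolding N_def by linarith
      then show ?thesis using i S(2) R aL by (auto simp: \<nu>_def Y_def Suc_le_eq intro!: mult_mono)
    qed
    have d_le: "norm (d i) \<le> real L * real (\<nu> i) powr (-7/8)" if iI: "i \<in> I" for i
    proof -
      obtain a m where i: "i = (a, m)" "a \<in> S" "m \<in> R" using iI by (auto simp: I_def)
      have a: "a > 0" "real a \<ge> 1" using S(2)[OF i(2)] by auto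
      have "norm (d i) = norm (c a) * real m powr (- Re z)"
        using R(2)[OF i(3)] by (simp add: i d_def norm_mult norm_of_nat_powr)
      also have "\<dots> \<le> 1 * real m powr (-7/8)"
        using c1[OF i(2)] R(2)[OF i(3)] z by (intro mult_mono powr_mono) auto
      also have "\<dots> = real a powr (7/8) * real (\<nu> i) powr (-7/8)"
        using a by (simp add: i \<nu>_def powr_mult powr_minus)
      also have "\<dots> \<le> real L * real (\<nu> i) powr (-7/8)"
      proof (rule mult_right_mono)
        have "real a powr (7/8) \<le> real a powr 1" using a by (intro powr_mono) auto
        also have "\<dots> \<le> real L" using aL[OF i(2)] a by simp
        finally show "real a powr (7/8) \<le> real L" .
      qed simp
      finally show ?thesis .
    qed
    have sum_d: "(\<Sum>i\<in>I. (norm (d i))\<^sup>2) \<le> cw * (4/3 * real M powr (-3/4))"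
    proof -
      have "(\<Sum>i\<in>I. (norm (d i))\<^sup>2) = cw * (\<Sum>m\<in>R. (norm (of_nat m powr (- z) :: complex))\<^sup>2)"
        unfolding cw_def sum_product I_def sum.cartesian_product
        by (intro sum.cong) (auto simp: d_def norm_mult power_mult_distrib)
      also have "(\<Sum>m\<in>R. (norm (of_nat m powr (- z) :: complex))\<^sup>2) \<le> (\<Sum>m\<in>R. real m powr (- (3/4) - 1))"
      proof (rule sum_mono)
        fix m assume "m \<in> R"
        then have m: "m > 0" by (rule R)
        have "(norm (of_nat m powr (- z) :: complex))\<^sup>2 = real m powr (2 * - Re z)"
          using m by (simp add: norm_of_nat_powr power2_eq_square flip: powr_add)
        also have "\<dots> \<le> real m powr (- (3/4) - 1)" using m z by (intro powr_mono) auto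
        finally show "(norm (of_nat m powr (- z) :: complex))\<^sup>2 \<le> real m powr (- (3/4) - 1)" .
      qed
      also have "\<dots> \<le> 4/3 * real M powr (-3/4)"
      proof -
        have "norm (\<Sum>m\<in>R. complex_of_real (real m powr (- (3/4) - 1))) \<le> 1 * real M powr (- (3/4)) / (3/4)"
          by (rule norm_tail_sum_le[where A = R and f = "\<lambda>m. of_real (real m powr (- (3/4) - 1))"])
             (use R M \<open>finite R\<close> in \<open>auto intro!: has_sum_finite\<close>)
        then show ?thesis by (simp flip: of_real_sum add: sum_nonneg)
      qed
      finally show ?thesis using \<open>cw > 0\<close> by (simp add: mult_left_mono)
    qed
    have err: "6 * (real L)\<^sup>2 * real Y powr (1/4) * (harm Y)\<^sup>2 \<le> E T"
    proof -
      have "harm Y \<le> ln (real Y) + 1" using Y(1) by (rule harm_le_ln)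
      also have "\<dots> \<le> ln (real L * T\<^sup>2) + 1" using Y by simp
      finally have "harm Y \<le> ln (real L * T\<^sup>2) + 1" .
      then show ?thesis unfolding E_def using Y harm_nonneg[of Y, where 'a = real]
        by (intro mult_mono power_mono powr_mono2) auto
    qed
    have "integral {T..2*T} (\<lambda>t. (norm (\<Sum>i\<in>I. d i * cis (- (ln (real (\<nu> i)) * t))))\<^sup>2)
        \<le> (2*T - T) * (\<Sum>i\<in>I. (norm (d i))\<^sup>2) + 6 * (real L)\<^sup>2 * real Y powr (1/4) * (harm Y)\<^sup>2"
      by (rule integral_norm_square_dirichlet_le[OF _ inj range d_le])
         (use S(1) \<open>finite R\<close> T in \<open>auto simp: I_def\<close>)
    also have "\<dots> \<le> T * (cw * (4/3 * real M powr (-3/4))) + E T"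
      using sum_d err T by (intro add_mono mult_mono) (auto intro: sum_nonneg)
    finally have int_A: "integral {T..2*T} (\<lambda>t. (norm (phase_weight M k \<omega> t * A t))\<^sup>2)
        \<le> T * cw * (4/3 * real M powr (-3/4)) + E T" by (simp add: prod mult.assoc)
    have pointwise: "(norm (phase_weight M k \<omega> t))\<^sup>2 * (norm (sieved_zeta M (z + \<i> * of_real t) - 1))\<^sup>2
        \<le> 2 * (norm (phase_weight M k \<omega> t * A t))\<^sup>2 + 2 * (C * (6 * T powr (-3/4)))\<^sup>2" if t: "t \<in> {T..2*T}" for t
    proof -
      define s where "s = z + \<i> * of_real t"
      have s1: "s \<noteq> 1" using t T z by (auto simp: s_def complex_eq_iff abs_le_iff)
      have sum_s: "(\<Sum>n | n \<in> rough M \<and> real n \<le> T\<^sup>2. of_nat n powr (- s)) = 1 + A t"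
      proof -
        have "{n. n \<in> rough M \<and> real n \<le> T\<^sup>2} = insert 1 R"
          using one_in_rough[of M] \<open>T * T \<ge> 4 * 4\<close> by (auto simp: R_def power2_eq_square)
        moreover have "1 \<notin> R" by (simp add: R_def)
        ultimately have "(\<Sum>n | n \<in> rough M \<and> real n \<le> T\<^sup>2. of_nat n powr (- s)) = 1 + (\<Sum>n\<in>R. of_nat n powr (- s))"
          using \<open>finite R\<close> by simp
        also have "(\<Sum>n\<in>R. of_nat n powr (- s)) = A t"
          unfolding A_def s_def by (intro sum.cong refl powr_vertical_shift R)
        finally show ?thesis .
      qed
      have "norm (sieved_zeta M s - (1 + A t)) \<le> C * zeta_err s (T\<^sup>2)"
        unfolding sum_s[symmetric] using z T s1 by (intro C(2)) (auto simp: s_def)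
      also have "\<dots> \<le> C * (6 * T powr (-3/4))"
        using C(1) zeta_err_vertical_le[OF z T(1) t] by (intro mult_left_mono) (auto simp: s_def)
      finally have approx: "norm (sieved_zeta M s - (1 + A t)) \<le> C * (6 * T powr (-3/4))" .
      define W where "W = phase_weight M k \<omega> t"
      have W: "norm W \<le> 1" unfolding W_def using \<omega> by (rule norm_phase_weight_le)
      have "(norm W)\<^sup>2 * (norm (sieved_zeta M s - 1))\<^sup>2 = (norm (W * A t + W * (sieved_zeta M s - (1 + A t))))\<^sup>2"
        by (simp add: norm_mult[symmetric] power_mult_distrib[symmetric] algebra_simps)
      also have "\<dots> \<le> 2 * (norm (W * A t))\<^sup>2 + 2 * (norm (W * (sieved_zeta M s - (1 + A t))))\<^sup>2"
        by (rule norm_add_square_le)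
      also have "\<dots> \<le> 2 * (norm (W * A t))\<^sup>2 + 2 * (1 * (C * (6 * T powr (-3/4))))\<^sup>2"
        unfolding norm_mult[of W "sieved_zeta M s - (1 + A t)"]
        using W approx by (intro add_left_mono mult_left_mono power_mono mult_mono) auto
      finally show ?thesis by (simp add: W_def s_def)
    qed
    have ne: "z + \<i> * of_real t \<noteq> 1" if "t \<in> {T..2*T}" for t
      using that T z by (auto simp: complex_eq_iff abs_le_iff)
    have "integral {T..2*T} (\<lambda>t. (norm (phase_weight M k \<omega> t))\<^sup>2 * (norm (sieved_zeta M (z + \<i> * of_real t) - 1))\<^sup>2)
        \<le> integral {T..2*T} (\<lambda>t. 2 * (norm (phase_weight M k \<omega> t * A t))\<^sup>2 + 2 * (C * (6 * T powr (-3/4)))\<^sup>2)"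
    proof (rule integral_le)
      show "(\<lambda>t. (norm (phase_weight M k \<omega> t))\<^sup>2 * (norm (sieved_zeta M (z + \<i> * of_real t) - 1))\<^sup>2) integrable_on {T..2*T}"
        by (intro integrable_continuous_real continuous_intros ne) auto
      show "(\<lambda>t. 2 * (norm (phase_weight M k \<omega> t * A t))\<^sup>2 + 2 * (C * (6 * T powr (-3/4)))\<^sup>2) integrable_on {T..2*T}"
        unfolding A_def by (intro integrable_continuous_real continuous_intros)
    qed (rule pointwise)
    also have "\<dots> = 2 * integral {T..2*T} (\<lambda>t. (norm (phase_weight M k \<omega> t * A t))\<^sup>2) + 2 * T * (C * (6 * T powr (-3/4)))\<^sup>2"
    proof -
      have i: "(\<lambda>t. (norm (phase_weight M k \<omega> t * A t))\<^sup>2) integrable_on {T..2*T}"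
        unfolding A_def by (intro integrable_continuous_real continuous_intros)
      show ?thesis
        using T i by (subst integral_add) (auto intro!: integrable_on_cmult_left)
    qed
    also have "\<dots> \<le> 2 * (T * cw * (4/3 * real M powr (-3/4)) + E T) + 2 * T * (C * (6 * T powr (-3/4)))\<^sup>2"
      using int_A by simp
    finally show ?thesis .
  qed
  \<comment> \<open>The square of a sum doubles the diagonal to 8/3; this reserve of 4/3 for
    everything that is o(T) completes the constant 4.\<close>
  define \<eta> where "\<eta> = 4/3 * cw * real M powr (-3/4)"
  have "\<eta> > 0" using \<open>cw > 0\<close> M by (simp add: \<eta>_def)
  have "((\<lambda>T. (2 * E T + 2 * T * (C * (6 * T powr (-3/4)))\<^sup>2) / T) \<longlongrightarrow> 0) at_top"
    unfolding E_def using L C(1) by real_asymp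
  then have ev1: "eventually (\<lambda>T. (2 * E T + 2 * T * (C * (6 * T powr (-3/4)))\<^sup>2) / T < \<eta>) at_top"
    using \<open>\<eta> > 0\<close> by (rule order_tendstoD)
  \<comment> \<open>From T \<ge> 8 B / cw on, the off-diagonal constant B is at most an eighth of
    the main term, whence the factor 7/8.\<close>
  have ev2: "eventually (\<lambda>T::real. T \<ge> max 4 (8 * B / cw)) at_top" by (rule eventually_ge_at_top)
  have ev3: "eventually (\<lambda>T::real. T\<^sup>2 \<ge> fact M) at_top" by real_asymp
  obtain T0 where T0: "\<And>T. T \<ge> T0 \<Longrightarrow> (2 * E T + 2 * T * (C * (6 * T powr (-3/4)))\<^sup>2) / T < \<eta> \<and>
      T \<ge> max 4 (8 * B / cw) \<and> T\<^sup>2 \<ge> fact M"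
    using eventually_conj[OF ev1 eventually_conj[OF ev2 ev3]] unfolding eventually_at_top_linorder by blast
  show ?thesis
  proof (rule that[OF cw, of "max 4 T0"])
    fix T assume T: "T \<ge> max 4 T0"
    have "8 * B / cw \<le> T" using T0[of T] T by auto
    then have "B \<le> T * cw / 8" using \<open>cw > 0\<close> by (simp add: field_simps)
    then show "7 / 8 * T * cw \<le> integral {T..2*T} (\<lambda>t. (norm (phase_weight M k \<omega> t))\<^sup>2)"
      using mean[of T] T by simp
  next
    fix T z assume T: "T \<ge> max 4 T0" and z: "7/8 \<le> Re z" "Re z \<le> 3" "\<bar>Im z\<bar> \<le> 1"
    have "2 * E T + 2 * T * (C * (6 * T powr (-3/4)))\<^sup>2 \<le> \<eta> * T"
      using T0[of T] T by (simp add: divide_less_eq split: if_splits)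
    then show "integral {T..2*T} (\<lambda>t. (norm (phase_weight M k \<omega> t))\<^sup>2 * (norm (sieved_zeta M (z + \<i> * of_real t) - 1))\<^sup>2)
         \<le> 4 * T * cw * real M powr (-3/4)"
      using main[of T z] T0[of T] T z by (simp add: \<eta>_def algebra_simps)
  qed auto
qed

text \<open>No factor of the weight exceeds 1 in norm, so a large product forces each single factor
  to be large. With u the quotient of actual and prescribed phase, the parallelogram identity for 1
  + u and 1 - u then makes |u - 1| small.\<close>

lemma phase_close_of_weight:
  assumes \<omega>: "\<And>p. norm (\<omega> p) = 1" and p: "p \<in> primes_le M" and k: "k > 0" and \<theta>: "0 \<le> \<theta>"
    and W: "\<theta> ^ k \<le> (norm (phase_weight M k \<omega> t))\<^sup>2"
  shows "(norm (cis (- (ln (real p) * t)) - \<omega> p))\<^sup>2 \<le> 4 * (1 - \<theta>)"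
proof -
  define F where "F = (\<lambda>q. (1 + cnj (\<omega> q) * cis (- (ln (real q) * t))) / 2)"
  define u where "u = cnj (\<omega> p) * cis (- (ln (real p) * t))"
  have F1: "norm (F q) \<le> 1" for q unfolding F_def using \<omega> by (rule norm_phase_factor_le)
  have "norm (phase_weight M k \<omega> t) = (\<Prod>q\<in>primes_le M. norm (F q) ^ k)"
    unfolding phase_weight_def F_def by (simp only: prod_norm[symmetric] norm_power)
  also have "\<dots> = norm (F p) ^ k * (\<Prod>q\<in>primes_le M - {p}. norm (F q) ^ k)"
    using p by (intro prod.remove) auto
  also have "\<dots> \<le> norm (F p) ^ k * 1"
    using F1 by (intro mult_left_mono prod_le_1) (auto intro!: power_le_one)
  finally have "(norm (phase_weight M k \<omega> t))\<^sup>2 \<le> (norm (F p) ^ k)\<^sup>2"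
    by (intro power_mono) auto
  with W have "\<theta> ^ k \<le> ((norm (F p))\<^sup>2) ^ k" by (simp add: power_mult[symmetric] mult.commute)
  then have "\<theta> \<le> (norm (F p))\<^sup>2" using k by (simp add: power_mono_iff \<theta>)
  moreover have "(norm (F p))\<^sup>2 = (norm (1 + u))\<^sup>2 / 4"
    by (simp add: F_def u_def norm_divide power_divide)
  ultimately have 1: "4 * \<theta> \<le> (norm (1 + u))\<^sup>2" by simp
  have "norm u = 1" using \<omega> by (simp add: u_def norm_mult)
  then have 2: "(norm (1 + u))\<^sup>2 + (norm (u - 1))\<^sup>2 = 4"
    unfolding cmod_power2 by (simp add: power2_eq_square algebra_simps) (simp add: cmod_def power2_eq_square)
  have "\<omega> p * cnj (\<omega> p) = 1" using complex_norm_square[of "\<omega> p"] \<omega> by simp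
  then have "cis (- (ln (real p) * t)) - \<omega> p = \<omega> p * (u - 1)"
    by (simp add: u_def algebra_simps)
  then have "norm (cis (- (ln (real p) * t)) - \<omega> p) = norm (u - 1)"
    using \<omega> by (simp add: norm_mult)
  with 1 2 show ?thesis by simp
qed

text \<open>Cauchy's formula for the square of h turns a mean square on the circle into a pointwise
  bound inside. The points w keep distance 1/16 from the circle, so the kernel contributes 16 * 2 pi
  * 5/8 = 20 pi, and division by 2 pi leaves 10.\<close>

lemma norm_square_le_circle_mean:
  assumes hol: "h holomorphic_on cball z0 (5/8)" and w: "norm (w - z0) \<le> 9/16"
  shows "(norm (h w))\<^sup>2 \<le> 10 * integral {0..1} (\<lambda>x. (norm (h (circlepath z0 (5/8) x)))\<^sup>2)"
proof -
  define \<gamma> where "\<gamma> = circlepath z0 (5/8)"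
  have sphere: "norm (\<gamma> x - z0) = 5/8" for x
    by (simp add: \<gamma>_def circlepath norm_mult)
  have cont_\<gamma>: "continuous_on {0..1} \<gamma>" unfolding \<gamma>_def circlepath by (intro continuous_intros)
  have cont: "continuous_on {0..1} (\<lambda>x. h (\<gamma> x))"
    by (rule continuous_on_compose2[OF holomorphic_on_imp_continuous_on[OF hol] cont_\<gamma>])
       (use sphere in \<open>auto simp: dist_norm norm_minus_commute\<close>)
  have "((\<lambda>u. (h u)\<^sup>2 / (u - w)) has_contour_integral (2 * of_real pi * \<i> * (h w)\<^sup>2)) \<gamma>"
    unfolding \<gamma>_def
  proof (rule Cauchy_integral_circlepath)
    show "continuous_on (cball z0 (5/8)) (\<lambda>u. (h u)\<^sup>2)"
      using hol by (intro continuous_intros holomorphic_on_imp_continuous_on)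
    show "(\<lambda>u. (h u)\<^sup>2) holomorphic_on ball z0 (5/8)"
      using hol by (intro holomorphic_intros holomorphic_on_subset[OF hol]) auto
  qed (use w in auto)
  then have int: "((\<lambda>x. (h (\<gamma> x))\<^sup>2 / (\<gamma> x - w) * vector_derivative \<gamma> (at x within {0..1})) has_integral
      (2 * of_real pi * \<i> * (h w)\<^sup>2)) {0..1}"
    by (simp add: has_contour_integral_def)
  have "norm (2 * of_real pi * \<i> * (h w)\<^sup>2) \<le> integral {0..1} (\<lambda>x. 20 * pi * (norm (h (\<gamma> x)))\<^sup>2)"
    unfolding integral_unique[OF int, symmetric]
  proof (rule integral_norm_bound_integral)
    show "(\<lambda>x. (h (\<gamma> x))\<^sup>2 / (\<gamma> x - w) * vector_derivative \<gamma> (at x within {0..1})) integrable_on {0..1}"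
      using int by blast
    show "(\<lambda>x. 20 * pi * (norm (h (\<gamma> x)))\<^sup>2) integrable_on {0..1}"
      by (intro integrable_continuous_real continuous_intros cont)
    fix x :: real assume x: "x \<in> {0..1}"
    have vd: "norm (vector_derivative \<gamma> (at x within {0..1})) = 2 * pi * (5/8)"
      using x unfolding \<gamma>_def by (subst vector_derivative_circlepath01) (auto simp: norm_mult)
    have "norm (\<gamma> x - z0) \<le> norm (\<gamma> x - w) + norm (w - z0)"
      using norm_triangle_ineq[of "\<gamma> x - w" "w - z0"] by simp
    then have "norm (\<gamma> x - w) \<ge> 1/16" using sphere[of x] w by simp
    then have "(norm (h (\<gamma> x)))\<^sup>2 / norm (\<gamma> x - w) \<le> (norm (h (\<gamma> x)))\<^sup>2 / (1/16)"
      by (intro divide_left_mono) auto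
    from mult_right_mono[OF this, of "2 * pi * (5/8)"]
    show "norm ((h (\<gamma> x))\<^sup>2 / (\<gamma> x - w) * vector_derivative \<gamma> (at x within {0..1})) \<le> 20 * pi * (norm (h (\<gamma> x)))\<^sup>2"
      unfolding norm_mult vd norm_divide norm_power by simp
  qed
  also have "\<dots> = 20 * pi * integral {0..1} (\<lambda>x. (norm (h (\<gamma> x)))\<^sup>2)"
    by (rule integral_mult_right)
  also have "norm (2 * of_real pi * \<i> * (h w)\<^sup>2) = 2 * pi * (norm (h w))\<^sup>2"
    by (simp add: norm_mult norm_power)
  finally have "2 * pi * (norm (h w))\<^sup>2 \<le> 2 * pi * (10 * integral {0..1} (\<lambda>x. (norm (h (\<gamma> x)))\<^sup>2))" by simp
  then show ?thesis unfolding \<gamma>_def by (subst (asm) mult_le_cancel_left_pos) auto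
qed

lemma exponential_beats_power:
  fixes \<theta> :: real
  assumes "0 \<le> \<theta>" "\<theta> < 1"
  obtains k :: nat where "k > 0" "8 * \<theta> ^ k \<le> 1 / (real k + 1) ^ M"
proof -
  \<comment> \<open>The base q is positive even when \<theta> = 0.\<close>
  obtain q where q: "\<theta> < q" "q < 1" using dense[OF assms(2)] by blast
  have "(\<lambda>k. 8 * (real k + 1) ^ M * q ^ k) \<longlonglongrightarrow> 0"
    using q assms by real_asymp
  then have "eventually (\<lambda>k. 8 * (real k + 1) ^ M * q ^ k < 1) sequentially"
    by (rule order_tendstoD) simp
  then obtain k where k: "k > 0" "8 * (real k + 1) ^ M * q ^ k < 1"
    using eventually_conj[OF _ eventually_gt_at_top[of 0]]
    by (metis (mono_tags, lifting) eventually_happens' trivial_limit_sequentially)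
  have "8 * \<theta> ^ k * (real k + 1) ^ M \<le> 8 * q ^ k * (real k + 1) ^ M"
    using q assms by (intro mult_right_mono mult_left_mono power_mono) auto
  also have "\<dots> \<le> 1" using k by (simp add: mult_ac)
  finally show ?thesis using k(1) that[of k] by (simp add: pos_le_divide_eq)
qed

text \<open>The integral of the squared weight is at least 7/8 T cw. Points where this square is
  below \<theta> ^ k account for at most 1/8 of T cw, and points where the circle mean I exceeds l
  for at most 1/4 by Markov's inequality. Since the weight is at most 1, the remaining 1/2 T cw is a
  lower bound for the measure of the good set.\<close>

lemma positive_density_good_shifts:
  assumes \<omega>: "\<And>p. norm (\<omega> p) = 1" and M: "M > 0" and \<eta>: "\<eta> > 0" and \<epsilon>: "\<epsilon> > 0"
    and large: "160 * real M powr (-3/4) \<le> \<epsilon>\<^sup>2"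
  obtains c T0 where "c > 0" "T0 \<ge> 4"
    "\<And>T. T \<ge> T0 \<Longrightarrow> \<exists>G. G \<in> lmeasurable \<and> G \<subseteq> {T..2*T} \<and> c * T \<le> measure lebesgue G \<and>
       (\<forall>t\<in>G. (\<forall>p\<in>primes_le M. norm (cis (- (ln (real p) * t)) - \<omega> p) \<le> \<eta>) \<and>
              (\<forall>w. norm (w - (3/2 + \<i> * of_real t)) \<le> 9/16 \<longrightarrow> norm (sieved_zeta M w - 1) \<le> \<epsilon>))"
proof -
  \<comment> \<open>Chosen for 4 (1 - \<theta>) \<le> \<eta>^2; the minimum with 1/2 keeps \<theta>
    nonnegative.\<close>
  define \<theta> where "\<theta> = 1 - min (\<eta>\<^sup>2 / 4) (1/2)"
  have \<theta>: "0 \<le> \<theta>" "\<theta> < 1" "4 * (1 - \<theta>) \<le> \<eta>\<^sup>2" using \<eta> by (auto simp: \<theta>_def min_def)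
  obtain k where k: "k > 0" "8 * \<theta> ^ k \<le> 1 / (real k + 1) ^ M"
    using exponential_beats_power[OF \<theta>(1,2)] by blast
  define W where "W = phase_weight M k \<omega>"
  obtain cw T0 where cw: "cw \<ge> 1 / (real k + 1) ^ M" and T0: "T0 \<ge> 4"
    "\<And>T. T \<ge> T0 \<Longrightarrow> 7 / 8 * T * cw \<le> integral {T..2*T} (\<lambda>t. (norm (W t))\<^sup>2)"
    "\<And>T z. T \<ge> T0 \<Longrightarrow> 7/8 \<le> Re z \<Longrightarrow> Re z \<le> 3 \<Longrightarrow> \<bar>Im z\<bar> \<le> 1 \<Longrightarrow>
       integral {T..2*T} (\<lambda>t. (norm (W t))\<^sup>2 * (norm (sieved_zeta M (z + \<i> * of_real t) - 1))\<^sup>2)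
         \<le> 4 * T * cw * real M powr (-3/4)"
    unfolding W_def by (rule phase_weight_mean_square[of \<omega> M k, OF \<omega> M]) blast
  have "cw > 0" by (rule less_le_trans[OF _ cw]) simp
  have W1: "norm (W t) \<le> 1" for t unfolding W_def using \<omega> by (rule norm_phase_weight_le)
  \<comment> \<open>The circle touches the abscissa 7/8 from the right; the concentric disc of
    radius 9/16 still reaches 15/16, to the left of the line of real part 1.\<close>
  define \<gamma> where "\<gamma> = (\<lambda>x. circlepath (3/2) (5/8) x)"
  have \<gamma>: "7/8 \<le> Re (\<gamma> x)" "Re (\<gamma> x) \<le> 3" "\<bar>Im (\<gamma> x)\<bar> \<le> 1" for x
  proof -
    have "norm (\<gamma> x - 3/2) = 5/8" by (simp add: \<gamma>_def circlepath norm_mult)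
    then have "\<bar>Re (\<gamma> x - 3/2)\<bar> \<le> 5/8" "\<bar>Im (\<gamma> x - 3/2)\<bar> \<le> 5/8"
      using abs_Re_le_cmod abs_Im_le_cmod by metis+
    then show "7/8 \<le> Re (\<gamma> x)" "Re (\<gamma> x) \<le> 3" "\<bar>Im (\<gamma> x)\<bar> \<le> 1"
      unfolding abs_le_iff by auto
  qed
  define h where "h = (\<lambda>t x. (norm (sieved_zeta M (\<gamma> x + \<i> * of_real t) - 1))\<^sup>2)"
  define I where "I = (\<lambda>t. integral {0..1} (h t))"
  \<comment> \<open>The 10 is the constant of the circle mean. Markov's inequality at this level
    gives 40 \<open>M powr (-3/4)\<close> / \<epsilon>^2 times T cw, and the factor 160 in
    \<open>large\<close> makes this at most a quarter.\<close>
  define l where "l = \<epsilon>\<^sup>2 / 10"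
  have "l > 0" using \<epsilon> by (simp add: l_def)
  show ?thesis
  proof (rule that[of "cw / 2" T0])
    show "cw / 2 > 0" "T0 \<ge> 4" using \<open>cw > 0\<close> T0 by auto
    fix T assume T: "T \<ge> T0"
    then have "T \<ge> 4" using T0(1) by simp
    have ne: "\<gamma> x + \<i> * of_real t \<noteq> 1" if "t \<in> {T..2*T}" for t x
      using that \<open>T \<ge> 4\<close> \<gamma>(3)[of x] by (auto simp: complex_eq_iff abs_le_iff)
    have cont_\<gamma>: "continuous_on A (\<lambda>x. \<gamma> (g x))" if "continuous_on A g" for A :: "'z::topological_space set" and g
      unfolding \<gamma>_def circlepath using that by (intro continuous_intros)
    have cont_h: "continuous_on ({T..2*T} \<times> {0..1}) (\<lambda>(t, x). h t x)"
      unfolding h_def split_beta by (intro continuous_intros cont_\<gamma> ne) auto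
    have cont_I: "continuous_on {T..2*T} I"
      unfolding I_def using cont_h by (intro integral_continuous_on_param[of _ 0 1 h, unfolded cbox_interval])
    have cont_W: "continuous_on A W" for A unfolding W_def by (intro continuous_intros)
    \<comment> \<open>With non-strict inequalities and continuous functions G is compact, hence
      measurable.\<close>
    define G where "G = {t \<in> {T..2*T}. \<theta> ^ k \<le> (norm (W t))\<^sup>2 \<and> I t \<le> l}"
    have "closed {t \<in> {T..2*T}. \<theta> ^ k \<le> (norm (W t))\<^sup>2}"
      by (intro continuous_on_closed_Collect_le continuous_intros cont_W)
    moreover have "closed {t \<in> {T..2*T}. I t \<le> l}"
      by (intro continuous_on_closed_Collect_le continuous_intros cont_I)
    moreover have "G = {t \<in> {T..2*T}. \<theta> ^ k \<le> (norm (W t))\<^sup>2} \<inter> {t \<in> {T..2*T}. I t \<le> l}"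
      by (auto simp: G_def)
    ultimately have "closed G" by auto
    moreover have "bounded G" by (rule bounded_subset[of "{T..2*T}"]) (auto simp: G_def)
    ultimately have "compact G" by (simp add: compact_eq_bounded_closed)
    then have G: "G \<in> lmeasurable" by (rule lmeasurable_compact)
    have swap: "integral {T..2*T} (\<lambda>t. (norm (W t))\<^sup>2 * I t) \<le> 4 * T * cw * real M powr (-3/4)"
    proof -
      have "integral {T..2*T} (\<lambda>t. (norm (W t))\<^sup>2 * I t) =
          integral {T..2*T} (\<lambda>t. integral {0..1} (\<lambda>x. (norm (W t))\<^sup>2 * h t x))"
        by (simp add: I_def)
      also have "\<dots> = integral {0..1} (\<lambda>x. integral {T..2*T} (\<lambda>t. (norm (W t))\<^sup>2 * h t x))"
      proof -
        have "continuous_on (cbox (T, 0) (2*T, 1)) (\<lambda>(t, x). (norm (W t))\<^sup>2 * h t x)"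
          unfolding cbox_Pair_eq unfolding cbox_interval split_beta W_def
          using cont_h by (intro continuous_intros) (simp_all add: split_beta)
        from integral_swap_continuous[OF this] show ?thesis by simp
      qed
      also have "\<dots> \<le> integral {0..1} (\<lambda>x::real. 4 * T * cw * real M powr (-3/4))"
      proof (rule integral_le)
        have "continuous_on ({0..1} \<times> {T..2*T}) (\<lambda>(x, t). (norm (W t))\<^sup>2 * h t x)"
          unfolding h_def split_beta W_def by (intro continuous_intros cont_\<gamma> ne) auto
        then show "(\<lambda>x. integral {T..2*T} (\<lambda>t. (norm (W t))\<^sup>2 * h t x)) integrable_on {0..1}"
          by (intro integrable_continuous_real integral_continuous_on_param[of _ T "2*T" "\<lambda>x t. (norm (W t))\<^sup>2 * h t x", unfolded cbox_interval])
        show "integral {T..2*T} (\<lambda>t. (norm (W t))\<^sup>2 * h t x) \<le> 4 * T * cw * real M powr (-3/4)" for x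
          unfolding h_def using T \<gamma> by (intro T0(3))
      qed auto
      finally show ?thesis by simp
    qed
    have "7 / 8 * T * cw \<le> integral {T..2*T} (\<lambda>t. (norm (W t))\<^sup>2)" using T by (rule T0)
    also have "\<dots> \<le> integral {T..2*T} (\<lambda>t. indicator G t + (\<theta> ^ k + (norm (W t))\<^sup>2 * I t / l))"
    proof (rule integral_le)
      show "(\<lambda>t. (norm (W t))\<^sup>2) integrable_on {T..2*T}"
        by (intro integrable_continuous_real continuous_intros cont_W)
      have "indicat_real G integrable_on {T..2*T}"
        using G by (simp add: integrable_on_indicator fmeasurable.Int)
      then show "(\<lambda>t. indicator G t + (\<theta> ^ k + (norm (W t))\<^sup>2 * I t / l)) integrable_on {T..2*T}"
        using \<open>l > 0\<close>
        by (intro integrable_add[OF _ integrable_continuous_real] continuous_intros cont_W cont_I) auto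
      fix t assume t: "t \<in> {T..2*T}"
      have I0: "I t \<ge> 0"
        unfolding I_def h_def
        by (intro integral_nonneg integrable_continuous_real continuous_intros cont_\<gamma> ne t) auto
      have W2: "(norm (W t))\<^sup>2 \<le> 1" using W1[of t] by (simp add: power_le_one)
      consider "t \<in> G" | "(norm (W t))\<^sup>2 < \<theta> ^ k" | "I t > l" using t by (force simp: G_def)
      then show "(norm (W t))\<^sup>2 \<le> indicator G t + (\<theta> ^ k + (norm (W t))\<^sup>2 * I t / l)"
      proof cases
        case 1
        then show ?thesis using W2 I0 \<open>l > 0\<close> \<theta> by (simp add: add_increasing2)
      next
        case 2
        have "0 \<le> indicat_real G t + (norm (W t))\<^sup>2 * I t / l" using I0 \<open>l > 0\<close> by simp
        with 2 show ?thesis by linarith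
      next
        case 3
        then have "(norm (W t))\<^sup>2 * 1 \<le> (norm (W t))\<^sup>2 * (I t / l)"
          using \<open>l > 0\<close> by (intro mult_left_mono) auto
        moreover have "0 \<le> indicat_real G t + \<theta> ^ k" using \<theta> by simp
        ultimately show ?thesis unfolding times_divide_eq_right by linarith
      qed
    qed
    also have "\<dots> = measure lebesgue G + (T * \<theta> ^ k + integral {T..2*T} (\<lambda>t. (norm (W t))\<^sup>2 * I t) / l)"
    proof -
      have "G \<inter> {T..2*T} = G" by (auto simp: G_def)
      then have "indicat_real G integrable_on {T..2*T}" "integral {T..2*T} (indicat_real G) = measure lebesgue G"
        using G by (simp_all add: integrable_on_indicator integral_indicator)
      moreover have "(\<lambda>t. (norm (W t))\<^sup>2 * I t / l) integrable_on {T..2*T}"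
        using \<open>l > 0\<close> by (intro integrable_continuous_real continuous_intros cont_W cont_I) auto
      moreover have "(\<lambda>t. \<theta> ^ k) integrable_on {T..2*T}"
        by (intro integrable_continuous_real continuous_intros)
      moreover have "integral {T..2*T} (\<lambda>t. \<theta> ^ k) = T * \<theta> ^ k"
        using \<open>T \<ge> 4\<close> by simp
      moreover have "integral {T..2*T} (\<lambda>t. (norm (W t))\<^sup>2 * I t / l) = integral {T..2*T} (\<lambda>t. (norm (W t))\<^sup>2 * I t) / l"
        by (rule integral_divide)
      ultimately show ?thesis by (subst integral_add; simp add: integral_add integrable_add)
    qed
    finally have "7 / 8 * T * cw \<le> measure lebesgue G + (T * \<theta> ^ k + integral {T..2*T} (\<lambda>t. (norm (W t))\<^sup>2 * I t) / l)" .
    moreover have "T * \<theta> ^ k \<le> T * (cw / 8)"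
      using k(2) cw \<open>T \<ge> 4\<close> by (intro mult_left_mono) auto
    moreover have "integral {T..2*T} (\<lambda>t. (norm (W t))\<^sup>2 * I t) / l \<le> T * cw / 4"
    proof -
      have "integral {T..2*T} (\<lambda>t. (norm (W t))\<^sup>2 * I t) / l \<le> (4 * T * cw * real M powr (-3/4)) / l"
        using swap \<open>l > 0\<close> by (intro divide_right_mono) auto
      also have "\<dots> = T * cw / 4 * (160 * real M powr (-3/4)) / \<epsilon>\<^sup>2" by (simp add: l_def)
      also have "\<dots> \<le> T * cw / 4 * \<epsilon>\<^sup>2 / \<epsilon>\<^sup>2"
        using large \<open>T \<ge> 4\<close> \<open>cw > 0\<close> by (intro divide_right_mono mult_left_mono) auto
      finally show ?thesis using \<epsilon> by simp
    qed
    ultimately have meas: "cw / 2 * T \<le> measure lebesgue G" by (simp add: algebra_simps)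
    show "\<exists>G. G \<in> lmeasurable \<and> G \<subseteq> {T..2*T} \<and> cw / 2 * T \<le> measure lebesgue G \<and>
       (\<forall>t\<in>G. (\<forall>p\<in>primes_le M. norm (cis (- (ln (real p) * t)) - \<omega> p) \<le> \<eta>) \<and>
              (\<forall>w. norm (w - (3/2 + \<i> * of_real t)) \<le> 9/16 \<longrightarrow> norm (sieved_zeta M w - 1) \<le> \<epsilon>))"
    proof (intro exI[of _ G] conjI ballI allI impI)
      show "G \<in> lmeasurable" by (rule G)
      show "G \<subseteq> {T..2*T}" unfolding G_def by blast
      show "cw / 2 * T \<le> measure lebesgue G" by (rule meas)
    next
      fix t p assume t: "t \<in> G" and p: "p \<in> primes_le M"
      have "(norm (cis (- (ln (real p) * t)) - \<omega> p))\<^sup>2 \<le> 4 * (1 - \<theta>)"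
        using t by (intro phase_close_of_weight[OF \<omega> p k(1) \<theta>(1)]) (simp add: G_def W_def)
      also have "\<dots> \<le> \<eta>\<^sup>2" by (rule \<theta>)
      finally show "norm (cis (- (ln (real p) * t)) - \<omega> p) \<le> \<eta>"
        by (rule power2_le_imp_le) (use \<eta> in simp)
    next
      fix t w assume t: "t \<in> G" and w: "norm (w - (3/2 + \<i> * of_real t)) \<le> 9/16"
      have "1 \<notin> cball (3/2 + \<i> * of_real t) (5/8)"
      proof
        assume "1 \<in> cball (3/2 + \<i> * of_real t) (5/8)"
        then have "\<bar>Im (3/2 + \<i> * of_real t - 1)\<bar> \<le> 5/8"
          using abs_Im_le_cmod[of "3/2 + \<i> * of_real t - 1"] by (simp add: dist_norm)
        then show False using t \<open>T \<ge> 4\<close> by (simp add: G_def)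
      qed
      then have hol: "(\<lambda>w. sieved_zeta M w - 1) holomorphic_on cball (3/2 + \<i> * of_real t) (5/8)"
        by (intro holomorphic_intros holomorphic_on_subset[OF holomorphic_sieved_zeta]) auto
      have "(norm (sieved_zeta M w - 1))\<^sup>2 \<le>
          10 * integral {0..1} (\<lambda>x. (norm (sieved_zeta M (circlepath (3/2 + \<i> * of_real t) (5/8) x) - 1))\<^sup>2)"
        by (rule norm_square_le_circle_mean[OF hol w])
      also have "\<dots> = 10 * I t"
        by (simp add: I_def h_def \<gamma>_def circlepath add_ac)
      also have "\<dots> \<le> \<epsilon>\<^sup>2" using t by (simp add: G_def l_def)
      finally show "norm (sieved_zeta M w - 1) \<le> \<epsilon>"
        by (rule power2_le_imp_le) (use \<epsilon> in simp)
    qed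
  qed
qed

section \<open>Euler products with prescribed phases\<close>

text \<open>
  Greedy choice: the next term always points to the remaining target, unless all later terms together
  cannot undo the overshoot; then they all point backwards.
\<close>

lemma unimodular_sum_approx:
  fixes c :: "'a \<Rightarrow> real" and z :: complex
  assumes "finite A" "\<And>p. p \<in> A \<Longrightarrow> 0 \<le> c p" "\<And>p. p \<in> A \<Longrightarrow> c p \<le> m" "0 \<le> m" "norm z \<le> sum c A"
  shows "\<exists>\<omega>. (\<forall>p. norm (\<omega> p) = 1) \<and> norm ((\<Sum>p\<in>A. of_real (c p) * \<omega> p) - z) \<le> m"
  using assms
proof (induction A arbitrary: z rule: finite_induct)
  case empty
  then show ?case by (intro exI[of _ "\<lambda>_. 1"]) simp
next
  case (insert q A)
  define u where "u = (if z = 0 then 1 else sgn z)"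
  have u: "norm u = 1" "z = of_real (norm z) * u"
    by (cases "z = 0"; simp add: u_def sgn_eq norm_divide)+
  have c: "0 \<le> c q" "c q \<le> m" using insert.prems by auto
  have "z - of_real (c q) * u = of_real (norm z - c q) * u"
    by (subst (1) u(2)) (simp add: algebra_simps)
  then have diff: "norm (z - of_real (c q) * u) = \<bar>norm z - c q\<bar>"
    using u(1) by (simp only: norm_mult norm_of_real mult_1_right)
  show ?case
  proof (cases "\<bar>norm z - c q\<bar> \<le> sum c A")
    case True
    then obtain \<omega> where \<omega>: "\<And>p. norm (\<omega> p) = 1"
      "norm ((\<Sum>p\<in>A. of_real (c p) * \<omega> p) - (z - of_real (c q) * u)) \<le> m"
      using insert.IH[of "z - of_real (c q) * u"] insert.prems diff by auto
    define \<omega>' where "\<omega>' = (\<lambda>p. if p = q then u else \<omega> p)"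
    have "(\<Sum>p\<in>insert q A. of_real (c p) * \<omega>' p) = of_real (c q) * u + (\<Sum>p\<in>A. of_real (c p) * \<omega> p)"
      using insert.hyps by (auto simp: \<omega>'_def intro!: sum.cong)
    then show ?thesis
      using \<omega> u by (intro exI[of _ \<omega>']) (simp add: \<omega>'_def algebra_simps)
  next
    case False
    have nonneg: "0 \<le> sum c A" using insert.prems by (intro sum_nonneg) auto
    have "norm z \<le> c q + sum c A" using insert.prems insert.hyps by simp
    with False have less: "sum c A < c q - norm z" by linarith
    define \<omega> where "\<omega> = (\<lambda>p. if p = q then u else - u)"
    have "(\<Sum>p\<in>insert q A. of_real (c p) * \<omega> p) = of_real (c q) * u + (\<Sum>p\<in>A. of_real (c p) * (- u))"
      using insert.hyps by (auto simp: \<omega>_def intro!: sum.cong)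
    also have "\<dots> = of_real (c q - sum c A) * u"
      by (simp add: sum_negf sum_distrib_right[symmetric] left_diff_distrib)
    finally have "(\<Sum>p\<in>insert q A. of_real (c p) * \<omega> p) - z = of_real (c q - sum c A - norm z) * u"
      by (subst u(2)) (simp add: algebra_simps)
    then have "norm ((\<Sum>p\<in>insert q A. of_real (c p) * \<omega> p) - z) = \<bar>c q - sum c A - norm z\<bar>"
      using u(1) by (simp only: norm_mult norm_of_real mult_1_right)
    also have "\<dots> \<le> m" using less nonneg c norm_ge_zero[of z] by linarith
    finally show ?thesis using u by (intro exI[of _ \<omega>]) (auto simp: \<omega>_def)
  qed
qed

text \<open>A target that is out of reach by at most e is first pulled radially onto the circle of
  radius \<open>sum c A\<close>.\<close>

lemma unimodular_sum_approx':
  fixes c :: "'a \<Rightarrow> real" and z :: complex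
  assumes A: "finite A" "\<And>p. p \<in> A \<Longrightarrow> 0 \<le> c p" "\<And>p. p \<in> A \<Longrightarrow> c p \<le> m" "0 \<le> m"
    and z: "norm z \<le> sum c A + e" and "0 \<le> e"
  shows "\<exists>\<omega>. (\<forall>p. norm (\<omega> p) = 1) \<and> norm ((\<Sum>p\<in>A. of_real (c p) * \<omega> p) - z) \<le> m + e"
proof (cases "norm z \<le> sum c A")
  case True
  obtain \<omega> where "\<forall>p. norm (\<omega> p) = 1" "norm ((\<Sum>p\<in>A. of_real (c p) * \<omega> p) - z) \<le> m"
    using unimodular_sum_approx[of A c m z] A True by blast
  then show ?thesis using \<open>0 \<le> e\<close> by (intro exI[of _ \<omega>]) simp
next
  case False
  define S where "S = sum c A"
  have S: "0 \<le> S" "S < norm z" using A(2) False by (auto simp: S_def intro: sum_nonneg)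
  define z' where "z' = of_real (S / norm z) * z"
  have "z \<noteq> 0" using S by auto
  then have "norm z' = S" using S by (simp add: z'_def norm_mult norm_divide)
  then obtain \<omega> where \<omega>: "\<And>p. norm (\<omega> p) = 1" "norm ((\<Sum>p\<in>A. of_real (c p) * \<omega> p) - z') \<le> m"
    using unimodular_sum_approx[of A c m z'] A by (auto simp: S_def)
  have "z' - z = of_real (S / norm z - 1) * z" by (simp add: z'_def algebra_simps)
  then have "norm (z' - z) = \<bar>S / norm z - 1\<bar> * norm z" by (simp only: norm_mult norm_of_real)
  also have "\<dots> = norm z - S" using S \<open>z \<noteq> 0\<close> by (simp add: abs_if field_simps)
  also have "\<dots> \<le> e" using z by (simp add: S_def)
  finally have "norm (((\<Sum>p\<in>A. of_real (c p) * \<omega> p) - z') + (z' - z)) \<le> m + e"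
    using \<omega>(2) by (intro norm_triangle_mono)
  then show ?thesis using \<omega>(1) by (intro exI[of _ \<omega>]) simp
qed

text \<open>Disjoint blocks do not interact, so their phases can be chosen separately. The value 1
  outside the blocks leaves the Euler factors of the smallest primes untwisted.\<close>

lemma unimodular_block_approx:
  fixes c :: "'a \<Rightarrow> real" and z :: "nat \<Rightarrow> complex"
  assumes disj: "\<And>i j. i \<noteq> j \<Longrightarrow> B i \<inter> B j = {}" and fin: "\<And>j. finite (B j)"
    and c: "\<And>j p. p \<in> B j \<Longrightarrow> 0 \<le> c p" "\<And>j p. p \<in> B j \<Longrightarrow> c p \<le> m j" "\<And>j. 0 \<le> m j"
    and z: "\<And>j. j \<le> n \<Longrightarrow> norm (z j) \<le> sum c (B j) + e j" and e: "\<And>j. 0 \<le> e j"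
  shows "\<exists>\<omega>. (\<forall>p. norm (\<omega> p) = 1) \<and> (\<forall>p. p \<notin> (\<Union>j. B j) \<longrightarrow> \<omega> p = 1) \<and>
           (\<forall>j\<le>n. norm ((\<Sum>p\<in>B j. of_real (c p) * \<omega> p) - z j) \<le> m j + e j)"
proof -
  have "\<exists>\<omega>. (\<forall>p. norm (\<omega> p) = 1) \<and> (j \<le> n \<longrightarrow> norm ((\<Sum>p\<in>B j. of_real (c p) * \<omega> p) - z j) \<le> m j + e j)" for j
  proof (cases "j \<le> n")
    case True
    then show ?thesis
      using unimodular_sum_approx'[of "B j" c "m j" "z j" "e j"] fin c z e by blast
  qed (auto intro: exI[of _ "\<lambda>_. 1"])
  then obtain \<phi> where \<phi>: "\<And>j p. norm (\<phi> j p) = 1"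
    "\<And>j. j \<le> n \<Longrightarrow> norm ((\<Sum>p\<in>B j. of_real (c p) * \<phi> j p) - z j) \<le> m j + e j"
    by metis
  define \<omega> where "\<omega> = (\<lambda>p. if p \<in> (\<Union>j. B j) then \<phi> (THE j. p \<in> B j) p else 1)"
  have \<omega>: "\<omega> p = \<phi> j p" if "p \<in> B j" for j p
  proof -
    have "i = j" if "p \<in> B i" for i using disj[of i j] that \<open>p \<in> B j\<close> by blast
    then have "(THE j. p \<in> B j) = j" using \<open>p \<in> B j\<close> by (intro the_equality)
    then show ?thesis using \<open>p \<in> B j\<close> by (auto simp: \<omega>_def)
  qed
  show ?thesis
  proof (intro exI[of _ \<omega>] conjI allI impI)
    show "norm (\<omega> p) = 1" for p using \<phi>(1) by (simp add: \<omega>_def)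
    show "\<omega> p = 1" if "p \<notin> (\<Union>j. B j)" for p using that by (simp add: \<omega>_def)
    show "norm ((\<Sum>p\<in>B j. of_real (c p) * \<omega> p) - z j) \<le> m j + e j" if "j \<le> n" for j
      using \<phi>(2)[OF that] by (simp add: \<omega> cong: sum.cong)
  qed
qed

section \<open>Elementary estimates for exponentials, logarithms and integrals\<close>

lemma norm_exp_diff_le:
  fixes u v :: complex
  assumes "norm u \<le> r" "norm v \<le> r"
  shows "norm (exp u - exp v) \<le> exp r * norm (u - v)"
proof (rule field_differentiable_bound[where S = "cball 0 r" and f' = exp])
  fix z :: complex assume z: "z \<in> cball 0 r"
  show "(exp has_field_derivative exp z) (at z within cball 0 r)"
    by (intro DERIV_exp[THEN has_field_derivative_at_within])
  show "norm (exp z) \<le> exp r"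
    using z complex_Re_le_cmod[of z] by (auto simp: norm_exp_eq_Re)
qed (use assms in auto)

text \<open>The radius 2/3 is large enough for the prime 2, as \<open>2 powr (-3/4)\<close> is below
  2/3; on this disc the derivative is at most 3.\<close>

lemma norm_Ln_one_minus_diff_le:
  assumes "norm w \<le> 2/3" "norm v \<le> 2/3"
  shows "norm (Ln (1 - w) - Ln (1 - v)) \<le> 3 * norm (w - v)"
proof (rule field_differentiable_bound[where S = "cball 0 (2/3)" and f' = "\<lambda>z. - inverse (1 - z)" and f = "\<lambda>z. Ln (1 - z)"])
  fix z :: complex assume z: "z \<in> cball 0 (2/3)"
  then have n: "norm z \<le> 2/3" by simp
  have "Re (1 - z) > 0" using n complex_Re_le_cmod[of z] by simp
  then have "1 - z \<notin> \<real>\<^sub>\<le>\<^sub>0" by (auto simp: complex_nonpos_Reals_iff)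
  then show "((\<lambda>z. Ln (1 - z)) has_field_derivative - inverse (1 - z)) (at z within cball 0 (2/3))"
    by (auto intro!: derivative_eq_intros)
  have "1/3 \<le> norm (1 - z)" using norm_triangle_ineq2[of 1 z] n by simp
  then have "inverse (norm (1 - z)) \<le> inverse (1/3)" by (intro le_imp_inverse_le) auto
  then show "norm (- inverse (1 - z)) \<le> 3" by (simp add: norm_inverse)
qed (use assms in auto)

lemma norm_Ln_one_minus_plus_le:
  assumes "norm w \<le> 1/2"
  shows "norm (- Ln (1 - w) - w) \<le> 2 * (norm w)\<^sup>2"
proof -
  have "norm (Ln (1 + - w) - (- w)) \<le> (norm (- w))\<^sup>2 / (1 - norm (- w))"
    by (rule Ln_approx_linear) (use assms in auto)
  also have "\<dots> \<le> (norm (- w))\<^sup>2 / (1/2)"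
    using assms by (intro divide_left_mono) auto
  also have "norm (Ln (1 + - w) - (- w)) = norm (- Ln (1 - w) - w)"
    by (subst norm_minus_cancel[symmetric]) simp
  finally show ?thesis by simp
qed

lemma set_integral_interval_bound:
  fixes F :: "real \<Rightarrow> complex"
  assumes F: "set_borel_measurable lebesgue {c<..d} F"
    and B: "\<And>x. x \<in> {c<..d} \<Longrightarrow> norm (F x) \<le> B" and cd: "c \<le> d"
  shows "set_integrable lebesgue {c<..d} F"
    and "norm (LINT x:{c<..d}|lebesgue. F x) \<le> B * (d - c)"
proof -
  have I: "{c<..d} \<in> sets lebesgue" "emeasure lebesgue {c<..d} < \<infinity>" using cd by simp_all
  have "integrable lebesgue (\<lambda>x. indicator {c<..d} x *\<^sub>R F x)"
    by (rule integrableI_bounded_set[of "{c<..d}" _ _ B])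
       (use F I B in \<open>auto simp: set_borel_measurable_def intro!: AE_I2\<close>)
  then show int: "set_integrable lebesgue {c<..d} F" by (simp add: set_integrable_def)
  have const: "set_integrable lebesgue {c<..d} (\<lambda>_. B)"
    using I unfolding set_integrable_def by (intro integrable_scaleR_left integrable_real_indicator) auto
  have "norm (LINT x:{c<..d}|lebesgue. F x) \<le> (LINT x:{c<..d}|lebesgue. norm (F x))"
    using int by (rule set_integral_norm_bound)
  also have "\<dots> \<le> (LINT x:{c<..d}|lebesgue. B)"
    by (rule set_integral_mono[OF set_integrable_norm[OF int] const B])
  also have "\<dots> = B * (d - c)"
    using cd by (simp add: set_lebesgue_integral_def)
  finally show "norm (LINT x:{c<..d}|lebesgue. F x) \<le> B * (d - c)" .
qed

lemma set_borel_measurable_mult_continuous: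
  fixes g h :: "real \<Rightarrow> complex"
  assumes "set_borel_measurable lebesgue A g" "continuous_on UNIV h"
  shows "set_borel_measurable lebesgue A (\<lambda>x. g x * h x)"
proof -
  have "h \<in> borel_measurable lebesgue"
    using borel_measurable_continuous_onI[OF assms(2)]
    by (intro measurable_completion) simp
  then have "(\<lambda>x. (indicator A x *\<^sub>R g x) * h x) \<in> borel_measurable lebesgue"
    using assms(1) unfolding set_borel_measurable_def by (intro borel_measurable_times)
  then show ?thesis by (simp add: set_borel_measurable_def)
qed

lemma norm_exp_neg_mult_diff_le:
  fixes s :: complex
  assumes "norm s \<le> R" "0 \<le> x" "x \<le> b" "0 \<le> y" "y \<le> b" "0 \<le> b"
  shows "norm (exp (- s * of_real x) - exp (- s * of_real y)) \<le> R * \<bar>x - y\<bar> * exp (R * b)"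
proof -
  have bd: "norm (- s * of_real u) \<le> R * b" if "0 \<le> u" "u \<le> b" for u
    unfolding norm_mult using assms that order_trans[OF norm_ge_zero assms(1)] by (auto intro!: mult_mono)
  have "norm (exp (- s * of_real x) - exp (- s * of_real y)) \<le> exp (R * b) * norm (- s * of_real x - - s * of_real y)"
    using bd assms by (intro norm_exp_diff_le) auto
  also have "- s * of_real x - - s * of_real y = - s * of_real (x - y)" by (simp add: algebra_simps)
  also have "norm (- s * of_real (x - y)) = norm s * \<bar>x - y\<bar>" by (simp only: norm_mult norm_minus_cancel norm_of_real)
  also have "exp (R * b) * \<dots> \<le> exp (R * b) * (R * \<bar>x - y\<bar>)"
    using assms by (intro mult_left_mono mult_right_mono) auto
  finally show ?thesis by (simp add: mult_ac)
qed

section \<open>Riemann sums and truncation for the Laplace integral\<close>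

context
  fixes g :: "real \<Rightarrow> complex"
  assumes meas: "set_borel_measurable lebesgue {0<..} g"
    and bound: "\<And>x. x > 0 \<Longrightarrow> norm (of_real x * g x) \<le> 1"
begin

lemma norm_kernel_le:
  assumes "0 < c" "c \<le> x"
  shows "norm (g x) \<le> 1 / c"
proof -
  have "x * norm (g x) \<le> 1" using bound[of x] assms by (simp add: norm_mult)
  then have "norm (g x) \<le> 1 / x" using assms by (simp add: field_simps)
  also have "\<dots> \<le> 1 / c" using assms by (simp add: frac_le)
  finally show ?thesis .
qed

lemma kernel_measurable:
  assumes "0 < c"
  shows "set_borel_measurable lebesgue {c<..d} g"
  by (rule set_borel_measurable_subset[OF meas]) (use assms in auto)

text \<open>On the window g is at most 1/c, and the exponential varies by at most R (d - c) exp (R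
  d).\<close>

lemma kernel_window:
  assumes "0 < c" "c \<le> d"
  shows "set_integrable lebesgue {c<..d} g"
    and "norm (LINT x:{c<..d}|lebesgue. g x) \<le> (d - c) / c"
    and "set_integrable lebesgue {c<..d} (\<lambda>x. g x * exp (- s * of_real x))"
    and "norm s \<le> R \<Longrightarrow> norm (exp (- s * of_real c) * (LINT x:{c<..d}|lebesgue. g x) - (LINT x:{c<..d}|lebesgue. g x * exp (- s * of_real x)))
           \<le> (d - c) / c * (R * (d - c) * exp (R * d))"
proof -
  have B: "norm (g x) \<le> 1 / c" if "x \<in> {c<..d}" for x
    using norm_kernel_le[of c x] that assms by simp
  show int: "set_integrable lebesgue {c<..d} g"
    and "norm (LINT x:{c<..d}|lebesgue. g x) \<le> (d - c) / c"
    using set_integral_interval_bound[OF kernel_measurable[OF assms(1)] B assms(2)] by auto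
  have exp: "norm (exp (- s * of_real x)) \<le> exp (norm s * d)" if "x \<in> {c<..d}" for x
  proof -
    have "Re (- s * of_real x) \<le> norm s * x"
      using complex_Re_le_cmod[of "- s * of_real x"] that assms by (simp add: norm_mult)
    also have "\<dots> \<le> norm s * d" using that by (intro mult_left_mono) auto
    finally show ?thesis by (simp only: norm_exp_eq_Re exp_le_cancel_iff)
  qed
  have "norm (g x * exp (- s * of_real x)) \<le> 1 / c * exp (norm s * d)" if "x \<in> {c<..d}" for x
    unfolding norm_mult using B[OF that] exp[OF that] assms by (intro mult_mono) auto
  then show int': "set_integrable lebesgue {c<..d} (\<lambda>x. g x * exp (- s * of_real x))"
    using assms by (intro set_integral_interval_bound set_borel_measurable_mult_continuous kernel_measurable continuous_intros) auto
  assume s: "norm s \<le> R"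
  have "exp (- s * of_real c) * (LINT x:{c<..d}|lebesgue. g x) - (LINT x:{c<..d}|lebesgue. g x * exp (- s * of_real x))
      = (LINT x:{c<..d}|lebesgue. exp (- s * of_real c) * g x - g x * exp (- s * of_real x))"
    using int int' by (subst set_integral_diff) (auto intro: set_integrable_mult_right)
  also have "\<dots> = (LINT x:{c<..d}|lebesgue. g x * (exp (- s * of_real c) - exp (- s * of_real x)))"
    by (simp add: algebra_simps)
  also have "norm \<dots> \<le> (1 / c * (R * (d - c) * exp (R * d))) * (d - c)"
  proof (rule set_integral_interval_bound(2)[OF _ _ assms(2)])
    show "set_borel_measurable lebesgue {c<..d} (\<lambda>x. g x * (exp (- s * of_real c) - exp (- s * of_real x)))"
      using assms by (intro set_borel_measurable_mult_continuous kernel_measurable continuous_intros)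
    fix x assume x: "x \<in> {c<..d}"
    have R: "0 \<le> R" using s norm_ge_zero order_trans by blast
    have "norm (exp (- s * of_real c) - exp (- s * of_real x)) \<le> R * \<bar>c - x\<bar> * exp (R * d)"
      using s x assms by (intro norm_exp_neg_mult_diff_le) auto
    also have "\<dots> \<le> R * (d - c) * exp (R * d)"
      using x R by (intro mult_right_mono mult_left_mono) auto
    finally show "norm (g x * (exp (- s * of_real c) - exp (- s * of_real x))) \<le> 1 / c * (R * (d - c) * exp (R * d))"
      unfolding norm_mult using B[OF x] assms by (intro mult_mono) auto
  qed
  finally show "norm (exp (- s * of_real c) * (LINT x:{c<..d}|lebesgue. g x) - (LINT x:{c<..d}|lebesgue. g x * exp (- s * of_real x)))
           \<le> (d - c) / c * (R * (d - c) * exp (R * d))" by (simp add: mult_ac)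
qed

text \<open>Only the exponential is discretized: g is merely measurable and enters through its exact
  integrals over the windows.\<close>

lemma kernel_riemann_sum:
  fixes a \<eta> :: real and N :: nat
  assumes a: "0 < a" and \<eta>: "0 \<le> \<eta>" and s: "norm s \<le> R"
  defines "x \<equiv> \<lambda>j. a + real j * \<eta>"
  shows "norm ((\<Sum>j<N. exp (- s * of_real (x j)) * (LINT y:{x j<..x (Suc j)}|lebesgue. g y)) -
           (LINT y:{a<..x N}|lebesgue. g y * exp (- s * of_real y))) \<le> real N * (\<eta> / a * (R * \<eta> * exp (R * x N)))"
proof -
  have R: "0 \<le> R" using s norm_ge_zero order_trans by blast
  have x: "x j \<ge> a" "x j \<le> x (Suc j)" "x (Suc j) - x j = \<eta>" for j
    using a \<eta> by (auto simp: x_def algebra_simps)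
  have mono: "x i \<le> x j" if "i \<le> j" for i j using that \<eta> by (auto simp: x_def intro!: mult_right_mono)
  have split: "(LINT y:{a<..x n}|lebesgue. g y * exp (- s * of_real y)) =
      (\<Sum>j<n. (LINT y:{x j<..x (Suc j)}|lebesgue. g y * exp (- s * of_real y)))" for n
  proof (induction n)
    case 0
    then show ?case by (simp add: x_def set_lebesgue_integral_def)
  next
    case (Suc n)
    have "{a<..x (Suc n)} = {a<..x n} \<union> {x n<..x (Suc n)}" using x[of n] by auto
    then have "(LINT y:{a<..x (Suc n)}|lebesgue. g y * exp (- s * of_real y)) =
      (LINT y:{a<..x n}|lebesgue. g y * exp (- s * of_real y)) + (LINT y:{x n<..x (Suc n)}|lebesgue. g y * exp (- s * of_real y))"
      using a x[of n] by (simp only:) (intro set_integral_Un kernel_window(3); simp)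
    then show ?case using Suc by simp
  qed
  have "norm (\<Sum>j<N. (exp (- s * of_real (x j)) * (LINT y:{x j<..x (Suc j)}|lebesgue. g y)) -
      (LINT y:{x j<..x (Suc j)}|lebesgue. g y * exp (- s * of_real y))) \<le> (\<Sum>j<N. \<eta> / a * (R * \<eta> * exp (R * x N)))"
  proof (rule sum_norm_le)
    fix j assume "j \<in> {..<N}"
    then have xN: "x (Suc j) \<le> x N" by (intro mono) auto
    have "norm ((exp (- s * of_real (x j)) * (LINT y:{x j<..x (Suc j)}|lebesgue. g y)) -
      (LINT y:{x j<..x (Suc j)}|lebesgue. g y * exp (- s * of_real y)))
      \<le> (x (Suc j) - x j) / x j * (R * (x (Suc j) - x j) * exp (R * x (Suc j)))"
      using a x[of j] s by (intro kernel_window(4)) auto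
    also have "\<dots> \<le> \<eta> / a * (R * \<eta> * exp (R * x N))"
      unfolding x(3) using a x[of j] R \<eta> xN by (intro mult_mono frac_le) (auto intro!: mult_left_mono)
    finally show "norm ((exp (- s * of_real (x j)) * (LINT y:{x j<..x (Suc j)}|lebesgue. g y)) -
      (LINT y:{x j<..x (Suc j)}|lebesgue. g y * exp (- s * of_real y))) \<le> \<eta> / a * (R * \<eta> * exp (R * x N))" .
  qed
  then show ?thesis unfolding split by (simp add: sum_subtractf)
qed

text \<open>The integrand at the point \<open>s0\<close> of smallest real part dominates the others
  in absolute value, so dominated convergence at this single point truncates uniformly on K. The
  bound r on a is later used to make the block of the smallest x harmless.\<close>

lemma kernel_truncation:
  assumes s0: "set_integrable lebesgue {0<..} (\<lambda>x. g x * exp (- s0 * of_real x))"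
    and min: "\<And>s. s \<in> K \<Longrightarrow> Re s0 \<le> Re s"
    and int: "\<And>s. s \<in> K \<Longrightarrow> set_integrable lebesgue {0<..} (\<lambda>x. g x * exp (- s * of_real x))"
    and "\<epsilon> > 0" "r > 0"
  obtains a b where "0 < a" "a < r" "a < b"
    "\<And>s. s \<in> K \<Longrightarrow> norm ((LINT x:{a<..b}|lebesgue. g x * exp (- s * of_real x)) -
        (LINT x:{0<..}|lebesgue. g x * exp (- s * of_real x))) \<le> \<epsilon>"
proof -
  define a where "a = (\<lambda>n. inverse (real (Suc n)))"
  define b where "b = (\<lambda>n. real (Suc n) + 1)"
  define F where "F = (\<lambda>x. indicator {0<..} x *\<^sub>R norm (g x * exp (- s0 * of_real x)))"
  have F: "integrable lebesgue F"
    using set_integrable_norm[OF s0] by (simp add: F_def set_integrable_def)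
  have "(\<lambda>n. LINT x|lebesgue. indicator (- {a n<..b n}) x *\<^sub>R F x) \<longlonglongrightarrow> (LINT x::real|lebesgue. 0)"
  proof (rule integral_dominated_convergence[where w = F])
    show "AE x in lebesgue. (\<lambda>n. indicator (- {a n<..b n}) x *\<^sub>R F x) \<longlonglongrightarrow> 0"
    proof (rule AE_I2)
      fix x :: real
      show "(\<lambda>n. indicator (- {a n<..b n}) x *\<^sub>R F x) \<longlonglongrightarrow> 0"
      proof (cases "x > 0")
        case True
        have "eventually (\<lambda>n. a n < x) sequentially"
          unfolding a_def using LIMSEQ_inverse_real_of_nat True by (rule order_tendstoD)
        moreover have "eventually (\<lambda>n. x \<le> b n) sequentially"
          unfolding b_def by real_asymp
        ultimately have "eventually (\<lambda>n. indicator (- {a n<..b n}) x *\<^sub>R F x = 0) sequentially"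
          by eventually_elim simp
        then show ?thesis by (rule tendsto_eventually)
      qed (simp add: F_def)
    qed
    show "AE x in lebesgue. norm (indicator (- {a n<..b n}) x *\<^sub>R F x) \<le> F x" for n
      by (rule AE_I2) (auto simp: F_def indicator_def)
    show "(\<lambda>x. indicator (- {a n<..b n}) x *\<^sub>R F x) \<in> borel_measurable lebesgue" for n
      using borel_measurable_integrable[OF F] by (intro borel_measurable_scaleR borel_measurable_indicator) auto
  qed (use F in auto)
  then have "(\<lambda>n. LINT x|lebesgue. indicator (- {a n<..b n}) x *\<^sub>R F x) \<longlonglongrightarrow> 0" by simp
  then have "eventually (\<lambda>n. (LINT x|lebesgue. indicator (- {a n<..b n}) x *\<^sub>R F x) < \<epsilon>) sequentially"
    using \<open>\<epsilon> > 0\<close> by (rule order_tendstoD)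
  moreover have "eventually (\<lambda>n. a n < r) sequentially"
    unfolding a_def using LIMSEQ_inverse_real_of_nat \<open>r > 0\<close> by (rule order_tendstoD)
  ultimately obtain n where n: "(LINT x|lebesgue. indicator (- {a n<..b n}) x *\<^sub>R F x) < \<epsilon>" "a n < r"
    using eventually_happens'[OF sequentially_bot eventually_conj] by blast
  have ab: "0 < a n" "a n < b n"
  proof -
    show "0 < a n" by (simp add: a_def)
    have "a n \<le> 1" by (simp add: a_def inverse_le_1_iff)
    then show "a n < b n" by (simp add: b_def)
  qed
  show ?thesis
  proof (rule that[OF ab(1) n(2) ab(2)])
    fix s assume s: "s \<in> K"
    let ?h = "\<lambda>x. g x * exp (- s * of_real x)"
    define A where "A = {0<..} - {a n<..b n}"
    have intA: "set_integrable lebesgue A ?h"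
      by (rule set_integrable_subset[OF int[OF s]]) (auto simp: A_def)
    have "{0<..} = {a n<..b n} \<union> A" using ab by (auto simp: A_def)
    then have "(LINT x:{0<..}|lebesgue. ?h x) = (LINT x:{a n<..b n}|lebesgue. ?h x) + (LINT x:A|lebesgue. ?h x)"
      using ab intA by (simp only:) (intro set_integral_Un kernel_window(3); auto simp: A_def)
    then have "norm ((LINT x:{a n<..b n}|lebesgue. ?h x) - (LINT x:{0<..}|lebesgue. ?h x)) = norm (LINT x:A|lebesgue. ?h x)"
      by simp
    also have "\<dots> \<le> (LINT x:A|lebesgue. norm (?h x))" using intA by (rule set_integral_norm_bound)
    also have "\<dots> \<le> (LINT x|lebesgue. indicator (- {a n<..b n}) x *\<^sub>R F x)"
      unfolding set_lebesgue_integral_def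
    proof (rule integral_mono)
      show "integrable lebesgue (\<lambda>x. indicat_real A x *\<^sub>R norm (?h x))"
        using set_integrable_norm[OF intA] by (simp add: set_integrable_def)
      show "integrable lebesgue (\<lambda>x. indicator (- {a n<..b n}) x *\<^sub>R F x)"
        using F by (intro integrable_mult_indicator) auto
      fix x :: real
      have "norm (?h x) \<le> norm (g x * exp (- s0 * of_real x))" if "x > 0"
        using min[OF s] that by (auto simp: norm_mult norm_exp_eq_Re intro!: mult_left_mono mult_right_mono)
      then show "indicat_real A x *\<^sub>R norm (?h x) \<le> indicator (- {a n<..b n}) x *\<^sub>R F x"
        by (auto simp: A_def F_def indicator_def)
    qed
    finally show "norm ((LINT x:{a n<..b n}|lebesgue. ?h x) - (LINT x:{0<..}|lebesgue. ?h x)) \<le> \<epsilon>"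
      using n(1) by simp
  qed
qed

end

section \<open>Sums over blocks of primes\<close>

lemma prime_powr_scaled:
  fixes s :: complex
  assumes "p > 0"
  shows "of_nat p powr (- (1 + of_real \<delta> * s)) = of_real (1 / real p) * exp (- s * of_real (\<delta> * ln (real p)))"
proof -
  have "of_nat p powr (- (1 + of_real \<delta> * s)) = of_nat p powr (-1) * of_nat p powr (- (of_real \<delta> * s))"
    by (subst powr_add[symmetric]) simp
  also have "of_nat p powr (- (of_real \<delta> * s)) = exp (- s * of_real (\<delta> * ln (real p)))"
    using assms by (simp add: powr_def Ln_of_nat mult_ac)
  also have "of_nat p powr (-1) = complex_of_real (1 / real p)"
    using assms by (simp add: powr_minus_divide)
  finally show ?thesis .
qed

lemma norm_prime_powr_scaled_le:
  assumes "p > 0" "norm s \<le> R" "0 < \<delta>" "\<delta> * R \<le> 1/4"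
  shows "norm (of_nat p powr (- (1 + of_real \<delta> * s)) :: complex) \<le> real p powr (-3/4)"
proof -
  have "- Re s \<le> R" using complex_Re_le_cmod[of "- s"] assms(2) by simp
  then have "\<delta> * (- Re s) \<le> 1/4"
    using mult_left_mono[of "- Re s" R \<delta>] assms by linarith
  moreover have "Re (- (1 + of_real \<delta> * s)) = - 1 + \<delta> * (- Re s)" by simp
  ultimately have "Re (- (1 + of_real \<delta> * s)) \<le> -3/4" by linarith
  then have "real p powr Re (- (1 + of_real \<delta> * s)) \<le> real p powr (-3/4)"
    using assms(1) by (intro powr_mono) auto
  then show ?thesis using assms(1) by (simp only: norm_of_nat_powr)
qed

lemma powr_three_quarters_le:
  assumes "2 \<le> p"
  shows "real p powr (-3/4) \<le> 2/3"
proof -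
  have "real p powr (-3/4) \<le> 2 powr (-3/4)" using assms by (intro powr_mono2') auto
  also have "(2::real) powr (-3/4) = inverse (2 powr (3/4))" by (simp add: powr_minus)
  also have "\<dots> \<le> inverse (3/2)"
  proof (rule le_imp_inverse_le)
    \<comment> \<open>Raised to the fourth power, the claim reads 81/16 \<le> 8.\<close>
    have "((2::real) powr (3/4)) ^ Suc 3 = 8"
      by (simp add: powr_power)
    note root = this
    show "3/2 \<le> (2::real) powr (3/4)"
      by (rule power_le_imp_le_base[of _ 3]) (use root in \<open>simp_all add: power_divide\<close>)
  qed simp
  finally show ?thesis by simp
qed

lemma powr_three_quarters_le_half:
  assumes "3 \<le> p"
  shows "real p powr (-3/4) \<le> 1/2"
proof -
  have "real p powr (-3/4) \<le> 3 powr (-3/4)" using assms by (intro powr_mono2') auto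
  also have "(3::real) powr (-3/4) = inverse (3 powr (3/4))" by (simp add: powr_minus)
  also have "\<dots> \<le> inverse 2"
  proof (rule le_imp_inverse_le)
    have "((3::real) powr (3/4)) ^ Suc 3 = 27"
      by (simp add: powr_power)
    note root = this
    show "2 \<le> (3::real) powr (3/4)"
      by (rule power_le_imp_le_base[of _ 3]) (use root in simp_all)
  qed simp
  finally show ?thesis by simp
qed

text \<open>On a block the exponential is frozen at the left end x0. The freezing error keeps the
  factor \<delta> ln p - x0 under the sum, because on the first block, with x0 = 0, the total weight
  of 1/p is unbounded as \<delta> tends to 0, whereas the sum of \<delta> ln p / p stays controlled
  by Mertens' theorem.\<close>

lemma block_error_le:
  fixes \<omega> :: "nat \<Rightarrow> complex"
  assumes "finite B" and \<omega>: "\<And>p. norm (\<omega> p) = 1"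
    and B: "\<And>p. p \<in> B \<Longrightarrow> p > 0 \<and> x0 \<le> \<delta> * ln (real p) \<and> \<delta> * ln (real p) \<le> x1"
    and x: "0 \<le> x0" "x0 \<le> x1" and s: "norm s \<le> R"
  shows "norm ((\<Sum>p\<in>B. \<omega> p * of_nat p powr (- (1 + of_real \<delta> * s))) - exp (- s * of_real x0) * z)
    \<le> R * exp (R * x1) * (\<Sum>p\<in>B. (\<delta> * ln (real p) - x0) / real p)
      + exp (R * x0) * norm ((\<Sum>p\<in>B. of_real (1 / real p) * \<omega> p) - z)"
proof -
  let ?E = "\<lambda>y. exp (- s * of_real y)"
  have eq: "(\<Sum>p\<in>B. \<omega> p * of_nat p powr (- (1 + of_real \<delta> * s))) - ?E x0 * z =
      (\<Sum>p\<in>B. of_real (1 / real p) * \<omega> p * (?E (\<delta> * ln (real p)) - ?E x0))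
      + ?E x0 * ((\<Sum>p\<in>B. of_real (1 / real p) * \<omega> p) - z)"
  proof -
    have "(\<Sum>p\<in>B. \<omega> p * of_nat p powr (- (1 + of_real \<delta> * s))) =
        (\<Sum>p\<in>B. of_real (1 / real p) * \<omega> p * (?E (\<delta> * ln (real p)) - ?E x0) + ?E x0 * (of_real (1 / real p) * \<omega> p))"
    proof (rule sum.cong[OF refl])
      fix p assume "p \<in> B"
      then have "p > 0" using B by blast
      show "\<omega> p * of_nat p powr (- (1 + of_real \<delta> * s)) =
        of_real (1 / real p) * \<omega> p * (?E (\<delta> * ln (real p)) - ?E x0) + ?E x0 * (of_real (1 / real p) * \<omega> p)"
        unfolding prime_powr_scaled[OF \<open>p > 0\<close>] by (simp only: right_diff_distrib) simp
    qed
    then show ?thesis by (simp only: sum.distrib sum_distrib_left right_diff_distrib) simp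
  qed
  have "norm (\<Sum>p\<in>B. of_real (1 / real p) * \<omega> p * (?E (\<delta> * ln (real p)) - ?E x0))
      \<le> (\<Sum>p\<in>B. R * exp (R * x1) * ((\<delta> * ln (real p) - x0) / real p))"
  proof (rule sum_norm_le)
    fix p assume "p \<in> B"
    then have p: "p > 0" "x0 \<le> \<delta> * ln (real p)" "\<delta> * ln (real p) \<le> x1" using B by auto
    have "norm (?E (\<delta> * ln (real p)) - ?E x0) \<le> R * \<bar>\<delta> * ln (real p) - x0\<bar> * exp (R * x1)"
      using p x s by (intro norm_exp_neg_mult_diff_le) auto
    then have "1 / real p * norm (?E (\<delta> * ln (real p)) - ?E x0) \<le> 1 / real p * (R * (\<delta> * ln (real p) - x0) * exp (R * x1))"
      using p by (intro mult_left_mono) auto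
    then show "norm (of_real (1 / real p) * \<omega> p * (?E (\<delta> * ln (real p)) - ?E x0))
        \<le> R * exp (R * x1) * ((\<delta> * ln (real p) - x0) / real p)"
      unfolding norm_mult \<omega> norm_of_real by (simp add: mult_ac)
  qed
  moreover have "norm (?E x0 * ((\<Sum>p\<in>B. of_real (1 / real p) * \<omega> p) - z))
      \<le> exp (R * x0) * norm ((\<Sum>p\<in>B. of_real (1 / real p) * \<omega> p) - z)"
  proof -
    have "Re (- s * of_real x0) \<le> norm (- s * of_real x0)" by (rule complex_Re_le_cmod)
    also have "\<dots> = norm s * x0" using x by (simp add: norm_mult)
    also have "\<dots> \<le> R * x0" using s x by (intro mult_right_mono)
    finally show ?thesis unfolding norm_mult norm_exp_eq_Re by (intro mult_right_mono) auto
  qed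
  ultimately show ?thesis
    unfolding eq sum_distrib_left by (intro norm_triangle_mono)
qed

lemma sum_primes_window_blocks:
  assumes "mono Y"
  shows "sum f (primes_window (Y 0) (Y (Suc n))) = (\<Sum>j\<le>n. sum f (primes_window (Y j) (Y (Suc j))))"
proof (induction n)
  case (Suc n)
  have "primes_window (Y 0) (Y (Suc (Suc n))) = primes_window (Y 0) (Y (Suc n)) \<union> primes_window (Y (Suc n)) (Y (Suc (Suc n)))"
    using monoD[OF assms] by (intro primes_window_Un[symmetric]) auto
  then have "sum f (primes_window (Y 0) (Y (Suc (Suc n)))) =
      sum f (primes_window (Y 0) (Y (Suc n))) + sum f (primes_window (Y (Suc n)) (Y (Suc (Suc n))))"
    by (simp only:) (rule sum.union_disjoint; simp add: primes_window_disjoint)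
  then show ?case using Suc by simp
qed simp

text \<open>For fixed P the bound tends to 0 with \<delta>, because the exponents -1 - \<delta> s
  tend to -1 uniformly for |s| \<le> R.\<close>

lemma small_primes_error:
  assumes s: "norm s \<le> R" and \<delta>: "0 < \<delta>" "\<delta> * R \<le> 1/4" and "0 < R"
  shows "norm ((\<Sum>p\<in>primes_le P. - Ln (1 - of_nat p powr (- (1 + of_real \<delta> * s)))) - (\<Sum>p\<in>primes_le P. - Ln (1 - of_real (1 / real p))))
    \<le> (\<Sum>p\<in>primes_le P. 3 * (R * (\<delta> * ln (real p)) * exp (R * (\<delta> * ln (real p)))))"
  unfolding sum_subtractf[symmetric]
proof (rule sum_norm_le)
  fix p assume "p \<in> primes_le P"
  then have p: "p \<ge> 2" "p > 0" "ln (real p) \<ge> 0" by (auto dest: prime_ge_2_nat)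
  let ?w = "of_nat p powr (- (1 + of_real \<delta> * s)) :: complex"
  have "norm ?w \<le> 2/3"
    using norm_prime_powr_scaled_le[OF p(2) s \<delta>] powr_three_quarters_le[OF p(1)] by linarith
  moreover have "norm (complex_of_real (1 / real p)) \<le> 2/3"
    using p by (simp add: norm_divide field_simps)
  ultimately have "norm (Ln (1 - ?w) - Ln (1 - of_real (1 / real p))) \<le> 3 * norm (?w - of_real (1 / real p))"
    by (rule norm_Ln_one_minus_diff_le)
  also have "?w - of_real (1 / real p) = of_real (1 / real p) * (exp (- s * of_real (\<delta> * ln (real p))) - exp (- s * of_real 0))"
    unfolding prime_powr_scaled[OF p(2)] by (simp only: right_diff_distrib) simp
  also have "norm \<dots> \<le> 1 * (R * \<bar>\<delta> * ln (real p) - 0\<bar> * exp (R * (\<delta> * ln (real p))))"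
    unfolding norm_mult using p \<delta> s
    by (intro mult_mono norm_exp_neg_mult_diff_le) (auto simp: norm_divide)
  finally have "norm (Ln (1 - ?w) - Ln (1 - of_real (1 / real p))) \<le> 3 * (R * (\<delta> * ln (real p)) * exp (R * (\<delta> * ln (real p))))"
    using p \<delta> by simp
  then show "norm (- Ln (1 - ?w) - - Ln (1 - of_real (1 / real p))) \<le> 3 * (R * (\<delta> * ln (real p)) * exp (R * (\<delta> * ln (real p))))"
    by (simp add: norm_minus_commute)
qed

text \<open>The error of each term is quadratic, at most \<open>2 * p powr (-3/2)\<close>, so it is
  summable and its tail beyond P is small. This is why the primes up to P are treated
  separately.\<close>

lemma linearization_error:
  assumes "finite A" and A: "\<And>p. p \<in> A \<Longrightarrow> P < p" and P: "P \<ge> 3"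
    and \<omega>: "\<And>p. norm (\<omega> p) = 1" and s: "norm s \<le> R" and \<delta>: "0 < \<delta>" "\<delta> * R \<le> 1/4"
  shows "norm ((\<Sum>p\<in>A. - Ln (1 - \<omega> p * of_nat p powr (- (1 + of_real \<delta> * s)))) - (\<Sum>p\<in>A. \<omega> p * of_nat p powr (- (1 + of_real \<delta> * s))))
    \<le> 4 * real P powr (-1/2)"
proof -
  let ?w = "\<lambda>p. \<omega> p * of_nat p powr (- (1 + of_real \<delta> * s))"
  have "norm (\<Sum>p\<in>A. - Ln (1 - ?w p) - ?w p) \<le> 2 * real P powr (- (1/2)) / (1/2)"
  proof (rule norm_tail_sum_le[where A = A and f = "\<lambda>p. - Ln (1 - ?w p) - ?w p"])
    fix p assume "p \<in> A"
    then have p: "P < p" "p > 0" "p \<ge> 3" using A P by fastforce+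
    have w: "norm (?w p) \<le> real p powr (-3/4)"
      unfolding norm_mult \<omega> using norm_prime_powr_scaled_le[OF p(2) s \<delta>] by simp
    have "norm (- Ln (1 - ?w p) - ?w p) \<le> 2 * (norm (?w p))\<^sup>2"
      using w powr_three_quarters_le_half[OF p(3)] by (intro norm_Ln_one_minus_plus_le) linarith
    also have "\<dots> \<le> 2 * (real p powr (-3/4))\<^sup>2" using w by (intro mult_left_mono power_mono) auto
    also have "\<dots> = 2 * real p powr (- (1/2) - 1)"
      by (simp add: power2_eq_square flip: powr_add)
    finally show "norm (- Ln (1 - ?w p) - ?w p) \<le> 2 * real p powr (- (1/2) - 1)" .
  qed (use assms in \<open>auto intro!: has_sum_finite\<close>)
  then show ?thesis by (simp add: sum_subtractf)
qed

text \<open>Primes up to a fixed P keep phase 1 and contribute about D. Primes with x between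
  \<delta> ln P and a form one block that has to produce C - D, and the windows that divide (a, b]
  produce the integral. P is chosen first, then a and b, then the number N of windows, and \<delta>
  last.\<close>

lemma finite_euler_product_approx:
  fixes g :: "real \<Rightarrow> complex" and K :: "complex set" and C :: complex
  assumes meas: "set_borel_measurable lebesgue {0<..} g"
    and bound: "\<And>x. x > 0 \<Longrightarrow> norm (of_real x * g x) \<le> 1"
    and int: "\<And>s. s \<in> K \<Longrightarrow> set_integrable lebesgue {0<..} (\<lambda>x. g x * exp (- s * of_real x))"
    and R: "\<And>s. s \<in> K \<Longrightarrow> norm s \<le> R" "R > 0"
    and s0: "s0 \<in> K" "\<And>s. s \<in> K \<Longrightarrow> Re s0 \<le> Re s"
    and "\<epsilon> > 0"
  shows "\<exists>\<delta>0>0. \<forall>\<delta>. 0 < \<delta> \<and> \<delta> < \<delta>0 \<longrightarrow> (\<exists>M\<ge>M0. \<exists>\<omega>. (\<forall>p. norm (\<omega> p) = 1) \<and>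
    (\<forall>s\<in>K. norm ((\<Sum>p\<in>primes_le M. - Ln (1 - \<omega> p * of_nat p powr (- (1 + of_real \<delta> * s))))
       - (C + (LINT x:{0<..}|lebesgue. g x * exp (- s * of_real x)))) \<le> \<epsilon>))"
proof -
  define e where "e = \<epsilon> / 8"
  have "e > 0" using \<open>\<epsilon> > 0\<close> by (simp add: e_def)
  obtain C1 where C1: "C1 > 0"
    "\<And>x y. 0 \<le> x \<Longrightarrow> x \<le> y \<Longrightarrow> (\<Sum>p\<in>primes_window x y. ln (real p) / real p) \<le> y - x + C1"
    "\<And>x y. 0 \<le> x \<Longrightarrow> x \<le> y \<Longrightarrow> 0 < y \<Longrightarrow> (y - x - C1) / y \<le> (\<Sum>p\<in>primes_window x y. 1 / real p)"
    using sum_inverse_primes_window by metis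
  have "eventually (\<lambda>P::nat. 4 * real P powr (-1/2) < e) sequentially"
    "eventually (\<lambda>P::nat. 1 / real P < e) sequentially"
    using \<open>e > 0\<close> by real_asymp+
  then have "eventually (\<lambda>P::nat. 4 * real P powr (-1/2) < e \<and> 1 / real P < e \<and> max 3 M0 \<le> P) sequentially"
    by (intro eventually_conj eventually_ge_at_top)
  then obtain P where P: "4 * real P powr (-1/2) < e" "1 / real P < e" "3 \<le> P" "M0 \<le> P"
    by (auto dest!: eventually_happens)
  have lnP: "ln (real P) > 0" using P by simp
  define D where "D = (\<Sum>p\<in>primes_le P. - Ln (1 - of_real (1 / real p)) :: complex)"
  \<comment> \<open>On the first block \<open>exp (-s x)\<close> is replaced by 1, at a cost of
    about R exp (R a) a; a < r makes this at most e / 2.\<close>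
  define r where "r = min 1 (e / (2 * R * exp R))"
  have "r > 0" using \<open>e > 0\<close> R by (simp add: r_def)
  obtain a b where ab: "0 < a" "a < r" "a < b"
    "\<And>s. s \<in> K \<Longrightarrow> norm ((LINT x:{a<..b}|lebesgue. g x * exp (- s * of_real x)) -
        (LINT x:{0<..}|lebesgue. g x * exp (- s * of_real x))) \<le> e"
    using kernel_truncation[OF meas bound int[OF s0(1)] s0(2) int \<open>e > 0\<close> \<open>r > 0\<close>] by blast
  have a_small: "R * exp (R * a) * a \<le> e / 2"
  proof -
    have "R * exp (R * a) * a \<le> R * exp R * (e / (2 * R * exp R))"
      using ab R by (intro mult_mono) (auto simp: r_def)
    then show ?thesis using R by simp
  qed
  \<comment> \<open>Each window errs by the square of its length, so N windows together err by a
    multiple of \<open>step N\<close>, which N can make small once a and b are fixed.\<close>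
  define step where "step = (\<lambda>N::nat. (b - a) / real N)"
  have "((\<lambda>N. (b - a) / a * (R * step N * exp (R * b))) \<longlonglongrightarrow> 0)" "((\<lambda>N. exp (R * b) * (b - a) * step N / a\<^sup>2) \<longlonglongrightarrow> 0)"
    unfolding step_def using ab(1,3) by real_asymp+
  then have "eventually (\<lambda>N. (b - a) / a * (R * step N * exp (R * b)) < e / 2 \<and> exp (R * b) * (b - a) * step N / a\<^sup>2 < e / 2 \<and> 1 \<le> N) sequentially"
    using \<open>e > 0\<close> by (intro eventually_conj eventually_ge_at_top order_tendstoD(2)) auto
  then obtain N where N: "(b - a) / a * (R * step N * exp (R * b)) < e / 2" "exp (R * b) * (b - a) * step N / a\<^sup>2 < e / 2" "1 \<le> N"
    by (auto dest!: eventually_happens)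
  define \<eta> where "\<eta> = step N"
  have \<eta>: "\<eta> > 0" "real N * \<eta> = b - a" using ab N by (auto simp: \<eta>_def step_def)
  define x where "x = (\<lambda>j. a + real j * \<eta>)"
  have x: "x j \<ge> a" "x (Suc j) - x j = \<eta>" "x j \<le> x (Suc j)" "x j > 0" for j
    using ab \<eta> by (auto simp: x_def algebra_simps add_pos_nonneg)
  have xN: "x N = b" using \<eta> by (simp add: x_def)
  have x_mono: "x i \<le> x j" if "i \<le> j" for i j using that \<eta> by (auto simp: x_def intro!: mult_right_mono)
  \<comment> \<open>As soon as a / \<delta> \<ge> Y0, the first block carries enough weight to reach
    C - D, whatever its size.\<close>
  obtain Y0 where Y0: "\<And>y. y \<ge> Y0 \<Longrightarrow> norm (C - D) \<le> (\<Sum>p\<in>primes_window (ln (real P)) y. 1 / real p)"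
    using sum_inverse_primes_unbounded[of "ln (real P)" "norm (C - D)"] lnP by auto
  define q1 where "q1 = (\<lambda>\<delta>. \<Sum>p\<in>primes_le P. 3 * (R * (\<delta> * ln (real p)) * exp (R * (\<delta> * ln (real p)))))"
  have "(q1 \<longlongrightarrow> (\<Sum>p\<in>primes_le P. 3 * (R * (0 * ln (real p)) * exp (R * (0 * ln (real p)))))) (at_right 0)"
    unfolding q1_def by (intro tendsto_intros)
  then have "(q1 \<longlongrightarrow> 0) (at_right 0)" by simp
  then have ev1: "eventually (\<lambda>\<delta>. q1 \<delta> < e) (at_right 0)" using \<open>e > 0\<close> by (rule order_tendstoD)
  have lims: "((\<lambda>\<delta>. R * exp (R * a) * (C1 * \<delta>)) \<longlongrightarrow> 0) (at_right 0)"
    "((\<lambda>\<delta>. real N * (C1 * \<delta>) / a * (R * \<eta> * exp (R * b))) \<longlongrightarrow> 0) (at_right 0)"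
    "((\<lambda>\<delta>. exp (R * b) * (real N * (exp (- a / \<delta>) + C1 * \<delta> / a))) \<longlongrightarrow> 0) (at_right 0)"
    "((\<lambda>\<delta>. \<delta> * R) \<longlongrightarrow> 0) (at_right 0)" "((\<lambda>\<delta>. \<delta> * ln (real P)) \<longlongrightarrow> 0) (at_right 0)" "((\<lambda>\<delta>. \<delta> * Y0) \<longlongrightarrow> 0) (at_right 0)"
    using ab by real_asymp+
  have "eventually (\<lambda>\<delta>. R * exp (R * a) * (C1 * \<delta>) < e / 2 \<and>
      real N * (C1 * \<delta>) / a * (R * \<eta> * exp (R * b)) < e / 2 \<and>
      exp (R * b) * (real N * (exp (- a / \<delta>) + C1 * \<delta> / a)) < e / 2 \<and>
      \<delta> * R < 1/4 \<and> \<delta> * ln (real P) < a \<and> \<delta> * Y0 < a \<and> q1 \<delta> < e) (at_right 0)"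
    using \<open>e > 0\<close> ab ev1 by (intro eventually_conj lims[THEN order_tendstoD(2)]) auto
  then obtain \<delta>0 where \<delta>0: "\<delta>0 > 0" and small: "\<And>\<delta>. 0 < \<delta> \<Longrightarrow> \<delta> < \<delta>0 \<Longrightarrow> R * exp (R * a) * (C1 * \<delta>) < e / 2 \<and>
      real N * (C1 * \<delta>) / a * (R * \<eta> * exp (R * b)) < e / 2 \<and>
      exp (R * b) * (real N * (exp (- a / \<delta>) + C1 * \<delta> / a)) < e / 2 \<and>
      \<delta> * R < 1/4 \<and> \<delta> * ln (real P) < a \<and> \<delta> * Y0 < a \<and> q1 \<delta> < e"
    unfolding eventually_at_right_field by blast
  show ?thesis
  proof (intro exI[of _ \<delta>0] conjI \<delta>0 allI impI)
    fix \<delta> assume "0 < \<delta> \<and> \<delta> < \<delta>0"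
    then have \<delta>: "0 < \<delta>" "R * exp (R * a) * (C1 * \<delta>) < e / 2"
      "real N * (C1 * \<delta>) / a * (R * \<eta> * exp (R * b)) < e / 2"
      "exp (R * b) * (real N * (exp (- a / \<delta>) + C1 * \<delta> / a)) < e / 2"
      "\<delta> * R \<le> 1/4" "\<delta> * ln (real P) < a" "\<delta> * Y0 < a" "q1 \<delta> < e"
      using small[of \<delta>] by auto
    \<comment> \<open>Break points on the scale of ln p: block 0 runs from ln P to a / \<delta> and
      serves the constant, block \<open>Suc i\<close> corresponds to the window from
      \<open>x i\<close> to \<open>x (Suc i)\<close>.\<close>
    define Y where "Y = (\<lambda>j. case j of 0 \<Rightarrow> ln (real P) | Suc i \<Rightarrow> x i / \<delta>)"
    have Y_simps: "Y 0 = ln (real P)" "Y (Suc j) = x j / \<delta>" for j by (simp_all add: Y_def)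
    have "mono Y"
    proof (rule mono_iff_le_Suc[THEN iffD2], rule allI)
      fix j show "Y j \<le> Y (Suc j)"
      proof (cases j)
        case 0
        have "ln (real P) \<le> a / \<delta>" using \<delta> by (simp add: field_simps)
        then show ?thesis using 0 by (simp add: Y_simps x_def)
      next
        case (Suc i)
        then show ?thesis using x(3)[of i] \<delta>(1) by (simp add: Y_simps divide_right_mono)
      qed
    qed
    note Y_mono = monoD[OF this]
    define B where "B = (\<lambda>j. primes_window (Y j) (Y (Suc j)))"
    have B: "p > 0" "Y j < ln (real p)" "ln (real p) \<le> Y (Suc j)" if "p \<in> B j" for p j
      using that by (auto simp: B_def primes_window_def dest: prime_gt_0_nat)
    have disj: "B i \<inter> B j = {}" if "i \<noteq> j" for i j
    proof (cases "i < j")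
      case True
      then show ?thesis unfolding B_def by (intro primes_window_disjoint Y_mono) auto
    next
      case False
      then show ?thesis using that unfolding B_def Int_commute[of "primes_window (Y i) _"]
        by (intro primes_window_disjoint Y_mono) auto
    qed
    define z where "z = (\<lambda>j. case j of 0 \<Rightarrow> C - D | Suc i \<Rightarrow> (LINT y:{x i<..x (Suc i)}|lebesgue. g y))"
    \<comment> \<open>The possible shortfall of weight: the target of a window can be as large as
      \<eta> / x i, while Mertens' theorem only guarantees (\<eta> - C1 \<delta>) / x (Suc i). Block
      0 has no shortfall.\<close>
    define er where "er = (\<lambda>j::nat. case j of 0 \<Rightarrow> 0 | Suc i \<Rightarrow> \<eta>\<^sup>2 / a\<^sup>2 + C1 * \<delta> / a)"
    have z_le: "norm (z j) \<le> (\<Sum>p\<in>B j. 1 / real p) + er j" for j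
    proof (cases j)
      case 0
      have "Y0 \<le> a / \<delta>" using \<delta> by (simp add: field_simps)
      from Y0[OF this] show ?thesis using 0 by (simp add: z_def er_def B_def Y_simps x_def)
    next
      case (Suc i)
      have "norm (z j) \<le> \<eta> / x i"
        using kernel_window(2)[OF meas bound x(4)[of i] x(3)[of i]] x(2)[of i] by (simp add: z_def Suc)
      also have "\<eta> / x i = (\<eta> - C1 * \<delta>) / x (Suc i) + (\<eta>\<^sup>2 / (x i * x (Suc i)) + C1 * \<delta> / x (Suc i))"
      proof -
        have "x (Suc i) = x i + \<eta>" using x(2)[of i] by simp
        then show ?thesis using x(4)[of i] \<eta>(1) by (simp add: divide_simps) (simp add: algebra_simps power2_eq_square)
      qed
      also have "\<dots> \<le> (\<Sum>p\<in>B j. 1 / real p) + er j"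
      proof (intro add_mono)
        have "(\<eta> - C1 * \<delta>) / x (Suc i) = (x (Suc i) / \<delta> - x i / \<delta> - C1) / (x (Suc i) / \<delta>)"
        proof -
          have "x (Suc i) / \<delta> - x i / \<delta> - C1 = (\<eta> - C1 * \<delta>) / \<delta>"
            using \<delta>(1) unfolding x(2)[of i, symmetric] by (simp add: diff_divide_distrib)
          then show ?thesis using \<delta>(1) by simp
        qed
        also have "\<dots> \<le> (\<Sum>p\<in>B j. 1 / real p)"
          unfolding B_def Suc Y_simps using x(3,4)[of i] x(4)[of "Suc i"] \<delta>(1)
          by (intro C1(3) divide_right_mono) auto
        finally show "(\<eta> - C1 * \<delta>) / x (Suc i) \<le> (\<Sum>p\<in>B j. 1 / real p)" .
        have "\<eta>\<^sup>2 / (x i * x (Suc i)) \<le> \<eta>\<^sup>2 / (a * a)"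
          using x ab by (intro divide_left_mono mult_mono mult_pos_pos) (auto intro: less_imp_le)
        moreover have "C1 * \<delta> / x (Suc i) \<le> C1 * \<delta> / a"
          using x ab C1 \<delta> by (intro divide_left_mono mult_pos_pos) auto
        ultimately show "\<eta>\<^sup>2 / (x i * x (Suc i)) + C1 * \<delta> / x (Suc i) \<le> er j"
          by (simp add: er_def Suc power2_eq_square)
      qed
      finally show ?thesis .
    qed
    have er0: "0 \<le> er j" for j
      using ab C1 \<delta> by (auto simp: er_def split: nat.splits intro!: add_nonneg_nonneg divide_nonneg_nonneg)
    \<comment> \<open>The largest weight in a block is the accuracy of the greedy choice
      there.\<close>
    have weight: "1 / real p \<le> exp (- Y j)" if "p \<in> B j" for j p
    proof -
      have "exp (Y j) \<le> real p"
        using B[OF that] by (metis exp_ln exp_le_cancel_iff less_imp_le of_nat_0_less_iff)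
      then show ?thesis by (simp add: exp_minus field_simps B(1)[OF that])
    qed
    obtain \<omega> where \<omega>: "\<And>p. norm (\<omega> p) = 1" "\<And>p. p \<notin> (\<Union>j. B j) \<Longrightarrow> \<omega> p = 1"
      "\<And>j. j \<le> N \<Longrightarrow> norm ((\<Sum>p\<in>B j. of_real (1 / real p) * \<omega> p) - z j) \<le> exp (- Y j) + er j"
      using unimodular_block_approx[of B "\<lambda>p. 1 / real p" "\<lambda>j. exp (- Y j)" N z er] disj weight z_le er0
      by (auto simp: B_def)
    \<comment> \<open>The primes up to M are exactly those with x = \<delta> ln p \<le> b.\<close>
    define M where "M = nat \<lfloor>exp (b / \<delta>)\<rfloor>"
    have lnP_le: "ln (real P) \<le> b / \<delta>" using \<delta>(1,6) ab by (simp add: field_simps)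
    have "P \<le> M"
    proof -
      have "real P \<le> exp (b / \<delta>)"
        using lnP_le P(3) by (metis exp_ln exp_le_cancel_iff of_nat_0_less_iff less_le_trans zero_less_numeral)
      then show ?thesis unfolding M_def by linarith
    qed
    have M_split: "primes_le M = primes_le P \<union> primes_window (ln (real P)) (b / \<delta>)"
      "primes_le P \<inter> primes_window (ln (real P)) (b / \<delta>) = {}"
    proof -
      have less: "ln (real P) < ln (real p) \<longleftrightarrow> P < p" if "prime p" for p
        using P(3) prime_gt_0_nat[OF that] by simp
      show "primes_le M = primes_le P \<union> primes_window (ln (real P)) (b / \<delta>)"
        unfolding M_def primes_ln_le_eq[symmetric] primes_window_def
        using less lnP_le \<open>P \<le> M\<close> ln_le_iff_le_exp[of _ "b / \<delta>"] unfolding M_def by (auto simp: not_less)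
      show "primes_le P \<inter> primes_window (ln (real P)) (b / \<delta>) = {}"
        using less by (auto simp: primes_window_def)
    qed
    show "\<exists>M\<ge>M0. \<exists>\<omega>. (\<forall>p. norm (\<omega> p) = 1) \<and>
      (\<forall>s\<in>K. norm ((\<Sum>p\<in>primes_le M. - Ln (1 - \<omega> p * of_nat p powr (- (1 + of_real \<delta> * s))))
       - (C + (LINT x:{0<..}|lebesgue. g x * exp (- s * of_real x)))) \<le> \<epsilon>)"
    proof (intro exI[of _ M] exI[of _ \<omega>] conjI allI ballI \<omega>(1))
      show "M0 \<le> M" using \<open>P \<le> M\<close> P(4) by simp
      fix s assume s: "s \<in> K"
      have sR: "norm s \<le> R" using R(1)[OF s] .
      define w where "w = (\<lambda>p. \<omega> p * of_nat p powr (- (1 + of_real \<delta> * s)))"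
      define L where "L = (\<lambda>A. LINT x:A|lebesgue. g x * exp (- s * of_real x))"
      define W where "W = primes_window (ln (real P)) (b / \<delta>)"
      define S where "S = (\<Sum>j<N. exp (- s * of_real (x j)) * z (Suc j))"
      have notB: "p \<notin> (\<Union>j. B j)" if "p \<in> primes_le P" for p
      proof
        assume "p \<in> (\<Union>j. B j)"
        then obtain j where "p \<in> B j" by blast
        then have "ln (real P) < ln (real p)"
          using Y_mono[of 0 j] B(2)[of p j] by (simp add: Y_simps)
        moreover have "0 < p" using B(1)[OF \<open>p \<in> B j\<close>] .
        ultimately show False using that P(3) by simp
      qed
      have E1: "norm ((\<Sum>p\<in>primes_le P. - Ln (1 - w p)) - D) \<le> e"
      proof -
        have "(\<Sum>p\<in>primes_le P. - Ln (1 - w p)) = (\<Sum>p\<in>primes_le P. - Ln (1 - of_nat p powr (- (1 + of_real \<delta> * s))))"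
          by (intro sum.cong refl) (simp only: w_def \<omega>(2)[OF notB] mult_1_left)
        moreover have "norm ((\<Sum>p\<in>primes_le P. - Ln (1 - of_nat p powr (- (1 + of_real \<delta> * s)))) - D) \<le> q1 \<delta>"
          unfolding D_def q1_def using sR \<delta>(1,5) R(2) by (rule small_primes_error)
        ultimately show ?thesis using \<delta>(8) by simp
      qed
      have E2: "norm ((\<Sum>p\<in>W. - Ln (1 - w p)) - (\<Sum>p\<in>W. w p)) \<le> e"
      proof -
        have "norm ((\<Sum>p\<in>W. - Ln (1 - w p)) - (\<Sum>p\<in>W. w p)) \<le> 4 * real P powr (-1/2)"
          unfolding w_def
        proof (rule linearization_error[OF _ _ P(3) \<omega>(1) sR \<delta>(1,5)])
          fix p assume "p \<in> W"
          then have "ln (real P) < ln (real p)" "0 < p" by (auto simp: W_def primes_window_def dest: prime_gt_0_nat)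
          then show "P < p" using P(3) by simp
        qed (simp add: W_def)
        then show ?thesis using P(1) by simp
      qed
      have W_blocks: "(\<Sum>p\<in>W. w p) = (\<Sum>p\<in>B 0. w p) + (\<Sum>j<N. \<Sum>p\<in>B (Suc j). w p)"
      proof -
        have "(\<Sum>p\<in>W. w p) = (\<Sum>j\<le>N. \<Sum>p\<in>B j. w p)"
          using sum_primes_window_blocks[OF \<open>mono Y\<close>, of w N] by (simp add: W_def B_def Y_simps xN)
        then show ?thesis by (simp add: sum.atMost_shift)
      qed
      have E3: "norm ((\<Sum>p\<in>B 0. w p) - (C - D)) \<le> e + e"
      proof -
        have "norm ((\<Sum>p\<in>B 0. w p) - exp (- s * of_real 0) * z 0)
            \<le> R * exp (R * a) * (\<Sum>p\<in>B 0. (\<delta> * ln (real p) - 0) / real p)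
              + exp (R * 0) * norm ((\<Sum>p\<in>B 0. of_real (1 / real p) * \<omega> p) - z 0)"
          unfolding w_def
        proof (rule block_error_le[OF _ \<omega>(1) _ _ _ sR])
          fix p assume p: "p \<in> B 0"
          have "\<delta> * ln (real p) \<le> \<delta> * (a / \<delta>)"
            using B(3)[OF p] \<delta>(1) by (intro mult_left_mono) (auto simp: Y_simps x_def)
          then show "p > 0 \<and> 0 \<le> \<delta> * ln (real p) \<and> \<delta> * ln (real p) \<le> a"
            using B[OF p] \<delta>(1) lnP by (auto simp: Y_simps)
        qed (use ab in \<open>auto simp: B_def\<close>)
        also have "\<dots> \<le> R * exp (R * a) * (a + C1 * \<delta>) + 1 * e"
        proof (intro add_mono mult_mono)
          have "(\<Sum>p\<in>B 0. (\<delta> * ln (real p) - 0) / real p) = \<delta> * (\<Sum>p\<in>B 0. ln (real p) / real p)"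
            by (simp add: sum_distrib_left)
          also have "\<dots> \<le> \<delta> * (Y 1 - Y 0 + C1)"
            unfolding B_def One_nat_def using lnP Y_mono[of 0 1] \<delta>(1)
            by (intro mult_left_mono C1(2)) (auto simp: Y_simps)
          also have "\<dots> \<le> \<delta> * (a / \<delta> + C1)"
            using lnP \<delta>(1) by (intro mult_left_mono) (auto simp: Y_simps x_def)
          also have "\<dots> = a + C1 * \<delta>" using \<delta>(1) by (simp add: field_simps)
          finally show "(\<Sum>p\<in>B 0. (\<delta> * ln (real p) - 0) / real p) \<le> a + C1 * \<delta>" .
          have "norm ((\<Sum>p\<in>B 0. of_real (1 / real p) * \<omega> p) - z 0) \<le> exp (- Y 0) + er 0"
            by (rule \<omega>(3)) simp
          also have "exp (- Y 0) + er 0 = 1 / real P"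
            using P(3) by (simp add: Y_simps er_def exp_minus inverse_eq_divide)
          finally show "norm ((\<Sum>p\<in>B 0. of_real (1 / real p) * \<omega> p) - z 0) \<le> e" using P(2) by simp
          show "0 \<le> (\<Sum>p\<in>B 0. (\<delta> * ln (real p) - 0) / real p)"
          proof (rule sum_nonneg)
            fix p assume "p \<in> B 0"
            then have "0 \<le> ln (real p)" using B(2)[of p 0] lnP by (simp add: Y_simps)
            then show "0 \<le> (\<delta> * ln (real p) - 0) / real p" using \<delta>(1) by simp
          qed
        qed (use R in auto)
        also have "\<dots> \<le> e + e" using a_small \<delta>(2) by (simp add: algebra_simps)
        finally show ?thesis by (simp add: z_def)
      qed
      have E4: "norm ((\<Sum>j<N. \<Sum>p\<in>B (Suc j). w p) - S) \<le> e + e"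
      proof -
        have "norm (\<Sum>j<N. (\<Sum>p\<in>B (Suc j). w p) - exp (- s * of_real (x j)) * z (Suc j))
            \<le> (\<Sum>j<N. R * exp (R * b) * (\<eta> * ((\<eta> + C1 * \<delta>) / a)) + exp (R * b) * (exp (- a / \<delta>) + (\<eta>\<^sup>2 / a\<^sup>2 + C1 * \<delta> / a)))"
        proof (rule sum_norm_le)
          fix j assume j: "j \<in> {..<N}"
          have xb: "x (Suc j) \<le> b" "x j \<le> b" using x_mono[of "Suc j" N] x_mono[of j N] j by (auto simp: xN)
          have p_bd: "p > 0" "x j \<le> \<delta> * ln (real p)" "\<delta> * ln (real p) \<le> x (Suc j)" if "p \<in> B (Suc j)" for p
          proof -
            show "p > 0" using B(1)[OF that] .
            have "x j / \<delta> < ln (real p)" "ln (real p) \<le> x (Suc j) / \<delta>"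
              using B(2,3)[OF that] by (simp_all add: Y_simps)
            then show "x j \<le> \<delta> * ln (real p)" "\<delta> * ln (real p) \<le> x (Suc j)"
              using \<delta>(1) by (simp_all add: field_simps)
          qed
          have "norm ((\<Sum>p\<in>B (Suc j). w p) - exp (- s * of_real (x j)) * z (Suc j))
            \<le> R * exp (R * x (Suc j)) * (\<Sum>p\<in>B (Suc j). (\<delta> * ln (real p) - x j) / real p)
              + exp (R * x j) * norm ((\<Sum>p\<in>B (Suc j). of_real (1 / real p) * \<omega> p) - z (Suc j))"
            unfolding w_def
            by (rule block_error_le[OF _ \<omega>(1) _ _ _ sR]) (use p_bd x in \<open>auto simp: B_def intro: less_imp_le\<close>)
          also have "\<dots> \<le> R * exp (R * b) * (\<eta> * ((\<eta> + C1 * \<delta>) / a)) + exp (R * b) * (exp (- a / \<delta>) + (\<eta>\<^sup>2 / a\<^sup>2 + C1 * \<delta> / a))"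
          proof (intro add_mono mult_mono)
            have "(\<Sum>p\<in>B (Suc j). (\<delta> * ln (real p) - x j) / real p) \<le> (\<Sum>p\<in>B (Suc j). \<eta> * (\<delta> / a) * (ln (real p) / real p))"
            proof (rule sum_mono)
              fix p assume p: "p \<in> B (Suc j)"
              have "a \<le> \<delta> * ln (real p)" using p_bd(2)[OF p] x(1)[of j] by simp
              \<comment> \<open>Inserting this factor, which is at least 1 on the block, turns the
                weights 1/p into ln p / p, for which the upper bound is available.\<close>
              then have one: "1 \<le> \<delta> / a * ln (real p)" using ab by (simp add: field_simps)
              have "\<delta> * ln (real p) - x j \<le> \<eta> * 1" using p_bd(3)[OF p] x(2)[of j] by simp
              also have "\<dots> \<le> \<eta> * (\<delta> / a * ln (real p))" using one \<eta> by (intro mult_left_mono) auto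
              finally have "\<delta> * ln (real p) - x j \<le> \<eta> * (\<delta> / a * ln (real p))" .
              from divide_right_mono[OF this, of "real p"]
              show "(\<delta> * ln (real p) - x j) / real p \<le> \<eta> * (\<delta> / a) * (ln (real p) / real p)"
                by (simp add: mult.assoc)
            qed
            also have "\<dots> = \<eta> * (\<delta> / a) * (\<Sum>p\<in>B (Suc j). ln (real p) / real p)"
              by (simp add: sum_distrib_left)
            also have "\<dots> \<le> \<eta> * (\<delta> / a) * (x (Suc j) / \<delta> - x j / \<delta> + C1)"
              unfolding B_def Y_simps using \<eta> \<delta>(1) ab x(3,4)[of j]
              by (intro mult_left_mono C1(2) divide_right_mono) auto
            also have "\<dots> = \<eta> * ((\<eta> + C1 * \<delta>) / a)"
            proof -
              have "\<delta> * (x (Suc j) / \<delta> - x j / \<delta> + C1) = \<eta> + C1 * \<delta>"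
                using \<delta>(1) x(2)[of j] by (simp add: field_simps)
              then show ?thesis by (simp add: mult.assoc)
            qed
            finally show "(\<Sum>p\<in>B (Suc j). (\<delta> * ln (real p) - x j) / real p) \<le> \<eta> * ((\<eta> + C1 * \<delta>) / a)" .
            have "norm ((\<Sum>p\<in>B (Suc j). of_real (1 / real p) * \<omega> p) - z (Suc j)) \<le> exp (- Y (Suc j)) + er (Suc j)"
              using j by (intro \<omega>(3)) auto
            also have "\<dots> \<le> exp (- a / \<delta>) + (\<eta>\<^sup>2 / a\<^sup>2 + C1 * \<delta> / a)"
              using x(1)[of j] \<delta>(1) by (simp add: Y_simps er_def divide_right_mono)
            finally show "norm ((\<Sum>p\<in>B (Suc j). of_real (1 / real p) * \<omega> p) - z (Suc j)) \<le> exp (- a / \<delta>) + (\<eta>\<^sup>2 / a\<^sup>2 + C1 * \<delta> / a)" .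
            show "0 \<le> (\<Sum>p\<in>B (Suc j). (\<delta> * ln (real p) - x j) / real p)"
              using p_bd by (intro sum_nonneg divide_nonneg_nonneg) auto
          qed (use R xb in auto)
          finally show "norm ((\<Sum>p\<in>B (Suc j). w p) - exp (- s * of_real (x j)) * z (Suc j))
            \<le> R * exp (R * b) * (\<eta> * ((\<eta> + C1 * \<delta>) / a)) + exp (R * b) * (exp (- a / \<delta>) + (\<eta>\<^sup>2 / a\<^sup>2 + C1 * \<delta> / a))" .
        qed
        \<comment> \<open>The terms are grouped so that N \<eta> = b - a can be substituted: two of
          them are small by the choice of N, the other two by the choice of \<delta>.\<close>
        also have "\<dots> = (real N * \<eta>) / a * (R * \<eta> * exp (R * b)) + real N * (C1 * \<delta>) / a * (R * \<eta> * exp (R * b))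
            + (exp (R * b) * (real N * \<eta>) * \<eta> / a\<^sup>2 + exp (R * b) * (real N * (exp (- a / \<delta>) + C1 * \<delta> / a)))"
          using ab(1) by (simp add: field_simps power2_eq_square)
        also have "\<dots> \<le> e + e"
          using N(1,2) \<delta>(3,4) unfolding \<eta>(2) \<eta>_def[symmetric] by linarith
        finally show ?thesis by (simp add: S_def sum_subtractf)
      qed
      have E5: "norm (S - L {a<..b}) \<le> e"
      proof -
        have x_eq: "a + real j * \<eta> = x j" for j by (simp add: x_def)
        have "norm (S - L {a<..b}) \<le> real N * (\<eta> / a * (R * \<eta> * exp (R * b)))"
          using kernel_riemann_sum[OF meas bound ab(1) less_imp_le[OF \<eta>(1)] sR, of N]
          unfolding S_def L_def z_def by (simp only: x_eq xN nat.case)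
        also have "\<dots> = (real N * \<eta>) / a * (R * \<eta> * exp (R * b))" by simp
        also have "\<dots> \<le> e" using N(1) \<open>e > 0\<close> unfolding \<eta>(2) \<eta>_def[symmetric] by linarith
        finally show ?thesis .
      qed
      have E6: "norm (L {a<..b} - L {0<..}) \<le> e" unfolding L_def by (rule ab(4)[OF s])
      have "(\<Sum>p\<in>primes_le M. - Ln (1 - w p)) = (\<Sum>p\<in>primes_le P. - Ln (1 - w p)) + (\<Sum>p\<in>W. - Ln (1 - w p))"
        unfolding W_def M_split(1) by (intro sum.union_disjoint M_split(2)) auto
      then have "(\<Sum>p\<in>primes_le M. - Ln (1 - w p)) - (C + L {0<..}) =
          ((\<Sum>p\<in>primes_le P. - Ln (1 - w p)) - D) + ((\<Sum>p\<in>W. - Ln (1 - w p)) - (\<Sum>p\<in>W. w p))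
          + ((\<Sum>p\<in>B 0. w p) - (C - D)) + ((\<Sum>j<N. \<Sum>p\<in>B (Suc j). w p) - S) + (S - L {a<..b}) + (L {a<..b} - L {0<..})"
        using W_blocks by (simp add: algebra_simps)
      also have "norm \<dots> \<le> e + e + (e + e) + (e + e) + e + e"
        using E1 E2 E3 E4 E5 E6 by (intro norm_triangle_mono)
      also have "\<dots> = \<epsilon>" by (simp add: e_def)
      finally show "norm ((\<Sum>p\<in>primes_le M. - Ln (1 - \<omega> p * of_nat p powr (- (1 + of_real \<delta> * s))))
         - (C + (LINT x:{0<..}|lebesgue. g x * exp (- s * of_real x)))) \<le> \<epsilon>"
        by (simp add: w_def L_def)
    qed
  qed
qed

section \<open>Universality\<close>

text \<open>The integrand at \<open>s0\<close> dominates all others. Continuity of f on K is needed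
  for the openness, and so the measurability, of the set of good t.\<close>

lemma continuous_laplace:
  fixes g :: "real \<Rightarrow> complex"
  assumes meas: "set_borel_measurable lebesgue {0<..} g"
    and int: "\<And>s. s \<in> K \<Longrightarrow> set_integrable lebesgue {0<..} (\<lambda>x. g x * exp (- s * of_real x))"
    and s0: "s0 \<in> K" "\<And>s. s \<in> K \<Longrightarrow> Re s0 \<le> Re s"
  shows "continuous_on K (\<lambda>s. LINT x:{0<..}|lebesgue. g x * exp (- s * of_real x))"
proof (rule continuous_on_sequentiallyI)
  fix u s assume u: "\<forall>n. u n \<in> K" "s \<in> K" "u \<longlonglongrightarrow> s"
  let ?F = "\<lambda>s x. indicator {0<..} x *\<^sub>R (g x * exp (- s * of_real x))"
  have "(\<lambda>n. integral\<^sup>L lebesgue (?F (u n))) \<longlonglongrightarrow> integral\<^sup>L lebesgue (?F s)"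
  proof (rule integral_dominated_convergence[where w = "\<lambda>x. norm (?F s0 x)"])
    show "?F s \<in> borel_measurable lebesgue" "\<And>n. ?F (u n) \<in> borel_measurable lebesgue"
      using int u(1,2) unfolding set_integrable_def by (blast intro: borel_measurable_integrable)+
    show "integrable lebesgue (\<lambda>x. norm (?F s0 x))"
      using int[OF s0(1)] unfolding set_integrable_def by (rule integrable_norm)
    show "AE x in lebesgue. (\<lambda>n. ?F (u n) x) \<longlonglongrightarrow> ?F s x"
      by (intro AE_I2 tendsto_intros u(3))
    show "AE x in lebesgue. norm (?F (u n) x) \<le> norm (?F s0 x)" for n
    proof (rule AE_I2)
      fix x :: real
      have "Re s0 \<le> Re (u n)" using s0(2) u(1) by blast
      then show "norm (?F (u n) x) \<le> norm (?F s0 x)"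
        by (cases "x > 0") (auto simp: norm_mult norm_exp_eq_Re intro!: mult_left_mono mult_right_mono)
    qed
  qed
  then show "(\<lambda>n. LINT x:{0<..}|lebesgue. g x * exp (- u n * of_real x)) \<longlonglongrightarrow> (LINT x:{0<..}|lebesgue. g x * exp (- s * of_real x))"
    by (simp add: set_lebesgue_integral_def)
qed

text \<open>The conditions are open in the pair (t, s), relative to s in K; compactness of K and the
  tube lemma turn the quantifier over K into an open condition on t.\<close>

lemma open_log_zeta_approx_set:
  fixes K :: "complex set" and f :: "complex \<Rightarrow> complex" and \<delta> \<epsilon> :: real
  assumes "compact K" and f: "continuous_on K f"
  shows "open {t::real. \<forall>s\<in>K. log_zeta_defined (1 + \<i> * of_real t + of_real \<delta> * s) \<and>
           norm (log_zeta (1 + \<i> * of_real t + of_real \<delta> * s) - f s) < \<epsilon>}"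
    (is "open ?O")
proof -
  define \<phi> where "\<phi> = (\<lambda>(t::real, s). 1 + \<i> * of_real t + of_real \<delta> * s)"
  have \<phi>: "continuous_on A \<phi>" for A
    unfolding \<phi>_def split_beta by (intro continuous_intros)
  define X where "X = (UNIV :: real set) \<times> K"
  define S where "S = X \<inter> \<phi> -` {z. log_zeta_defined z}"
  have S: "openin (top_of_set X) S"
    unfolding S_def by (rule continuous_openin_preimage_gen[OF \<phi> open_log_zeta_defined])
  define F where "F = (\<lambda>q. norm (log_zeta (\<phi> q) - f (snd q)))"
  have "continuous_on S F"
    unfolding F_def
  proof (intro continuous_intros)
    show "continuous_on S (\<lambda>q. log_zeta (\<phi> q))"
      by (rule continuous_on_compose2[OF continuous_log_zeta \<phi>]) (auto simp: S_def)
    show "continuous_on S (\<lambda>q. f (snd q))"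
      by (rule continuous_on_compose2[OF f]) (auto simp: S_def X_def intro!: continuous_intros)
  qed
  then have "openin (top_of_set S) (S \<inter> F -` {..<\<epsilon>})"
    by (rule continuous_openin_preimage_gen) simp
  then have "openin (top_of_set X) (S \<inter> F -` {..<\<epsilon>})"
    using S by (rule openin_trans)
  then obtain W where W: "open W" "S \<inter> F -` {..<\<epsilon>} = X \<inter> W"
    by (auto simp: openin_open)
  have O_iff: "t \<in> ?O \<longleftrightarrow> {t} \<times> K \<subseteq> W" for t
  proof -
    have "t \<in> ?O \<longleftrightarrow> (\<forall>s\<in>K. (t, s) \<in> S \<inter> F -` {..<\<epsilon>})"
      by (auto simp: S_def F_def X_def \<phi>_def)
    also have "\<dots> \<longleftrightarrow> {t} \<times> K \<subseteq> W" unfolding W(2) by (auto simp: X_def)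
    finally show ?thesis .
  qed
  show ?thesis
  proof (subst open_subopen, intro ballI)
    fix t assume "t \<in> ?O"
    then have "{t} \<times> K \<subseteq> W" by (simp only: O_iff)
    then obtain A where "t \<in> A" "open A" "A \<times> K \<subseteq> W"
      using Elementary_Topology.tube_lemma[OF \<open>compact K\<close> W(1), of t] by blast
    moreover from this have "A \<subseteq> ?O"
      using O_iff by blast
    ultimately show "\<exists>T. open T \<and> t \<in> T \<and> T \<subseteq> ?O" by blast
  qed
qed

text \<open>As |\<delta> s| \<le> 1/64, the point z lies in a half strip of half-width 1/32 starting
  at 31/32. Up to real part 3/2 the strip fits into the disc of radius 9/16 = 17/32 + 1/32; further
  right M > 16 makes the absolutely convergent bound 2 / sqrt M less than 1/2. The logarithm of the
  sieved function contributes 2 e, and each prime contributes 3 * 2/3 * \<eta>.\<close>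

lemma log_zeta_near_euler_sum:
  fixes \<omega> :: "nat \<Rightarrow> complex"
  assumes M: "M > 16" and \<omega>: "\<And>p. norm (\<omega> p) = 1"
    and s: "norm s \<le> R" and \<delta>: "0 < \<delta>" "\<delta> * R \<le> 1/64"
    and phase: "\<And>p. p \<in> primes_le M \<Longrightarrow> norm (cis (- (ln (real p) * t)) - \<omega> p) \<le> \<eta>"
    and near: "\<And>w. norm (w - (3/2 + \<i> * of_real t)) \<le> 9/16 \<Longrightarrow> norm (sieved_zeta M w - 1) \<le> e" and e: "e < 1/2"
  defines "z \<equiv> 1 + \<i> * of_real t + of_real \<delta> * s"
  shows "log_zeta_defined z"
    and "norm (log_zeta z - (\<Sum>p\<in>primes_le M. - Ln (1 - \<omega> p * of_nat p powr (- (1 + of_real \<delta> * s))))) \<le> 2 * e + 2 * real M * \<eta>"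
proof -
  have \<delta>s: "norm (of_real \<delta> * s) \<le> 1/64"
  proof -
    have "\<delta> * norm s \<le> 1/64" using mult_left_mono[OF s, of \<delta>] \<delta> by linarith
    then show ?thesis using \<delta>(1) by (simp add: norm_mult)
  qed
  have Re_z: "\<bar>Re z - 1\<bar> \<le> 1/64" and Im_z: "\<bar>Im z - t\<bar> \<le> 1/64"
    using abs_Re_le_cmod[of "of_real \<delta> * s"] abs_Im_le_cmod[of "of_real \<delta> * s"] \<delta>s by (simp_all add: z_def)
  have ball: "norm (w - (3/2 + \<i> * of_real t)) \<le> 9/16" if "w \<in> half_strip (31/32) t (1/32)" "Re w \<le> 3/2" for w
  proof -
    have "norm (w - (3/2 + \<i> * of_real t)) \<le> \<bar>Re (w - (3/2 + \<i> * of_real t))\<bar> + \<bar>Im (w - (3/2 + \<i> * of_real t))\<bar>"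
      by (rule cmod_le)
    also have "\<dots> \<le> 17/32 + 1/32"
    proof (rule add_mono)
      show "\<bar>Re (w - (3/2 + \<i> * of_real t))\<bar> \<le> 17/32" "\<bar>Im (w - (3/2 + \<i> * of_real t))\<bar> \<le> 1/32"
        using that unfolding half_strip_def abs_le_iff by auto
    qed
    finally show ?thesis by simp
  qed
  have strip: "norm (sieved_zeta M w - 1) < 1/2" if w: "w \<in> half_strip (31/32) t (1/32)" for w
  proof (cases "Re w \<le> 3/2")
    case True
    then show ?thesis using near[OF ball[OF w True]] e by simp
  next
    case False
    then have "norm (sieved_zeta M w - 1) \<le> real M powr (- (1/2)) / (1/2)"
      using M by (intro norm_sieved_zeta_minus_1_le) auto
    also have "real M powr (- (1/2)) < 16 powr (- (1/2))"
      using M by (intro powr_less_mono2_neg) auto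
    also have "(16::real) powr (- (1/2)) = 1/4"
      by (simp add: powr_minus powr_half_sqrt real_sqrt_unique)
    finally show ?thesis by simp
  qed
  have z_strip: "z \<in> half_strip (31/32) t (1/32)"
    using Re_z Im_z unfolding half_strip_def abs_le_iff by auto
  have "M > 2" using M by simp
  note log = log_zeta_eq_sieved[OF _ this strip z_strip]
  show "log_zeta_defined z" using log(1) by simp
  have eq: "log_zeta z = Ln (sieved_zeta M z) - (\<Sum>p\<in>primes_le M. Ln (1 - of_nat p powr (- z)))"
    using log(2) by simp
  have small: "norm (sieved_zeta M z - 1) \<le> e"
    using Re_z by (intro near ball[OF z_strip]) linarith
  then have "norm (Ln (1 + (sieved_zeta M z - 1))) \<le> 2 * norm (sieved_zeta M z - 1)"
    using e by (intro norm_Ln_le) simp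
  then have L: "norm (Ln (sieved_zeta M z)) \<le> 2 * e" using small by simp
  let ?x = "\<lambda>p. of_nat p powr (- (1 + of_real \<delta> * s)) :: complex"
  have "norm (\<Sum>p\<in>primes_le M. - Ln (1 - of_nat p powr (- z)) - - Ln (1 - \<omega> p * ?x p)) \<le> (\<Sum>p\<in>primes_le M. 2 * \<eta>)"
  proof (rule sum_norm_le)
    fix p assume p: "p \<in> primes_le M"
    then have p2: "p \<ge> 2" "p > 0" by (auto dest: prime_ge_2_nat)
    have x: "norm (?x p) \<le> 2/3"
      using norm_prime_powr_scaled_le[OF p2(2) s \<delta>(1)] \<delta>(2) powr_three_quarters_le[OF p2(1)] by linarith
    have "z = (1 + of_real \<delta> * s) + \<i> * of_real t" by (simp add: z_def)
    then have pz: "of_nat p powr (- z) = cis (- (ln (real p) * t)) * ?x p"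
      using powr_vertical_shift[OF p2(2), of "1 + of_real \<delta> * s" t] by (simp only: mult.commute)
    have "norm (Ln (1 - of_nat p powr (- z)) - Ln (1 - \<omega> p * ?x p)) \<le> 3 * norm (of_nat p powr (- z) - \<omega> p * ?x p)"
      using x by (intro norm_Ln_one_minus_diff_le) (simp_all only: pz norm_mult norm_cis \<omega> mult_1_left)
    also have "of_nat p powr (- z) - \<omega> p * ?x p = (cis (- (ln (real p) * t)) - \<omega> p) * ?x p"
      by (simp add: pz left_diff_distrib)
    also have "3 * norm \<dots> \<le> 3 * (\<eta> * (2/3))"
      unfolding norm_mult using x phase[OF p] order_trans[OF norm_ge_zero phase[OF p]]
      by (intro mult_left_mono mult_mono) auto
    finally show "norm (- Ln (1 - of_nat p powr (- z)) - - Ln (1 - \<omega> p * ?x p)) \<le> 2 * \<eta>"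
      by (simp add: norm_minus_commute)
  qed
  also have "\<dots> = real (card (primes_le M)) * (2 * \<eta>)" by simp
  also have "\<dots> \<le> real M * (2 * \<eta>)"
  proof (intro mult_right_mono)
    have "card (primes_le M) \<le> card {1..M}"
      by (intro card_mono) (auto simp: Suc_leI prime_gt_0_nat)
    then show "real (card (primes_le M)) \<le> real M" by simp
    have "2 \<in> primes_le M" using M by simp
    from order_trans[OF norm_ge_zero phase[OF this]] show "0 \<le> 2 * \<eta>" by simp
  qed
  finally have S: "norm (\<Sum>p\<in>primes_le M. - Ln (1 - of_nat p powr (- z)) - - Ln (1 - \<omega> p * ?x p)) \<le> 2 * real M * \<eta>"
    by simp
  have "log_zeta z - (\<Sum>p\<in>primes_le M. - Ln (1 - \<omega> p * ?x p)) =
      Ln (sieved_zeta M z) + (\<Sum>p\<in>primes_le M. - Ln (1 - of_nat p powr (- z)) - - Ln (1 - \<omega> p * ?x p))"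
    unfolding eq sum_subtractf sum_negf by simp
  then show "norm (log_zeta z - (\<Sum>p\<in>primes_le M. - Ln (1 - \<omega> p * ?x p))) \<le> 2 * e + 2 * real M * \<eta>"
    using L S by (simp only:) (rule norm_triangle_mono)
qed

theorem theorem2:
  fixes K :: "complex set" and C :: complex and g :: "real \<Rightarrow> complex"
    and f :: "complex \<Rightarrow> complex" and \<epsilon> :: real
  assumes "compact K" and "connected (- K)"
    and "set_borel_measurable lebesgue {0<..} g"
    and "\<And>x. x > 0 \<Longrightarrow> norm (of_real x * g x) \<le> 1"
    and "\<And>s. s \<in> K \<Longrightarrow> set_integrable lebesgue {0<..} (\<lambda>x. g x * exp (- s * of_real x))"
    and "\<And>s. s \<in> K \<Longrightarrow> f s = C + (LINT x:{0<..}|lebesgue. g x * exp (- s * of_real x))"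
    and "\<epsilon> > 0"
  shows "\<exists>\<delta>\<^sub>0>0. \<forall>\<delta>::real. 0 < \<delta> \<and> \<delta> \<le> \<delta>\<^sub>0 \<longrightarrow>
    Liminf at_top (\<lambda>T::real. ereal (1 / T * measure lebesgue
      {t \<in> {0..T}. \<forall>s\<in>K. log_zeta_defined (1 + \<i> * of_real t + of_real \<delta> * s) \<and>
         norm (log_zeta (1 + \<i> * of_real t + of_real \<delta> * s) - f s) < \<epsilon>})) > 0"
proof -
  define A where "A = (\<lambda>\<delta> T. {t \<in> {0..T}. \<forall>s\<in>K. log_zeta_defined (1 + \<i> * of_real t + of_real \<delta> * s) \<and>
         norm (log_zeta (1 + \<i> * of_real t + of_real \<delta> * s) - f s) < \<epsilon>})"
  have liminf: "Liminf at_top (\<lambda>T::real. ereal (1 / T * measure lebesgue (A \<delta> T))) > 0"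
    if c: "c > 0" and T0: "\<And>T. T \<ge> T0 \<Longrightarrow> c * T \<le> measure lebesgue (A \<delta> T)" for \<delta> c T0
  proof -
    have "eventually (\<lambda>T. T \<ge> max 1 T0) at_top" by (rule eventually_ge_at_top)
    then have "eventually (\<lambda>T. ereal c \<le> ereal (1 / T * measure lebesgue (A \<delta> T))) at_top"
      by eventually_elim (use T0 in \<open>auto simp: field_simps\<close>)
    then have "ereal c \<le> Liminf at_top (\<lambda>T::real. ereal (1 / T * measure lebesgue (A \<delta> T)))"
      by (rule Liminf_bounded)
    moreover have "0 < ereal c" using c by simp
    ultimately show ?thesis by (rule less_le_trans[rotated])
  qed
  show ?thesis
  proof (cases "K = {}")
    case True
    have "1 * T \<le> measure lebesgue (A \<delta> T)" if "T \<ge> 0" for \<delta> T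
    proof -
      have "A \<delta> T = {0..T}" using True by (auto simp: A_def)
      then show ?thesis using that by simp
    qed
    from liminf[OF zero_less_one this] show ?thesis
      unfolding A_def by (intro exI[of _ 1]) simp
  next
    case False
    obtain R' where R': "\<And>s. s \<in> K \<Longrightarrow> norm s \<le> R'"
      using compact_imp_bounded[OF assms(1)] unfolding bounded_iff by blast
    define R where "R = max R' 1"
    have R: "\<And>s. s \<in> K \<Longrightarrow> norm s \<le> R" "R > 0" using R' by (auto simp: R_def intro: le_max_iff_disj[THEN iffD2])
    have "continuous_on K Re" by (intro continuous_intros)
    then obtain s0 where s0: "s0 \<in> K" "\<And>s. s \<in> K \<Longrightarrow> Re s0 \<le> Re s"
      using continuous_attains_inf[OF assms(1) False] by blast
    have "continuous_on K (\<lambda>s. C + (LINT x:{0<..}|lebesgue. g x * exp (- s * of_real x)))"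
      by (intro continuous_intros continuous_laplace[OF assms(3,5) s0])
    then have cont_f: "continuous_on K f" by (rule continuous_on_eq) (use assms(6) in simp)
    \<comment> \<open>The 1/4 keeps the sieved function within 1/2 of 1, as its logarithm requires;
      the \<epsilon> / 8 bounds the contribution 2 e of that logarithm.\<close>
    define e where "e = min (1/4) (\<epsilon> / 8)"
    have e: "e > 0" "e < 1/2" "2 * e \<le> \<epsilon> / 4" using assms(7) by (auto simp: e_def)
    have "((\<lambda>M. 160 * real M powr (-3/4)) \<longlonglongrightarrow> 0)" by real_asymp
    then have "eventually (\<lambda>M. 160 * real M powr (-3/4) < e\<^sup>2) sequentially"
      by (rule order_tendstoD) (use e in simp)
    then obtain M0 where M0: "\<And>M. M \<ge> M0 \<Longrightarrow> 160 * real M powr (-3/4) < e\<^sup>2"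
      unfolding eventually_sequentially by blast
    have "\<epsilon> / 4 > 0" using assms(7) by simp
    from finite_euler_product_approx[OF assms(3,4,5) R s0 this, of "max 17 M0" C]
    obtain \<delta>1 where \<delta>1: "\<delta>1 > 0" and approx: "\<And>\<delta>. 0 < \<delta> \<Longrightarrow> \<delta> < \<delta>1 \<Longrightarrow> (\<exists>M\<ge>max 17 M0. \<exists>\<omega>. (\<forall>p. norm (\<omega> p) = 1) \<and>
      (\<forall>s\<in>K. norm ((\<Sum>p\<in>primes_le M. - Ln (1 - \<omega> p * of_nat p powr (- (1 + of_real \<delta> * s))))
       - (C + (LINT x:{0<..}|lebesgue. g x * exp (- s * of_real x)))) \<le> \<epsilon> / 4))" by blast
    \<comment> \<open>Halving \<open>\<delta>1\<close> turns the strict bound on \<delta> into a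
      non-strict one; the second term keeps \<delta> s within 1/64.\<close>
    define \<delta>0 where "\<delta>0 = min (\<delta>1 / 2) (1 / (64 * R))"
    have "\<delta>0 > 0" using \<delta>1 R by (simp add: \<delta>0_def)
    moreover have "Liminf at_top (\<lambda>T::real. ereal (1 / T * measure lebesgue (A \<delta> T))) > 0"
      if \<delta>: "0 < \<delta>" "\<delta> \<le> \<delta>0" for \<delta>
    proof -
      have "\<delta> < \<delta>1" using \<delta> \<delta>1 by (simp add: \<delta>0_def)
      have "\<delta> * R \<le> 1 / (64 * R) * R" using \<delta> R by (intro mult_right_mono) (auto simp: \<delta>0_def)
      then have \<delta>R: "\<delta> * R \<le> 1/64" using R by simp
      from approx[OF \<delta>(1) \<open>\<delta> < \<delta>1\<close>]
      obtain M \<omega> where M: "M \<ge> max 17 M0" and \<omega>': "\<forall>p. norm (\<omega> p :: complex) = 1"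
        and euler': "\<forall>s\<in>K. norm ((\<Sum>p\<in>primes_le M. - Ln (1 - \<omega> p * of_nat p powr (- (1 + of_real \<delta> * s))))
          - (C + (LINT x:{0<..}|lebesgue. g x * exp (- s * of_real x)))) \<le> \<epsilon> / 4"
        by (elim exE conjE)
      have \<omega>: "norm (\<omega> p) = 1" for p using \<omega>' by blast
      have euler: "norm ((\<Sum>p\<in>primes_le M. - Ln (1 - \<omega> p * of_nat p powr (- (1 + of_real \<delta> * s)))) - f s) \<le> \<epsilon> / 4"
        if "s \<in> K" for s
        using bspec[OF euler' that] unfolding assms(6)[OF that] .
      \<comment> \<open>The tolerance scales with 1/M because the errors of up to M primes add up.
        The total is at most \<epsilon>/4 + \<epsilon>/8 + \<epsilon>/4 < \<epsilon>.\<close>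
      define \<eta> where "\<eta> = \<epsilon> / (16 * real M)"
      have \<eta>: "\<eta> > 0" "2 * real M * \<eta> = \<epsilon> / 8" using M assms(7) by (auto simp: \<eta>_def)
      have "M > 0" "M > 16" using M by auto
      have "160 * real M powr (-3/4) \<le> e\<^sup>2" using M0[of M] M by simp
      note large = this
      obtain c T0 where c: "c > 0" and T0: "T0 \<ge> 4"
        and G: "\<And>T. T \<ge> T0 \<Longrightarrow> \<exists>G. G \<in> lmeasurable \<and> G \<subseteq> {T..2*T} \<and> c * T \<le> measure lebesgue G \<and>
       (\<forall>t\<in>G. (\<forall>p\<in>primes_le M. norm (cis (- (ln (real p) * t)) - \<omega> p) \<le> \<eta>) \<and>
              (\<forall>w. norm (w - (3/2 + \<i> * of_real t)) \<le> 9/16 \<longrightarrow> norm (sieved_zeta M w - 1) \<le> e))"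
        by (rule positive_density_good_shifts[of \<omega> M \<eta> e, OF \<omega> \<open>M > 0\<close> \<eta>(1) e(1) large]) blast
      show ?thesis
      proof (rule liminf)
        show "c / 2 > 0" using c by simp
        fix T assume T: "T \<ge> 2 * T0"
        \<comment> \<open>The good shifts in the upper half of {0..T} already suffice; halving T
          turns the density c into c / 2.\<close>
        obtain G where G: "G \<in> lmeasurable" "G \<subseteq> {T/2..2*(T/2)}" "c * (T/2) \<le> measure lebesgue G"
          "\<And>t p. t \<in> G \<Longrightarrow> p \<in> primes_le M \<Longrightarrow> norm (cis (- (ln (real p) * t)) - \<omega> p) \<le> \<eta>"
          "\<And>t w. t \<in> G \<Longrightarrow> norm (w - (3/2 + \<i> * of_real t)) \<le> 9/16 \<Longrightarrow> norm (sieved_zeta M w - 1) \<le> e"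
          using G[of "T/2"] T by auto
        have "G \<subseteq> A \<delta> T"
        proof
          fix t assume t: "t \<in> G"
          have "t \<in> {0..T}" using G(2) t T T0 by auto
          moreover have "log_zeta_defined (1 + \<i> * of_real t + of_real \<delta> * s) \<and>
             norm (log_zeta (1 + \<i> * of_real t + of_real \<delta> * s) - f s) < \<epsilon>" if s: "s \<in> K" for s
          proof -
            note near = log_zeta_near_euler_sum[OF \<open>M > 16\<close> \<omega> R(1)[OF s] \<delta>(1) \<delta>R G(4)[OF t] G(5)[OF t] e(2)]
            define E where "E = (\<Sum>p\<in>primes_le M. - Ln (1 - \<omega> p * of_nat p powr (- (1 + of_real \<delta> * s))))"
            define z where "z = 1 + \<i> * of_real t + of_real \<delta> * s"
            have 1: "norm (log_zeta z - E) \<le> 2 * e + 2 * real M * \<eta>" using near(2) by (simp add: E_def z_def)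
            have 2: "norm (E - f s) \<le> \<epsilon> / 4" using euler[OF s] by (simp add: E_def)
            have "norm ((log_zeta z - E) + (E - f s)) \<le> (2 * e + 2 * real M * \<eta>) + \<epsilon> / 4"
              using 1 2 by (rule norm_triangle_mono)
            also have "\<dots> < \<epsilon>" using e(3) \<eta>(2) assms(7) by simp
            finally show ?thesis using near(1) by (simp add: z_def)
          qed
          ultimately show "t \<in> A \<delta> T" by (simp add: A_def)
        qed
        \<comment> \<open>Not a formality: monotonicity of \<open>measure\<close> needs it, as a
          non-measurable set has measure 0 by convention.\<close>
        moreover have "A \<delta> T \<in> lmeasurable"
        proof -
          have "A \<delta> T = {0..T} \<inter> {t. \<forall>s\<in>K. log_zeta_defined (1 + \<i> * of_real t + of_real \<delta> * s) \<and>
             norm (log_zeta (1 + \<i> * of_real t + of_real \<delta> * s) - f s) < \<epsilon>}"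
            by (auto simp: A_def)
          then show ?thesis
            using open_log_zeta_approx_set[OF assms(1) cont_f, of \<delta> \<epsilon>]
            by (simp only:) (intro fmeasurable_Int_fmeasurable, auto)
        qed
        ultimately have "measure lebesgue G \<le> measure lebesgue (A \<delta> T)"
          using G(1) by (intro measure_mono_fmeasurable) auto
        then show "c / 2 * T \<le> measure lebesgue (A \<delta> T)" using G(3) by simp
      qed
    qed
    ultimately show ?thesis unfolding A_def by blast
  qed
qed

end
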